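(* Let $\mathcal C$ be a rigid C*-tensor category with simple unit $\mathbbm 1$ and at most countably many isomorphism classes of simple objects. Let $S\subseteq\mathrm{Irr}$ be a finite, symmetric, generating set, let $\nu:S\to(0,\infty)$ be a symmetric weight function, and let $\Delta\in\mathbb C[\mathcal C]$ be the Laplacian element of $(\mathcal C,S,\nu)$. Then $\Delta\ge 0$ in $\mathbb C[\mathcal C]$ with respect to the tube cone, i.e. $\Delta\in\Sigma^2\mathcal C$.
   Context: Conventions: C*-tensor categories are strict, essentially small, and closed under finite direct sums and passage to sub-objects. $\mathcal C(x,y)$ is the space of morphisms from $x$ to $y$. Rigid means every object $X$ has a conjugate $\overline X$ with $R\in\mathcal C(\mathbbm 1,\overline X\otimes X)$, $\overline R\in\mathcal C(\mathbbm 1,X\otimes\overline X)$ such that $(1_{\overline X}\otimes\overline R^* )(R\otimes 1_{\overline X})=1_{\overline X}$ and $(1_X\otimes R^* )(\overline R\otimes 1_X)=1_X$; the pair $(R,\overline R)$ is standard if $R^*(1\otimes f)R=\overline R^*(f\otimes 1)\overline R$ for all $f\in\mathrm{End}(X)$. Standard solutions $(R_X,\overline R_X)$ are fixed for all objects (fixed for irreducibles and extended by naturality). The categorical dimension is $d(X)=R_X^*R_X=\overline R_X^*\overline R_X$. $\mathrm{Irr}$ is a fixed set of representatives of the isomorphism classes of simple objects (with $\mathbbm 1\in \mathrm{Irr}$); simple objects are not distinguished from their classes. Fusion algebra: $\mathbb C[\mathcal C]$ is the unital $*$-algebra with linear basis $\mathrm{Irr}$, product $x\cdot y=\sum_{z\in\mathrm{Irr}}\dim\mathcal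 C(z,x\otimes y)\,z$, involution the conjugate-linear extension of $x^*=\overline x$, and unit $\mathbbm 1$. Tube algebra: $\mathcal A=\bigoplus_{x,y\in\mathrm{Irr}}\mathcal A_{x,y}$, $\mathcal A_{x,y}=\bigoplus_{w\in\mathrm{Irr}}\mathcal A^w_{x,y}$, $\mathcal A^w_{x,y}=\mathcal C(w\otimes x,y\otimes w)$. For an object $z$ and $\gamma\in\mathcal C(z\otimes x,y\otimes z)$, let $\Psi^z_{x,y}(\gamma)\in\mathcal A_{x,y}$ be the element with $w$-component $\sum_{\alpha}(1_y\otimes\alpha^* )\gamma(\alpha\otimes 1_x)$, where $\alpha$ runs over an orthonormal basis of $\mathcal C(w,z)$ for the inner product $\tau^*\sigma=\langle\sigma,\tau\rangle 1_w$. Every element of $\mathcal A_{x,y}$ is of this form for some $z,\gamma$. $\mathcal A$ is a $*$-algebra via the (well-defined) operations $\Psi^{z_1}_{x_1,y_1}(\gamma_1)\cdot\Psi^{z_2}_{x_2,y_2}(\gamma_2)=\delta_{x_1=y_2}\Psi^{z_1\otimes z_2}_{x_2,y_1}\big((\gamma_1\otimes 1_{z_2})(1_{z_1}\otimes\gamma_2)\big)\in\mathcal A_{x_2,y_1}$ and $\Psi^z_{x,y}(\gamma)^*=\Psi^{\overline z}_{y,x}\big((R_z^*\otimes 1_x\otimes 1_{\overline z})(1_{\overline z}\otimes\gamma^*\otimes 1_{\overline z})(1_{\overline z}\otimes 1_y\otimes\overline R_z)\big)\in\mathcal A_{y,x}$. The map $w\mapsto\Psi^w_{\mathbbm 1,\mathbbm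 1}(1_w)$ ($w\in\mathrm{Irr}$) is a unital $*$-isomorphism $\mathbb C[\mathcal C]\cong\mathcal A_{\mathbbm 1,\mathbbm 1}$, used as an identification. Tube cone: $\Sigma^2\mathcal C=\{\sum_{i=1}^n a_ia_i^*: n\in\mathbb N,\ a_i\in\mathcal A_{x_i,\mathbbm 1}\text{ for some }x_i\in\mathrm{Irr}\}\subseteq\mathbb C[\mathcal C]$. An element $x\in\mathbb C[\mathcal C]$ is positive, written $x\ge0$, if $x\in\Sigma^2\mathcal C$. Laplacian: $S\subseteq\mathrm{Irr}$ is symmetric if $\alpha\in S\iff\overline\alpha\in S$; it is generating if every $\alpha\in\mathrm{Irr}$ is a sub-object of $s_1\otimes\cdots\otimes s_n$ for some $s_1,\dots,s_n\in S$. $\nu:S\to(0,\infty)$ is symmetric if $\nu(\alpha)=\nu(\overline\alpha)$ for all $\alpha\in S$. For $S$ finite, $\Delta=\mathbbm 1-\frac1\kappa\sum_{\alpha\in S}\nu(\alpha)\alpha\in\mathbb C[\mathcal C]$ with $\kappa=\sum_{\alpha\in S}\nu(\alpha)d(\alpha)$. *)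

theory Defs
  imports "HOL-Analysis.Analysis"
begin

section \<open>Strict C*-tensor categories\<close>

text \<open>
  The objects are the elements of a type \<open>'o\<close> (so the category is automatically small).  All
  morphism spaces are linear subspaces of one ambient vector space \<open>'m\<close>, for instance the direct
  sum of all of them.  Composition, adjoint, tensor product and norm are functions on \<open>'m\<close> that are
  only constrained on the morphism spaces.  \<open>Hom C x y\<close> is the space of morphisms from \<open>x\<close> to \<open>y\<close>,
  and \<open>comp C g f\<close> is \<open>g\<close> after \<open>f\<close>.
\<close>

record ('o, 'm) tensor_cat =
  Hom :: "'o \<Rightarrow> 'o \<Rightarrow> 'm set"
  idm :: "'o \<Rightarrow> 'm"
  comp :: "'m \<Rightarrow> 'm \<Rightarrow> 'm"  (infixr \<open>\<cdot>\<index>\<close> 68)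
  adj :: "'m \<Rightarrow> 'm"  (\<open>_\<^sup>\<dagger>\<index>\<close> [1000] 999)
  cscale :: "complex \<Rightarrow> 'm \<Rightarrow> 'm"
  mnorm :: "'m \<Rightarrow> real"
  tunit :: "'o"  (\<open>\<one>\<index>\<close>)
  otens :: "'o \<Rightarrow> 'o \<Rightarrow> 'o"  (infixr \<open>\<odot>\<index>\<close> 72)
  mtens :: "'m \<Rightarrow> 'm \<Rightarrow> 'm"  (infixr \<open>\<otimes>\<index>\<close> 72)

locale cstar_category =
  fixes C :: "('o, 'm::ab_group_add) tensor_cat" (structure)
  assumes vector_space_cscale: "vector_space (cscale C)"
    and subspace_Hom: "module.subspace (cscale C) (Hom C x y)"
    and idm_in: "idm C x \<in> Hom C x x"
    and comp_in: "\<lbrakk>f \<in> Hom C x y; g \<in> Hom C y z\<rbrakk> \<Longrightarrow> g \<cdot> f \<in> Hom C x z"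
    and comp_idm: "f \<in> Hom C x y \<Longrightarrow> f \<cdot> idm C x = f"
    and idm_comp: "f \<in> Hom C x y \<Longrightarrow> idm C y \<cdot> f = f"
    and comp_assoc:
      "\<lbrakk>f \<in> Hom C w x; g \<in> Hom C x y; h \<in> Hom C y z\<rbrakk> \<Longrightarrow> (h \<cdot> g) \<cdot> f = h \<cdot> (g \<cdot> f)"
    and comp_add_left:
      "\<lbrakk>f \<in> Hom C x y; g \<in> Hom C y z; g' \<in> Hom C y z\<rbrakk> \<Longrightarrow> (g + g') \<cdot> f = g \<cdot> f + g' \<cdot> f"
    and comp_add_right:
      "\<lbrakk>f \<in> Hom C x y; f' \<in> Hom C x y; g \<in> Hom C y z\<rbrakk> \<Longrightarrow> g \<cdot> (f + f') = g \<cdot> f + g \<cdot> f'"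
    and comp_cscale_left:
      "\<lbrakk>f \<in> Hom C x y; g \<in> Hom C y z\<rbrakk> \<Longrightarrow> cscale C c g \<cdot> f = cscale C c (g \<cdot> f)"
    and comp_cscale_right:
      "\<lbrakk>f \<in> Hom C x y; g \<in> Hom C y z\<rbrakk> \<Longrightarrow> g \<cdot> cscale C c f = cscale C c (g \<cdot> f)"
    and mnorm_nonneg: "f \<in> Hom C x y \<Longrightarrow> 0 \<le> mnorm C f"
    and mnorm_eq_0_iff: "f \<in> Hom C x y \<Longrightarrow> mnorm C f = 0 \<longleftrightarrow> f = 0"
    and mnorm_triangle:
      "\<lbrakk>f \<in> Hom C x y; g \<in> Hom C x y\<rbrakk> \<Longrightarrow> mnorm C (f + g) \<le> mnorm C f + mnorm C g"
    and mnorm_cscale: "f \<in> Hom C x y \<Longrightarrow> mnorm C (cscale C c f) = cmod c * mnorm C f"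
    and mnorm_complete: "Metric_space.mcomplete (Hom C x y) (\<lambda>f g. mnorm C (f - g))"
    and mnorm_comp:
      "\<lbrakk>f \<in> Hom C x y; g \<in> Hom C y z\<rbrakk> \<Longrightarrow> mnorm C (g \<cdot> f) \<le> mnorm C g * mnorm C f"
    and adj_in: "f \<in> Hom C x y \<Longrightarrow> f\<^sup>\<dagger> \<in> Hom C y x"
    and adj_adj: "f \<in> Hom C x y \<Longrightarrow> (f\<^sup>\<dagger>)\<^sup>\<dagger> = f"
    and adj_add: "\<lbrakk>f \<in> Hom C x y; g \<in> Hom C x y\<rbrakk> \<Longrightarrow> (f + g)\<^sup>\<dagger> = f\<^sup>\<dagger> + g\<^sup>\<dagger>"
    and adj_cscale: "f \<in> Hom C x y \<Longrightarrow> (cscale C c f)\<^sup>\<dagger> = cscale C (cnj c) (f\<^sup>\<dagger>)"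
    and adj_comp: "\<lbrakk>f \<in> Hom C x y; g \<in> Hom C y z\<rbrakk> \<Longrightarrow> (g \<cdot> f)\<^sup>\<dagger> = f\<^sup>\<dagger> \<cdot> g\<^sup>\<dagger>"
    and cstar_identity: "f \<in> Hom C x y \<Longrightarrow> mnorm C (f\<^sup>\<dagger> \<cdot> f) = (mnorm C f)\<^sup>2"
    and adj_comp_positive: "f \<in> Hom C x y \<Longrightarrow> \<exists>h\<in>Hom C x x. f\<^sup>\<dagger> \<cdot> f = h\<^sup>\<dagger> \<cdot> h"

locale cstar_tensor_category = cstar_category +
  assumes otens_assoc: "(x \<odot> y) \<odot> z = x \<odot> (y \<odot> z)"
    and otens_unit_left: "\<one> \<odot> x = x"
    and otens_unit_right: "x \<odot> \<one> = x"
    and mtens_in: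
      "\<lbrakk>f \<in> Hom C x y; g \<in> Hom C x' y'\<rbrakk> \<Longrightarrow> f \<otimes> g \<in> Hom C (x \<odot> x') (y \<odot> y')"
    and mtens_idm: "idm C x \<otimes> idm C y = idm C (x \<odot> y)"
    and mtens_comp:
      "\<lbrakk>f \<in> Hom C x y; g \<in> Hom C y z; f' \<in> Hom C x' y'; g' \<in> Hom C y' z'\<rbrakk>
        \<Longrightarrow> (g \<cdot> f) \<otimes> (g' \<cdot> f') = (g \<otimes> g') \<cdot> (f \<otimes> f')"
    and mtens_add_left:
      "\<lbrakk>f \<in> Hom C x y; f' \<in> Hom C x y; g \<in> Hom C x' y'\<rbrakk>
        \<Longrightarrow> (f + f') \<otimes> g = f \<otimes> g + f' \<otimes> g"
    and mtens_add_right: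
      "\<lbrakk>f \<in> Hom C x y; g \<in> Hom C x' y'; g' \<in> Hom C x' y'\<rbrakk>
        \<Longrightarrow> f \<otimes> (g + g') = f \<otimes> g + f \<otimes> g'"
    and mtens_cscale_left:
      "\<lbrakk>f \<in> Hom C x y; g \<in> Hom C x' y'\<rbrakk> \<Longrightarrow> cscale C c f \<otimes> g = cscale C c (f \<otimes> g)"
    and mtens_cscale_right:
      "\<lbrakk>f \<in> Hom C x y; g \<in> Hom C x' y'\<rbrakk> \<Longrightarrow> f \<otimes> cscale C c g = cscale C c (f \<otimes> g)"
    and mtens_assoc:
      "\<lbrakk>f \<in> Hom C x y; g \<in> Hom C x' y'; h \<in> Hom C x'' y''\<rbrakk>
        \<Longrightarrow> (f \<otimes> g) \<otimes> h = f \<otimes> (g \<otimes> h)"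
    and mtens_unit_left: "f \<in> Hom C x y \<Longrightarrow> idm C \<one> \<otimes> f = f"
    and mtens_unit_right: "f \<in> Hom C x y \<Longrightarrow> f \<otimes> idm C \<one> = f"
    and adj_mtens: "\<lbrakk>f \<in> Hom C x y; g \<in> Hom C x' y'\<rbrakk> \<Longrightarrow> (f \<otimes> g)\<^sup>\<dagger> = f\<^sup>\<dagger> \<otimes> g\<^sup>\<dagger>"
    and direct_sums:
      "\<exists>z. \<exists>u\<in>Hom C x z. \<exists>v\<in>Hom C y z.
        u\<^sup>\<dagger> \<cdot> u = idm C x \<and> v\<^sup>\<dagger> \<cdot> v = idm C y \<and> u \<cdot> u\<^sup>\<dagger> + v \<cdot> v\<^sup>\<dagger> = idm C z"
    and subobjects:
      "\<lbrakk>p \<in> Hom C x x; p\<^sup>\<dagger> = p; p \<cdot> p = p\<rbrakk>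
        \<Longrightarrow> \<exists>y. \<exists>v\<in>Hom C y x. v\<^sup>\<dagger> \<cdot> v = idm C y \<and> v \<cdot> v\<^sup>\<dagger> = p"

section \<open>Simple objects and conjugates\<close>

context
  fixes C :: "('o, 'm::ab_group_add) tensor_cat" (structure)
begin

definition simple_obj :: "'o \<Rightarrow> bool" where
  "simple_obj x \<longleftrightarrow> idm C x \<noteq> 0 \<and> Hom C x x = range (\<lambda>c. cscale C c (idm C x))"

definition iso_obj :: "'o \<Rightarrow> 'o \<Rightarrow> bool" where
  "iso_obj x y \<longleftrightarrow>
    (\<exists>f\<in>Hom C x y. \<exists>g\<in>Hom C y x. g \<cdot> f = idm C x \<and> f \<cdot> g = idm C y)"

definition subobject :: "'o \<Rightarrow> 'o \<Rightarrow> bool" where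
  "subobject x y \<longleftrightarrow> (\<exists>v\<in>Hom C x y. v\<^sup>\<dagger> \<cdot> v = idm C x)"

definition simple_classes :: "'o set set" where
  "simple_classes =
    {x. simple_obj x} // {(x, y). simple_obj x \<and> simple_obj y \<and> iso_obj x y}"

definition irr_representatives :: "'o set \<Rightarrow> bool" where
  "irr_representatives Irr \<longleftrightarrow>
    Irr \<subseteq> {x. simple_obj x} \<and> \<one> \<in> Irr \<and> (\<forall>y. simple_obj y \<longrightarrow> (\<exists>!x. x \<in> Irr \<and> iso_obj y x))"

definition irr_rep :: "'o set \<Rightarrow> 'o \<Rightarrow> 'o" where
  "irr_rep Irr y = (THE x. x \<in> Irr \<and> iso_obj y x)"

definition conj_solution :: "'o \<Rightarrow> 'o \<Rightarrow> 'm \<Rightarrow> 'm \<Rightarrow> bool" where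
  "conj_solution x xb r rb \<longleftrightarrow>
    r \<in> Hom C \<one> (xb \<odot> x) \<and> rb \<in> Hom C \<one> (x \<odot> xb) \<and>
    (idm C xb \<otimes> rb\<^sup>\<dagger>) \<cdot> (r \<otimes> idm C xb) = idm C xb \<and>
    (idm C x \<otimes> r\<^sup>\<dagger>) \<cdot> (rb \<otimes> idm C x) = idm C x"

definition rigid :: bool where
  "rigid \<longleftrightarrow> (\<forall>x. \<exists>xb r rb. conj_solution x xb r rb)"

text \<open>
  A choice of a conjugate \<open>cj x\<close> and of a standard solution \<open>(R x, Rb x)\<close> for every object \<open>x\<close>.
  Standard solutions for a fixed conjugate are unique up to a unitary, which does not affect the
  constructions below.
\<close>

definition standard_solutions :: "('o \<Rightarrow> 'o) \<Rightarrow> ('o \<Rightarrow> 'm) \<Rightarrow> ('o \<Rightarrow> 'm) \<Rightarrow> bool" where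
  "standard_solutions cj R Rb \<longleftrightarrow>
    (\<forall>x. conj_solution x (cj x) (R x) (Rb x) \<and>
      (\<forall>f\<in>Hom C x x.
        (R x)\<^sup>\<dagger> \<cdot> (idm C (cj x) \<otimes> f) \<cdot> R x = (Rb x)\<^sup>\<dagger> \<cdot> (f \<otimes> idm C (cj x)) \<cdot> Rb x))"

definition cat_dim :: "('o \<Rightarrow> 'm) \<Rightarrow> 'o \<Rightarrow> real" where
  "cat_dim R x = (THE d. (R x)\<^sup>\<dagger> \<cdot> R x = cscale C (complex_of_real d) (idm C \<one>))"

section \<open>The tube algebra\<close>

text \<open>
  The tube algebra is given by its blocks \<open>\<A>\<^sub>x\<^sub>,\<^sub>y\<close>.  An element of \<open>\<A>\<^sub>x\<^sub>,\<^sub>y\<close> is the function sending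
  \<open>w\<close> to its component in \<open>\<A>\<^sup>w\<^sub>x\<^sub>,\<^sub>y\<close>.
\<close>

definition tube_block :: "'o set \<Rightarrow> 'o \<Rightarrow> 'o \<Rightarrow> ('o \<Rightarrow> 'm) set" where
  "tube_block Irr x y =
    {a. (\<forall>w\<in>Irr. a w \<in> Hom C (w \<odot> x) (y \<odot> w)) \<and> (\<forall>w. w \<notin> Irr \<longrightarrow> a w = 0) \<and>
        finite {w. a w \<noteq> 0}}"

text \<open>
  For simple \<open>w\<close> the inner product on \<open>Hom C w z\<close> is determined by
  \<open>t\<^sup>\<dagger> \<cdot> s = \<langle>s, t\<rangle> id\<^sub>w\<close>.
\<close>

definition orthonormal_basis :: "'o \<Rightarrow> 'o \<Rightarrow> 'm set \<Rightarrow> bool" where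
  "orthonormal_basis w z B \<longleftrightarrow>
    finite B \<and> B \<subseteq> Hom C w z \<and>
    (\<forall>s\<in>B. \<forall>t\<in>B. t\<^sup>\<dagger> \<cdot> s = (if s = t then idm C w else 0)) \<and>
    module.span (cscale C) B = Hom C w z"

definition tube_Psi :: "'o set \<Rightarrow> 'o \<Rightarrow> 'o \<Rightarrow> 'o \<Rightarrow> 'm \<Rightarrow> 'o \<Rightarrow> 'm" where
  "tube_Psi Irr x y z \<gamma> =
    (\<lambda>w. if w \<in> Irr
      then \<Sum>\<alpha>\<in>(SOME B. orthonormal_basis w z B).
        (idm C y \<otimes> \<alpha>\<^sup>\<dagger>) \<cdot> \<gamma> \<cdot> (\<alpha> \<otimes> idm C x)
      else 0)"

text \<open>
  The product \<open>\<A>\<^sub>u\<^sub>,\<^sub>y \<times> \<A>\<^sub>x\<^sub>,\<^sub>u \<rightarrow> \<A>\<^sub>x\<^sub>,\<^sub>y\<close> and the involution \<open>\<A>\<^sub>x\<^sub>,\<^sub>y \<rightarrow> \<A>\<^sub>y\<^sub>,\<^sub>x\<close>, given through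
  arbitrary presentations of the arguments as values of \<open>\<Psi>\<close>; the results do not depend on the
  presentations.  Products of non-composable blocks are zero and are left out.
\<close>

definition tube_mult ::
    "'o set \<Rightarrow> 'o \<Rightarrow> 'o \<Rightarrow> 'o \<Rightarrow> ('o \<Rightarrow> 'm) \<Rightarrow> ('o \<Rightarrow> 'm) \<Rightarrow> 'o \<Rightarrow> 'm" where
  "tube_mult Irr x u y a b =
    (THE c. \<exists>z\<^sub>1 z\<^sub>2. \<exists>\<gamma>\<^sub>1\<in>Hom C (z\<^sub>1 \<odot> u) (y \<odot> z\<^sub>1). \<exists>\<gamma>\<^sub>2\<in>Hom C (z\<^sub>2 \<odot> x) (u \<odot> z\<^sub>2).
      a = tube_Psi Irr u y z\<^sub>1 \<gamma>\<^sub>1 \<and> b = tube_Psi Irr x u z\<^sub>2 \<gamma>\<^sub>2 \<and>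
      c = tube_Psi Irr x y (z\<^sub>1 \<odot> z\<^sub>2) ((\<gamma>\<^sub>1 \<otimes> idm C z\<^sub>2) \<cdot> (idm C z\<^sub>1 \<otimes> \<gamma>\<^sub>2)))"

definition tube_star ::
    "'o set \<Rightarrow> ('o \<Rightarrow> 'o) \<Rightarrow> ('o \<Rightarrow> 'm) \<Rightarrow> ('o \<Rightarrow> 'm) \<Rightarrow> 'o \<Rightarrow> 'o \<Rightarrow> ('o \<Rightarrow> 'm) \<Rightarrow> 'o \<Rightarrow> 'm" where
  "tube_star Irr cj R Rb x y a =
    (THE c. \<exists>z. \<exists>\<gamma>\<in>Hom C (z \<odot> x) (y \<odot> z).
      a = tube_Psi Irr x y z \<gamma> \<and>
      c = tube_Psi Irr y x (cj z)
        (((R z)\<^sup>\<dagger> \<otimes> idm C x \<otimes> idm C (cj z)) \<cdot>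
         (idm C (cj z) \<otimes> \<gamma>\<^sup>\<dagger> \<otimes> idm C (cj z)) \<cdot>
         (idm C (cj z) \<otimes> idm C y \<otimes> Rb z)))"

section \<open>The fusion algebra and the tube cone\<close>

definition fusion_space :: "'o set \<Rightarrow> ('o \<Rightarrow> complex) set" where
  "fusion_space Irr = {c. finite {w. c w \<noteq> 0} \<and> {w. c w \<noteq> 0} \<subseteq> Irr}"

definition fusion_basis :: "'o \<Rightarrow> 'o \<Rightarrow> complex" where
  "fusion_basis \<alpha> = (\<lambda>w. if w = \<alpha> then 1 else 0)"

definition fusion_to_tube :: "'o set \<Rightarrow> ('o \<Rightarrow> complex) \<Rightarrow> 'o \<Rightarrow> 'm" where
  "fusion_to_tube Irr c =
    (\<lambda>v. \<Sum>w\<in>{w. c w \<noteq> 0}. cscale C (c w) (tube_Psi Irr \<one> \<one> w (idm C w) v))"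

definition tube_cone ::
    "'o set \<Rightarrow> ('o \<Rightarrow> 'o) \<Rightarrow> ('o \<Rightarrow> 'm) \<Rightarrow> ('o \<Rightarrow> 'm) \<Rightarrow> ('o \<Rightarrow> complex) set" where
  "tube_cone Irr cj R Rb =
    {c \<in> fusion_space Irr. \<exists>(n::nat) x a.
      (\<forall>i<n. x i \<in> Irr \<and> a i \<in> tube_block Irr (x i) \<one>) \<and>
      fusion_to_tube Irr c =
        (\<lambda>w. \<Sum>i<n. tube_mult Irr \<one> (x i) \<one> (a i) (tube_star Irr cj R Rb (x i) \<one> (a i)) w)}"

section \<open>The Laplacian\<close>

definition symmetric_set :: "'o set \<Rightarrow> ('o \<Rightarrow> 'o) \<Rightarrow> 'o set \<Rightarrow> bool" where
  "symmetric_set Irr cj S \<longleftrightarrow> (\<forall>\<alpha>\<in>Irr. \<alpha> \<in> S \<longleftrightarrow> irr_rep Irr (cj \<alpha>) \<in> S)"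

text \<open>Only nonempty words are allowed, so that a generating set is nonempty.\<close>

definition generating_set :: "'o set \<Rightarrow> 'o set \<Rightarrow> bool" where
  "generating_set Irr S \<longleftrightarrow>
    (\<forall>\<alpha>\<in>Irr. \<exists>ss. ss \<noteq> [] \<and> set ss \<subseteq> S \<and> subobject \<alpha> (foldr (otens C) ss \<one>))"

definition symmetric_weight :: "'o set \<Rightarrow> ('o \<Rightarrow> 'o) \<Rightarrow> 'o set \<Rightarrow> ('o \<Rightarrow> real) \<Rightarrow> bool" where
  "symmetric_weight Irr cj S \<nu> \<longleftrightarrow>
    (\<forall>\<alpha>\<in>S. \<nu> \<alpha> > 0 \<and> \<nu> \<alpha> = \<nu> (irr_rep Irr (cj \<alpha>)))"

definition weight_total :: "('o \<Rightarrow> 'm) \<Rightarrow> 'o set \<Rightarrow> ('o \<Rightarrow> real) \<Rightarrow> real" where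
  "weight_total R S \<nu> = (\<Sum>\<alpha>\<in>S. \<nu> \<alpha> * cat_dim R \<alpha>)"

definition laplacian :: "('o \<Rightarrow> 'm) \<Rightarrow> 'o set \<Rightarrow> ('o \<Rightarrow> real) \<Rightarrow> 'o \<Rightarrow> complex" where
  "laplacian R S \<nu> =
    (\<lambda>w. fusion_basis \<one> w -
      complex_of_real (1 / weight_total R S \<nu>) *
        (\<Sum>\<alpha>\<in>S. complex_of_real (\<nu> \<alpha>) * fusion_basis \<alpha> w))"

end

end

theory Submission
  imports Defs "HOL-Computational_Algebra.Fundamental_Theorem_Algebra"
begin

text \<open>
  For an element \<open>h\<close> of a group, \<open>2 - h - h\<inverse> = (1 - h) (1 - h)\<^sup>*\<close>, and the Laplacian of a finite
  symmetric set is a positive combination of such squares.  The same identity holds in the tube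
  algebra, with \<open>2\<close> replaced by twice the dimension.  Fix a simple object \<open>x\<close> with conjugate \<open>xb\<close>
  and standard solution \<open>(R, Rb)\<close>, put \<open>X = xb \<odot> x\<close>, and take \<open>z\<close> to be a direct sum of \<open>\<one>\<close> and \<open>x\<close>
  with isometries \<open>e\<close> and \<open>g\<close>.  The element \<open>a = \<Psi>\<^sup>z(\<Gamma>)\<close> with
  \<open>\<Gamma> = e R\<^sup>\<dagger> (e\<^sup>\<dagger> \<otimes> 1) - g (Rb\<^sup>\<dagger> \<otimes> 1) (g\<^sup>\<dagger> \<otimes> 1)\<close> plays the role of \<open>1 - h\<close>.  In
  \<open>a a\<^sup>*\<close> the two diagonal terms are closed loops, each equal to \<open>d(x) \<one>\<close>, and the two mixed
  terms straighten to \<open>x\<close> and \<open>xb\<close> by the conjugate equations.  Hence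
  \<open>a a\<^sup>* = 2 d(x) \<one> - x - xb\<close> (\<open>laplacian_square\<close>).  The object \<open>X\<close> need not be simple, but
  a decomposition of \<open>X\<close> into simple objects writes \<open>a a\<^sup>*\<close> as a sum of squares of elements of the blocks
  over \<open>Irr\<close> (\<open>tube_square_decomposition\<close>).  Summing over \<open>x\<close> in \<open>S\<close> with weights \<open>\<nu>(x) / 2\<kappa>\<close>
  gives the Laplacian, because conjugation permutes \<open>S\<close> and preserves \<open>\<nu>\<close>.

  Computing in the tube algebra requires that product and involution do not depend on the
  presentation of elements as \<open>\<Psi>\<^sup>z(\<gamma>)\<close>.  This is a universal property: \<open>\<Psi>\<close> is the universal family of
  additive maps on \<open>Hom (z \<odot> x) (y \<odot> z)\<close> that allows a morphism to be moved around the tube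
  (\<open>Psi_naturality\<close>, \<open>Psi_universal\<close>).  Product and involution are well defined since their
  formulas respect such moves (\<open>mult_dinatural_left\<close>, \<open>mult_dinatural_right\<close>, \<open>star_dinatural\<close>).

  The universal property rests on semisimplicity, \<open>1\<^sub>z = \<Sum> \<beta> \<beta>\<^sup>\<dagger>\<close> over orthonormal bases
  (\<open>resolution_of_identity\<close>), which in turn follows from rigidity.  Transposing projections of \<open>z\<close>
  into the Hilbert space \<open>Hom \<one> (zb \<odot> z)\<close> bounds the number of orthogonal ones
  (\<open>orth_projections_bounded\<close>).  Hence there are minimal projections and every endomorphism is a
  root of a polynomial.  Below a minimal projection every self-adjoint endomorphism is scalar, because
  an eigenspace would otherwise give a smaller projection (\<open>selfadjoint_scalar\<close>).
\<close>

section \<open>Linear algebra in C*-categories\<close>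

sublocale cstar_category \<subseteq> vs: vector_space "cscale C"
  by (rule vector_space_cscale)

context cstar_category
begin

lemma zero_in: "0 \<in> Hom C x y"
  by (rule vs.subspace_0[OF subspace_Hom])

lemma add_in: "f \<in> Hom C x y \<Longrightarrow> g \<in> Hom C x y \<Longrightarrow> f + g \<in> Hom C x y"
  by (rule vs.subspace_add[OF subspace_Hom])

lemma diff_in: "f \<in> Hom C x y \<Longrightarrow> g \<in> Hom C x y \<Longrightarrow> f - g \<in> Hom C x y"
  by (rule vs.subspace_diff[OF subspace_Hom])

lemma scale_in: "f \<in> Hom C x y \<Longrightarrow> cscale C c f \<in> Hom C x y"
  by (rule vs.subspace_scale[OF subspace_Hom])

lemma sum_in: "(\<And>i. i \<in> I \<Longrightarrow> f i \<in> Hom C x y) \<Longrightarrow> sum f I \<in> Hom C x y"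
  by (rule vs.subspace_sum[OF subspace_Hom])

lemmas hom_intros = zero_in add_in diff_in scale_in sum_in idm_in comp_in adj_in

lemma comp_zero_left: "f \<in> Hom C x y \<Longrightarrow> 0 \<cdot> f = 0"
  using comp_cscale_left[of f x y 0 y 0] zero_in by simp

lemma comp_zero_right: "g \<in> Hom C y z \<Longrightarrow> g \<cdot> 0 = 0"
  using comp_cscale_right[of 0 y y g z 0] zero_in by simp

lemma comp_diff_left:
  assumes "f \<in> Hom C x y" "g \<in> Hom C y z" "g' \<in> Hom C y z"
  shows "(g - g') \<cdot> f = g \<cdot> f - g' \<cdot> f"
  using comp_add_left[of f x y "g - g'" z g'] assms by (simp add: diff_in eq_diff_eq)

lemma comp_diff_right:
  assumes "f \<in> Hom C x y" "f' \<in> Hom C x y" "g \<in> Hom C y z"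
  shows "g \<cdot> (f - f') = g \<cdot> f - g \<cdot> f'"
  using comp_add_right[of "f - f'" x y f' g z] assms by (simp add: diff_in eq_diff_eq)

lemma comp_sum_left:
  assumes "f \<in> Hom C x y" "\<And>i. i \<in> I \<Longrightarrow> g i \<in> Hom C y z"
  shows "sum g I \<cdot> f = (\<Sum>i\<in>I. g i \<cdot> f)"
  using assms(2)
  by (induction I rule: infinite_finite_induct)
    (simp_all add: comp_zero_left[OF assms(1)] comp_add_left[OF assms(1), of _ z] sum_in)

lemma comp_sum_right:
  assumes "g \<in> Hom C y z" "\<And>i. i \<in> I \<Longrightarrow> f i \<in> Hom C x y"
  shows "g \<cdot> sum f I = (\<Sum>i\<in>I. g \<cdot> f i)"
  using assms(2)
  by (induction I rule: infinite_finite_induct)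
    (simp_all add: comp_zero_right[OF assms(1)] comp_add_right[of _ x y _ g z] assms(1) sum_in)

lemma comp_scaled_idm:
  "f \<in> Hom C x y \<Longrightarrow> f \<cdot> cscale C c (idm C x) = cscale C c f"
  using comp_cscale_right[OF idm_in] comp_idm by simp

lemma adj_zero: "0\<^sup>\<dagger> = 0"
  using adj_cscale[of 0 undefined undefined 0] zero_in by simp

lemma adj_diff:
  assumes "f \<in> Hom C x y" "g \<in> Hom C x y"
  shows "(f - g)\<^sup>\<dagger> = f\<^sup>\<dagger> - g\<^sup>\<dagger>"
  using adj_add[of "f - g" x y g] assms by (simp add: diff_in eq_diff_eq)

lemma adj_sum:
  assumes "\<And>i. i \<in> I \<Longrightarrow> f i \<in> Hom C x y"
  shows "(sum f I)\<^sup>\<dagger> = (\<Sum>i\<in>I. (f i)\<^sup>\<dagger>)"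
  using assms
  by (induction I rule: infinite_finite_induct)
    (simp_all add: adj_zero adj_add[of _ x y] sum_in)

lemma adj_idm: "(idm C x)\<^sup>\<dagger> = idm C x"
proof -
  have a: "(idm C x)\<^sup>\<dagger> \<in> Hom C x x"
    by (rule adj_in[OF idm_in])
  have "(idm C x)\<^sup>\<dagger> \<cdot> idm C x = (idm C x)\<^sup>\<dagger>"
    by (rule comp_idm[OF a])
  then have "((idm C x)\<^sup>\<dagger>)\<^sup>\<dagger> = (idm C x)\<^sup>\<dagger> \<cdot> ((idm C x)\<^sup>\<dagger>)\<^sup>\<dagger>"
    using adj_comp[OF idm_in a] by simp
  then show ?thesis
    using adj_adj[OF idm_in, of x] comp_idm[OF a] by simp
qed

lemma adj_comp_eq_0_iff:
  assumes "f \<in> Hom C x y"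
  shows "f\<^sup>\<dagger> \<cdot> f = 0 \<longleftrightarrow> f = 0"
  using cstar_identity[OF assms] mnorm_eq_0_iff[OF assms] mnorm_eq_0_iff[OF zero_in[of x x]]
    comp_zero_right[OF adj_in[OF assms]] by auto

lemma mnorm_0: "mnorm C 0 = 0"
  using mnorm_eq_0_iff[OF zero_in] by blast

lemma mnorm_projection:
  assumes "p \<in> Hom C x x" "p\<^sup>\<dagger> = p" "p \<cdot> p = p"
  shows "mnorm C p = (if p = 0 then 0 else 1)"
  using cstar_identity[OF assms(1)] assms mnorm_eq_0_iff[OF assms(1)]
  by (auto simp: power2_eq_square)

lemma mnorm_idm: "mnorm C (idm C x) = (if idm C x = 0 then 0 else 1)"
  by (rule mnorm_projection[OF idm_in adj_idm comp_idm[OF idm_in]])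

end

context cstar_tensor_category
begin

lemmas tensor_intros = hom_intros mtens_in

lemma mtens_zero_right: "f \<in> Hom C x y \<Longrightarrow> f \<otimes> 0 = 0"
  using mtens_cscale_right[of f x y 0 x x 0] zero_in by simp

lemma mtens_zero_left: "f \<in> Hom C x y \<Longrightarrow> 0 \<otimes> f = 0"
  using mtens_cscale_left[of 0 x x f x y 0] zero_in by simp

lemma mtens_sum_left:
  assumes "g \<in> Hom C x' y'" "\<And>i. i \<in> I \<Longrightarrow> f i \<in> Hom C x y"
  shows "sum f I \<otimes> g = (\<Sum>i\<in>I. f i \<otimes> g)"
  using assms(2)
  by (induction I rule: infinite_finite_induct)
    (simp_all add: mtens_zero_left[OF assms(1)] mtens_add_left[of _ x y _ g x' y'] assms(1) sum_in)

lemma mtens_sum_right: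
  assumes "f \<in> Hom C x y" "\<And>i. i \<in> I \<Longrightarrow> g i \<in> Hom C x' y'"
  shows "f \<otimes> sum g I = (\<Sum>i\<in>I. f \<otimes> g i)"
  using assms(2)
  by (induction I rule: infinite_finite_induct)
    (simp_all add: mtens_zero_right[OF assms(1)] mtens_add_right[of f x y _ x' y'] assms(1) sum_in)

lemma idm_mtens_comp:
  "f \<in> Hom C x y \<Longrightarrow> g \<in> Hom C y z \<Longrightarrow> idm C t \<otimes> (g \<cdot> f) = (idm C t \<otimes> g) \<cdot> (idm C t \<otimes> f)"
  using mtens_comp[OF idm_in[of t] idm_in[of t], of f x y g z] by (simp add: comp_idm[OF idm_in])

lemma comp_mtens_idm:
  "f \<in> Hom C x y \<Longrightarrow> g \<in> Hom C y z \<Longrightarrow> (g \<cdot> f) \<otimes> idm C t = (g \<otimes> idm C t) \<cdot> (f \<otimes> idm C t)"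
  using mtens_comp[OF _ _ idm_in[of t] idm_in[of t], of f x y g z] by (simp add: comp_idm[OF idm_in])

end

section \<open>String diagrams\<close>

text \<open>
  Since hom-spaces may overlap inside the ambient space, a bare morphism does not determine its source
  and target.  Carrying them along turns the side conditions of associativity and interchange into
  equations between objects, so that identities of string diagrams can be checked by rewriting.
\<close>

datatype ('o, 'm) arrow = Arrow (src: 'o) (tgt: 'o) (mor: 'm)

context cstar_tensor_category
begin

declare otens_assoc [simp] otens_unit_left [simp] otens_unit_right [simp]

definition valid :: "('a, 'b) arrow \<Rightarrow> bool" where
  "valid F \<longleftrightarrow> mor F \<in> Hom C (src F) (tgt F)"

definition aid :: "'a \<Rightarrow> ('a, 'b) arrow" where
  "aid x = Arrow x x (idm C x)"

definition acomp :: "('a, 'b) arrow \<Rightarrow> ('a, 'b) arrow \<Rightarrow> ('a, 'b) arrow"  (infixr \<open>\<star>\<close> 68) where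
  "G \<star> F = Arrow (src F) (tgt G) (mor G \<cdot> mor F)"

definition atens :: "('a, 'b) arrow \<Rightarrow> ('a, 'b) arrow \<Rightarrow> ('a, 'b) arrow"  (infixr \<open>\<diamondop>\<close> 72) where
  "F \<diamondop> G = Arrow (src F \<odot> src G) (tgt F \<odot> tgt G) (mor F \<otimes> mor G)"

definition aadj :: "('a, 'b) arrow \<Rightarrow> ('a, 'b) arrow" where
  "aadj F = Arrow (tgt F) (src F) ((mor F)\<^sup>\<dagger>)"

lemma arrow_sel [simp]:
  "src (aid x) = x" "tgt (aid x) = x" "mor (aid x) = idm C x"
  "src (G \<star> F) = src F" "tgt (G \<star> F) = tgt G" "mor (G \<star> F) = mor G \<cdot> mor F"
  "src (F \<diamondop> G) = src F \<odot> src G" "tgt (F \<diamondop> G) = tgt F \<odot> tgt G"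
  "mor (F \<diamondop> G) = mor F \<otimes> mor G"
  "src (aadj F) = tgt F" "tgt (aadj F) = src F" "mor (aadj F) = (mor F)\<^sup>\<dagger>"
  by (simp_all add: aid_def acomp_def atens_def aadj_def)

lemma valid_simps [simp]:
  "valid (aid x)"
  "valid F \<Longrightarrow> valid G \<Longrightarrow> tgt F = src G \<Longrightarrow> valid (G \<star> F)"
  "valid F \<Longrightarrow> valid G \<Longrightarrow> valid (F \<diamondop> G)"
  "valid F \<Longrightarrow> valid (aadj F)"
  by (auto simp: valid_def intro: tensor_intros)

lemma valid_Arrow [simp]: "valid (Arrow x y f) \<longleftrightarrow> f \<in> Hom C x y"
  by (simp add: valid_def)

lemma acomp_assoc:
  "valid F \<Longrightarrow> valid G \<Longrightarrow> valid H \<Longrightarrow> tgt F = src G \<Longrightarrow> tgt G = src H \<Longrightarrow>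
    (H \<star> G) \<star> F = H \<star> G \<star> F"
  by (auto simp: valid_def acomp_def intro: comp_assoc)

lemma acomp_aid [simp]: "valid F \<Longrightarrow> src F = x \<Longrightarrow> F \<star> aid x = F"
  by (cases F) (auto simp: valid_def acomp_def aid_def intro: comp_idm)

lemma aid_acomp [simp]: "valid F \<Longrightarrow> tgt F = x \<Longrightarrow> aid x \<star> F = F"
  by (cases F) (auto simp: valid_def acomp_def aid_def intro: idm_comp)

lemma atens_assoc: "valid F \<Longrightarrow> valid G \<Longrightarrow> valid H \<Longrightarrow> (F \<diamondop> G) \<diamondop> H = F \<diamondop> G \<diamondop> H"
  by (auto simp: valid_def atens_def intro: mtens_assoc)

lemma aid_unit_atens [simp]: "valid F \<Longrightarrow> aid \<one> \<diamondop> F = F"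
  by (cases F) (auto simp: valid_def atens_def aid_def intro: mtens_unit_left)

lemma atens_aid_unit [simp]: "valid F \<Longrightarrow> F \<diamondop> aid \<one> = F"
  by (cases F) (auto simp: valid_def atens_def aid_def intro: mtens_unit_right)

lemma aid_atens: "aid x \<diamondop> aid y = aid (x \<odot> y)"
  by (simp add: atens_def aid_def mtens_idm)

lemma interchange:
  "valid F \<Longrightarrow> valid G \<Longrightarrow> valid F' \<Longrightarrow> valid G' \<Longrightarrow> tgt F = src G \<Longrightarrow> tgt F' = src G' \<Longrightarrow>
    (G \<diamondop> G') \<star> (F \<diamondop> F') = (G \<star> F) \<diamondop> (G' \<star> F')"
  by (auto simp: valid_def atens_def acomp_def intro: mtens_comp[symmetric])

lemma aadj_simps:
  "aadj (aid x) = aid x"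
  "valid F \<Longrightarrow> aadj (aadj F) = F"
  "valid F \<Longrightarrow> valid G \<Longrightarrow> tgt F = src G \<Longrightarrow> aadj (G \<star> F) = aadj F \<star> aadj G"
  "valid F \<Longrightarrow> valid G \<Longrightarrow> aadj (F \<diamondop> G) = aadj F \<diamondop> aadj G"
  by (auto simp: valid_def atens_def acomp_def aid_def aadj_def adj_idm adj_adj arrow.expand
      intro: adj_comp adj_mtens)

lemma aid_split: "valid F \<Longrightarrow> aid (x \<odot> y) \<diamondop> F = aid x \<diamondop> aid y \<diamondop> F"
  by (simp add: atens_assoc[symmetric] aid_atens)

section \<open>Conjugate equations and Frobenius reciprocity\<close>

lemma conj_solution_swap: "conj_solution C x xb r rb \<Longrightarrow> conj_solution C xb x rb r"
  by (simp add: conj_solution_def)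

lemma zigzag_arrows:
  assumes "conj_solution C x xb r rb"
  defines "Rr \<equiv> Arrow \<one> (xb \<odot> x) r" and "Rbr \<equiv> Arrow \<one> (x \<odot> xb) rb"
  shows "valid Rr" "valid Rbr"
    "(aid x \<diamondop> aadj Rr) \<star> (Rbr \<diamondop> aid x) = aid x"
    "(aadj Rbr \<diamondop> aid x) \<star> (aid x \<diamondop> Rr) = aid x"
proof -
  show v: "valid Rr" "valid Rbr"
    using assms by (simp_all add: conj_solution_def)
  show z: "(aid x \<diamondop> aadj Rr) \<star> (Rbr \<diamondop> aid x) = aid x"
    using assms unfolding conj_solution_def
    by (simp add: aid_def acomp_def atens_def aadj_def)
  have "aadj ((aid x \<diamondop> aadj Rr) \<star> (Rbr \<diamondop> aid x)) = aid x"
    using z by (simp add: aadj_simps)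
  then show "(aadj Rbr \<diamondop> aid x) \<star> (aid x \<diamondop> Rr) = aid x"
    using v by (simp add: aadj_simps Rr_def Rbr_def)
qed

text \<open>
  Frobenius reciprocity: bending the input strand of \<open>e\<close> around \<open>r\<close> and back around \<open>rb\<close> straightens
  by a conjugate equation.  Conversely, every element of
  \<open>Hom \<one> (x \<odot> t)\<close> and of \<open>Hom \<one> (t \<odot> xb)\<close> arises by bending (\<open>transpose_right_inverse\<close>,
  \<open>transpose_left_inverse\<close>).
\<close>

lemma transpose_inverse:
  assumes sol: "conj_solution C x xb r rb" and e: "e \<in> Hom C x t"
  shows "(rb\<^sup>\<dagger> \<otimes> idm C t) \<cdot> (idm C x \<otimes> ((idm C xb \<otimes> e) \<cdot> r)) = e"
proof -
  define E where "E = Arrow x t e"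
  define Rr where "Rr = Arrow \<one> (xb \<odot> x) r"
  define Rbr where "Rbr = Arrow \<one> (x \<odot> xb) rb"
  note z = zigzag_arrows[OF sol, folded Rr_def Rbr_def]
  have sel [simp]: "src E = x" "tgt E = t" "mor E = e" "src Rr = \<one>" "tgt Rr = xb \<odot> x" "mor Rr = r"
    "src Rbr = \<one>" "tgt Rbr = x \<odot> xb" "mor Rbr = rb" "valid E" "valid Rr" "valid Rbr"
    using e z(1,2) by (simp_all add: E_def Rr_def Rbr_def)
  have "(aadj Rbr \<diamondop> aid t) \<star> (aid x \<diamondop> ((aid xb \<diamondop> E) \<star> Rr))
      = (aadj Rbr \<diamondop> aid t) \<star> ((aid (x \<odot> xb) \<diamondop> E) \<star> (aid x \<diamondop> Rr))"
    by (simp add: interchange aid_split)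
  also have "\<dots> = ((aadj Rbr \<diamondop> aid t) \<star> (aid (x \<odot> xb) \<diamondop> E)) \<star> (aid x \<diamondop> Rr)"
    by (simp add: acomp_assoc)
  also have "(aadj Rbr \<diamondop> aid t) \<star> (aid (x \<odot> xb) \<diamondop> E) = (aid \<one> \<diamondop> E) \<star> (aadj Rbr \<diamondop> aid x)"
    by (subst (1 2) interchange) simp_all
  also have "\<dots> \<star> (aid x \<diamondop> Rr) = E \<star> ((aadj Rbr \<diamondop> aid x) \<star> (aid x \<diamondop> Rr))"
    by (simp add: acomp_assoc)
  also have "\<dots> = E"
    by (simp add: z)
  finally show ?thesis
    by - (drule arg_cong[where f = mor], simp)
qed

lemma transpose_right_inverse:
  assumes sol: "conj_solution C x xb r rb" and k: "k \<in> Hom C \<one> (x \<odot> t)"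
  shows "(idm C x \<otimes> ((r\<^sup>\<dagger> \<otimes> idm C t) \<cdot> (idm C xb \<otimes> k))) \<cdot> rb = k"
proof -
  define K where "K = Arrow \<one> (x \<odot> t) k"
  define Rr where "Rr = Arrow \<one> (xb \<odot> x) r"
  define Rbr where "Rbr = Arrow \<one> (x \<odot> xb) rb"
  note z = zigzag_arrows[OF sol, folded Rr_def Rbr_def]
  have sel [simp]: "src K = \<one>" "tgt K = x \<odot> t" "mor K = k" "src Rr = \<one>" "tgt Rr = xb \<odot> x" "mor Rr = r"
    "src Rbr = \<one>" "tgt Rbr = x \<odot> xb" "mor Rbr = rb" "valid K" "valid Rr" "valid Rbr"
    using k z(1,2) by (simp_all add: K_def Rr_def Rbr_def)
  have "(aid x \<diamondop> ((aadj Rr \<diamondop> aid t) \<star> (aid xb \<diamondop> K))) \<star> Rbr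
      = ((aid x \<diamondop> (aadj Rr \<diamondop> aid t)) \<star> (aid x \<diamondop> aid xb \<diamondop> K)) \<star> Rbr"
    by (simp add: interchange)
  also have "\<dots> = (aid x \<diamondop> aadj Rr \<diamondop> aid t) \<star> ((aid (x \<odot> xb) \<diamondop> K) \<star> (Rbr \<diamondop> aid \<one>))"
    by (simp add: acomp_assoc aid_split)
  also have "(aid (x \<odot> xb) \<diamondop> K) \<star> (Rbr \<diamondop> aid \<one>) = (Rbr \<diamondop> aid (x \<odot> t)) \<star> (aid \<one> \<diamondop> K)"
    by (subst (1 2) interchange) simp_all
  also have "(Rbr \<diamondop> aid (x \<odot> t)) = (Rbr \<diamondop> aid x) \<diamondop> aid t"
    by (simp add: atens_assoc aid_atens)
  also have "(aid x \<diamondop> aadj Rr \<diamondop> aid t) \<star> ((Rbr \<diamondop> aid x) \<diamondop> aid t) \<star> (aid \<one> \<diamondop> K)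
      = (((aid x \<diamondop> aadj Rr) \<diamondop> aid t) \<star> ((Rbr \<diamondop> aid x) \<diamondop> aid t)) \<star> K"
    by (simp add: acomp_assoc atens_assoc)
  also have "\<dots> = K"
    by (subst interchange) (simp_all add: z aid_atens)
  finally show ?thesis
    by - (drule arg_cong[where f = mor], simp)
qed

lemma transpose_left_inverse:
  assumes sol: "conj_solution C x xb r rb" and k: "k \<in> Hom C \<one> (t \<odot> xb)"
  shows "(((idm C t \<otimes> r\<^sup>\<dagger>) \<cdot> (k \<otimes> idm C x)) \<otimes> idm C xb) \<cdot> rb = k"
proof -
  define K where "K = Arrow \<one> (t \<odot> xb) k"
  define Rr where "Rr = Arrow \<one> (xb \<odot> x) r"
  define Rbr where "Rbr = Arrow \<one> (x \<odot> xb) rb"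
  note z = zigzag_arrows[OF sol, folded Rr_def Rbr_def]
    zigzag_arrows[OF conj_solution_swap[OF sol], folded Rr_def Rbr_def]
  have sel [simp]: "src K = \<one>" "tgt K = t \<odot> xb" "mor K = k" "src Rr = \<one>" "tgt Rr = xb \<odot> x" "mor Rr = r"
    "src Rbr = \<one>" "tgt Rbr = x \<odot> xb" "mor Rbr = rb" "valid K" "valid Rr" "valid Rbr"
    using k z(1,2) by (simp_all add: K_def Rr_def Rbr_def)
  have "(((aid t \<diamondop> aadj Rr) \<star> (K \<diamondop> aid x)) \<diamondop> aid xb) \<star> Rbr
      = (((aid t \<diamondop> aadj Rr) \<diamondop> aid xb) \<star> ((K \<diamondop> aid x) \<diamondop> aid xb)) \<star> Rbr"
    by (simp add: interchange)
  also have "\<dots> = (aid t \<diamondop> aadj Rr \<diamondop> aid xb) \<star> ((K \<diamondop> aid (x \<odot> xb)) \<star> (aid \<one> \<diamondop> Rbr))"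
    by (simp add: acomp_assoc atens_assoc aid_atens)
  also have "(K \<diamondop> aid (x \<odot> xb)) \<star> (aid \<one> \<diamondop> Rbr) = (aid (t \<odot> xb) \<diamondop> Rbr) \<star> (K \<diamondop> aid \<one>)"
    by (subst (1 2) interchange) simp_all
  also have "aid (t \<odot> xb) \<diamondop> Rbr = aid t \<diamondop> aid xb \<diamondop> Rbr"
    by (simp add: aid_split)
  also have "(aid t \<diamondop> aadj Rr \<diamondop> aid xb) \<star> (aid t \<diamondop> aid xb \<diamondop> Rbr) \<star> (K \<diamondop> aid \<one>)
      = ((aid t \<diamondop> aadj Rr \<diamondop> aid xb) \<star> (aid t \<diamondop> aid xb \<diamondop> Rbr)) \<star> K"
    by (simp add: acomp_assoc)
  also have "\<dots> = K"
    by (subst interchange) (simp_all add: z aid_atens)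
  finally show ?thesis
    by - (drule arg_cong[where f = mor], simp)
qed

text \<open>
  The products that occur in the square \<open>a a\<^sup>*\<close> of \<open>laplacian_square\<close>: two straighten and the third is a
  cup stacked on a cap, which becomes a loop once the tube is closed.
\<close>

lemma conj_solution_products:
  assumes sol: "conj_solution C x xb r rb"
  shows "(r\<^sup>\<dagger> \<otimes> idm C xb) \<cdot> (idm C xb \<otimes> rb) = idm C xb"
    and "(rb\<^sup>\<dagger> \<otimes> idm C x) \<cdot> (idm C x \<otimes> r) = idm C x"
    and "((rb\<^sup>\<dagger> \<otimes> idm C x) \<otimes> idm C xb) \<cdot> (idm C x \<otimes> (idm C xb \<otimes> rb)) = rb \<cdot> rb\<^sup>\<dagger>"
proof -
  define Rr where "Rr = Arrow \<one> (xb \<odot> x) r"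
  define Rbr where "Rbr = Arrow \<one> (x \<odot> xb) rb"
  note z = zigzag_arrows[OF sol, folded Rr_def Rbr_def]
    zigzag_arrows[OF conj_solution_swap[OF sol], folded Rr_def Rbr_def]
  have sel [simp]: "src Rr = \<one>" "tgt Rr = xb \<odot> x" "mor Rr = r"
    "src Rbr = \<one>" "tgt Rbr = x \<odot> xb" "mor Rbr = rb" "valid Rr" "valid Rbr"
    using z(1,2) by (simp_all add: Rr_def Rbr_def)
  show "(r\<^sup>\<dagger> \<otimes> idm C xb) \<cdot> (idm C xb \<otimes> rb) = idm C xb"
    using arg_cong[OF z(8), of mor] by simp
  show "(rb\<^sup>\<dagger> \<otimes> idm C x) \<cdot> (idm C x \<otimes> r) = idm C x"
    using arg_cong[OF z(4), of mor] by simp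
  have "((aadj Rbr \<diamondop> aid x) \<diamondop> aid xb) \<star> (aid x \<diamondop> (aid xb \<diamondop> Rbr))
      = (aadj Rbr \<diamondop> aid (x \<odot> xb)) \<star> (aid (x \<odot> xb) \<diamondop> Rbr)"
    by (simp add: atens_assoc aid_split aid_atens)
  also have "\<dots> = (aid \<one> \<diamondop> Rbr) \<star> (aadj Rbr \<diamondop> aid \<one>)"
    by (subst (1 2) interchange) simp_all
  also have "\<dots> = Rbr \<star> aadj Rbr"
    by simp
  finally show "((rb\<^sup>\<dagger> \<otimes> idm C x) \<otimes> idm C xb) \<cdot> (idm C x \<otimes> (idm C xb \<otimes> rb)) = rb \<cdot> rb\<^sup>\<dagger>"
    by - (drule arg_cong[where f = mor], simp)
qed

section \<open>Dinaturality of the tube operations\<close>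

text \<open>
  Moving \<open>f\<close> around the first factor of a tube product amounts to moving \<open>f \<otimes> 1\<close> around the product
  tube; \<open>M\<close> is the product diagram cut open at the strand from which \<open>f\<close> is removed.
\<close>

lemma mult_dinatural_left:
  assumes A: "A \<in> Hom C (z' \<odot> u) (y \<odot> z)" and B: "B \<in> Hom C (z2 \<odot> x) (u \<odot> z2)" and f: "f \<in> Hom C z z'"
  defines "M \<equiv> (A \<otimes> idm C z2) \<cdot> (idm C z' \<otimes> B)"
  shows "M \<in> Hom C ((z' \<odot> z2) \<odot> x) (y \<odot> z \<odot> z2)"
    "((A \<cdot> (f \<otimes> idm C u)) \<otimes> idm C z2) \<cdot> (idm C z \<otimes> B) = M \<cdot> ((f \<otimes> idm C z2) \<otimes> idm C x)"
    "(((idm C y \<otimes> f) \<cdot> A) \<otimes> idm C z2) \<cdot> (idm C z' \<otimes> B) = (idm C y \<otimes> (f \<otimes> idm C z2)) \<cdot> M"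
proof -
  define A' where "A' = Arrow (z' \<odot> u) (y \<odot> z) A"
  define B' where "B' = Arrow (z2 \<odot> x) (u \<odot> z2) B"
  define F where "F = Arrow z z' f"
  have sel [simp]: "src A' = z' \<odot> u" "tgt A' = y \<odot> z" "mor A' = A"
    "src B' = z2 \<odot> x" "tgt B' = u \<odot> z2" "mor B' = B" "src F = z" "tgt F = z'" "mor F = f"
    "valid A'" "valid B'" "valid F"
    using A B f by (simp_all add: A'_def B'_def F_def)
  define M' where "M' = (A' \<diamondop> aid z2) \<star> (aid z' \<diamondop> B')"
  have M' [simp]: "valid M'" "src M' = z' \<odot> z2 \<odot> x" "tgt M' = y \<odot> z \<odot> z2" "mor M' = M"
    by (simp_all add: M'_def M_def)
  show "M \<in> Hom C ((z' \<odot> z2) \<odot> x) (y \<odot> z \<odot> z2)"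
    using M'(1) by (simp add: valid_def)
  have "((A' \<star> (F \<diamondop> aid u)) \<diamondop> aid z2) \<star> (aid z \<diamondop> B')
      = (A' \<diamondop> aid z2) \<star> ((F \<diamondop> aid (u \<odot> z2)) \<star> (aid z \<diamondop> B'))"
    by (subst acomp_assoc[symmetric]) (simp_all add: interchange atens_assoc[symmetric] flip: aid_atens)
  also have "(F \<diamondop> aid (u \<odot> z2)) \<star> (aid z \<diamondop> B') = (aid z' \<diamondop> B') \<star> (F \<diamondop> aid (z2 \<odot> x))"
    by (simp add: interchange)
  also have "(A' \<diamondop> aid z2) \<star> \<dots> = M' \<star> ((F \<diamondop> aid z2) \<diamondop> aid x)"
    by (simp add: M'_def acomp_assoc atens_assoc aid_atens)
  finally show "((A \<cdot> (f \<otimes> idm C u)) \<otimes> idm C z2) \<cdot> (idm C z \<otimes> B) = M \<cdot> ((f \<otimes> idm C z2) \<otimes> idm C x)"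
    by - (drule arg_cong[where f = mor], simp)
  have "(((aid y \<diamondop> F) \<star> A') \<diamondop> aid z2) \<star> (aid z' \<diamondop> B') = (((aid y \<diamondop> F) \<diamondop> aid z2) \<star> (A' \<diamondop> aid z2)) \<star> (aid z' \<diamondop> B')"
    by (simp add: interchange)
  also have "\<dots> = (aid y \<diamondop> F \<diamondop> aid z2) \<star> M'"
    by (simp add: M'_def acomp_assoc atens_assoc)
  finally show "(((idm C y \<otimes> f) \<cdot> A) \<otimes> idm C z2) \<cdot> (idm C z' \<otimes> B) = (idm C y \<otimes> (f \<otimes> idm C z2)) \<cdot> M"
    by - (drule arg_cong[where f = mor], simp)
qed

lemma mult_dinatural_right:
  assumes A: "A \<in> Hom C (z1 \<odot> u) (y \<odot> z1)" and B: "B \<in> Hom C (z' \<odot> x) (u \<odot> z)" and f: "f \<in> Hom C z z'"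
  defines "M \<equiv> (A \<otimes> idm C z) \<cdot> (idm C z1 \<otimes> B)"
  shows "M \<in> Hom C ((z1 \<odot> z') \<odot> x) (y \<odot> z1 \<odot> z)"
    "(A \<otimes> idm C z) \<cdot> (idm C z1 \<otimes> (B \<cdot> (f \<otimes> idm C x))) = M \<cdot> ((idm C z1 \<otimes> f) \<otimes> idm C x)"
    "(A \<otimes> idm C z') \<cdot> (idm C z1 \<otimes> ((idm C u \<otimes> f) \<cdot> B)) = (idm C y \<otimes> (idm C z1 \<otimes> f)) \<cdot> M"
proof -
  define A' where "A' = Arrow (z1 \<odot> u) (y \<odot> z1) A"
  define B' where "B' = Arrow (z' \<odot> x) (u \<odot> z) B"
  define F where "F = Arrow z z' f"
  have sel [simp]: "src A' = z1 \<odot> u" "tgt A' = y \<odot> z1" "mor A' = A"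
    "src B' = z' \<odot> x" "tgt B' = u \<odot> z" "mor B' = B" "src F = z" "tgt F = z'" "mor F = f"
    "valid A'" "valid B'" "valid F"
    using A B f by (simp_all add: A'_def B'_def F_def)
  define M' where "M' = (A' \<diamondop> aid z) \<star> (aid z1 \<diamondop> B')"
  have M' [simp]: "valid M'" "src M' = z1 \<odot> z' \<odot> x" "tgt M' = y \<odot> z1 \<odot> z" "mor M' = M"
    by (simp_all add: M'_def M_def)
  show "M \<in> Hom C ((z1 \<odot> z') \<odot> x) (y \<odot> z1 \<odot> z)"
    using M'(1) by (simp add: valid_def)
  have "(A' \<diamondop> aid z) \<star> (aid z1 \<diamondop> (B' \<star> (F \<diamondop> aid x))) = (A' \<diamondop> aid z) \<star> (aid z1 \<diamondop> B') \<star> (aid z1 \<diamondop> F \<diamondop> aid x)"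
    by (simp add: interchange)
  also have "\<dots> = M' \<star> ((aid z1 \<diamondop> F) \<diamondop> aid x)"
    by (simp add: M'_def acomp_assoc atens_assoc)
  finally show "(A \<otimes> idm C z) \<cdot> (idm C z1 \<otimes> (B \<cdot> (f \<otimes> idm C x))) = M \<cdot> ((idm C z1 \<otimes> f) \<otimes> idm C x)"
    by - (drule arg_cong[where f = mor], simp)
  have "(A' \<diamondop> aid z') \<star> (aid z1 \<diamondop> ((aid u \<diamondop> F) \<star> B'))
      = ((A' \<diamondop> aid z') \<star> (aid (z1 \<odot> u) \<diamondop> F)) \<star> (aid z1 \<diamondop> B')"
    by (subst acomp_assoc) (simp_all add: interchange aid_split)
  also have "(A' \<diamondop> aid z') \<star> (aid (z1 \<odot> u) \<diamondop> F) = (aid (y \<odot> z1) \<diamondop> F) \<star> (A' \<diamondop> aid z)"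
    by (simp add: interchange)
  also have "\<dots> \<star> (aid z1 \<diamondop> B') = (aid y \<diamondop> aid z1 \<diamondop> F) \<star> M'"
    by (simp add: M'_def acomp_assoc aid_split)
  finally show "(A \<otimes> idm C z') \<cdot> (idm C z1 \<otimes> ((idm C u \<otimes> f) \<cdot> B)) = (idm C y \<otimes> (idm C z1 \<otimes> f)) \<cdot> M"
    by - (drule arg_cong[where f = mor], simp)
qed

text \<open>
  The formula for the tube involution, with separate cap \<open>r\<close> and cup \<open>rb\<close>.  For the involution
  itself both belong to the same object; dinaturality passes through the mixed case.
\<close>

definition rotation :: "'a \<Rightarrow> 'a \<Rightarrow> 'a \<Rightarrow> 'a \<Rightarrow> 'b \<Rightarrow> 'b \<Rightarrow> 'b \<Rightarrow> 'b" where
  "rotation x y zb' zb r rb \<gamma> =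
    (r\<^sup>\<dagger> \<otimes> idm C x \<otimes> idm C zb) \<cdot> (idm C zb' \<otimes> \<gamma>\<^sup>\<dagger> \<otimes> idm C zb) \<cdot>
    (idm C zb' \<otimes> idm C y \<otimes> rb)"

lemma rotation_in:
  assumes "r \<in> Hom C \<one> (zb' \<odot> z')" "rb \<in> Hom C \<one> (z \<odot> zb)" "\<gamma> \<in> Hom C (z' \<odot> x) (y \<odot> z)"
  shows "rotation x y zb' zb r rb \<gamma> \<in> Hom C (zb' \<odot> y) (x \<odot> zb)"
proof -
  define G where "G = Arrow (z' \<odot> x) (y \<odot> z) \<gamma>"
  define Rr where "Rr = Arrow \<one> (zb' \<odot> z') r"
  define Rbr where "Rbr = Arrow \<one> (z \<odot> zb) rb"
  have "valid ((aadj Rr \<diamondop> aid x \<diamondop> aid zb) \<star> (aid zb' \<diamondop> aadj G \<diamondop> aid zb) \<star> (aid zb' \<diamondop> aid y \<diamondop> Rbr))"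
    using assms by (simp add: G_def Rr_def Rbr_def)
  then show ?thesis
    by (simp add: valid_def rotation_def G_def Rr_def Rbr_def)
qed

lemma rotation_add:
  assumes "r \<in> Hom C \<one> (zb \<odot> z)" "rb \<in> Hom C \<one> (z \<odot> zb)"
    "\<gamma> \<in> Hom C (z \<odot> x) (y \<odot> z)" "\<gamma>' \<in> Hom C (z \<odot> x) (y \<odot> z)"
  shows "rotation x y zb zb r rb (\<gamma> + \<gamma>') = rotation x y zb zb r rb \<gamma> + rotation x y zb zb r rb \<gamma>'"
proof -
  have a: "\<gamma>\<^sup>\<dagger> \<otimes> idm C zb \<in> Hom C ((y \<odot> z) \<odot> zb) ((z \<odot> x) \<odot> zb)"
    "\<gamma>'\<^sup>\<dagger> \<otimes> idm C zb \<in> Hom C ((y \<odot> z) \<odot> zb) ((z \<odot> x) \<odot> zb)"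
    by (rule mtens_in[OF adj_in[OF assms(3)] idm_in] mtens_in[OF adj_in[OF assms(4)] idm_in])+
  have b: "idm C zb \<otimes> \<gamma>\<^sup>\<dagger> \<otimes> idm C zb \<in> Hom C (zb \<odot> y \<odot> z \<odot> zb) (zb \<odot> z \<odot> x \<odot> zb)"
    "idm C zb \<otimes> \<gamma>'\<^sup>\<dagger> \<otimes> idm C zb \<in> Hom C (zb \<odot> y \<odot> z \<odot> zb) (zb \<odot> z \<odot> x \<odot> zb)"
    using a[THEN mtens_in[OF idm_in[of zb]]] by simp_all
  have l: "(r\<^sup>\<dagger> \<otimes> idm C x \<otimes> idm C zb) \<in> Hom C (zb \<odot> z \<odot> x \<odot> zb) (x \<odot> zb)"
    using mtens_in[OF adj_in[OF assms(1)] idm_in[of "x \<odot> zb"]] by (simp add: mtens_idm)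
  have rr: "(idm C zb \<otimes> idm C y \<otimes> rb) \<in> Hom C (zb \<odot> y) (zb \<odot> y \<odot> z \<odot> zb)"
    using mtens_in[OF idm_in[of zb] mtens_in[OF idm_in[of y] assms(2)]] by simp
  have "idm C zb \<otimes> (\<gamma> + \<gamma>')\<^sup>\<dagger> \<otimes> idm C zb = (idm C zb \<otimes> \<gamma>\<^sup>\<dagger> \<otimes> idm C zb) + (idm C zb \<otimes> \<gamma>'\<^sup>\<dagger> \<otimes> idm C zb)"
    using assms a
    by (simp add: adj_add[OF assms(3,4)] mtens_add_left[OF adj_in[OF assms(3)] adj_in[OF assms(4)] idm_in]
        mtens_add_right[OF idm_in a])
  then show ?thesis
    unfolding rotation_def
    by (simp add: comp_add_left[OF rr b] comp_add_right[OF comp_in[OF rr b(1)] comp_in[OF rr b(2)] l])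
qed

lemma rotation_diff:
  assumes "r \<in> Hom C \<one> (zb \<odot> z)" "rb \<in> Hom C \<one> (z \<odot> zb)"
    "\<gamma> \<in> Hom C (z \<odot> x) (y \<odot> z)" "\<gamma>' \<in> Hom C (z \<odot> x) (y \<odot> z)"
  shows "rotation x y zb zb r rb (\<gamma> - \<gamma>') = rotation x y zb zb r rb \<gamma> - rotation x y zb zb r rb \<gamma>'"
  using rotation_add[OF assms(1,2) diff_in[OF assms(3,4)] assms(4)] by (simp add: eq_diff_eq)

lemma rotation_scale:
  assumes "r \<in> Hom C \<one> (zb \<odot> z)" "rb \<in> Hom C \<one> (z \<odot> zb)" "\<gamma> \<in> Hom C (z \<odot> x) (y \<odot> z)"
  shows "rotation x y zb zb r rb (cscale C c \<gamma>) = cscale C (cnj c) (rotation x y zb zb r rb \<gamma>)"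
proof -
  have a: "\<gamma>\<^sup>\<dagger> \<otimes> idm C zb \<in> Hom C ((y \<odot> z) \<odot> zb) ((z \<odot> x) \<odot> zb)"
    by (rule mtens_in[OF adj_in[OF assms(3)] idm_in])
  have b: "idm C zb \<otimes> \<gamma>\<^sup>\<dagger> \<otimes> idm C zb \<in> Hom C (zb \<odot> y \<odot> z \<odot> zb) (zb \<odot> z \<odot> x \<odot> zb)"
    using a[THEN mtens_in[OF idm_in[of zb]]] by simp
  have l: "(r\<^sup>\<dagger> \<otimes> idm C x \<otimes> idm C zb) \<in> Hom C (zb \<odot> z \<odot> x \<odot> zb) (x \<odot> zb)"
    using mtens_in[OF adj_in[OF assms(1)] idm_in[of "x \<odot> zb"]] by (simp add: mtens_idm)
  have rr: "(idm C zb \<otimes> idm C y \<otimes> rb) \<in> Hom C (zb \<odot> y) (zb \<odot> y \<odot> z \<odot> zb)"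
    using mtens_in[OF idm_in[of zb] mtens_in[OF idm_in[of y] assms(2)]] by simp
  show ?thesis
    unfolding rotation_def
    by (simp add: adj_cscale[OF assms(3)] mtens_cscale_left[OF adj_in[OF assms(3)] idm_in]
        mtens_cscale_right[OF idm_in a] comp_cscale_left[OF rr b] comp_cscale_right[OF comp_in[OF rr b] l])
qed

text \<open>
  The morphism \<open>g\<close> is the conjugate of \<open>f\<close>.  Sliding \<open>f\<^sup>\<dagger>\<close> through the cap turns it into \<open>g\<close> on the
  incoming strand, sliding it through the cup turns it into \<open>g\<close> on the outgoing strand.
\<close>

lemma star_dinatural:
  assumes sol: "conj_solution C z zb r rb" and sol': "conj_solution C z' zb' r' rb'"
    and \<gamma>: "\<gamma> \<in> Hom C (z' \<odot> x) (y \<odot> z)" and f: "f \<in> Hom C z z'"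
  shows "\<exists>g\<in>Hom C zb zb'.
    rotation x y zb zb r rb (\<gamma> \<cdot> (f \<otimes> idm C x)) = rotation x y zb' zb r' rb \<gamma> \<cdot> (g \<otimes> idm C y) \<and>
    rotation x y zb' zb' r' rb' ((idm C y \<otimes> f) \<cdot> \<gamma>) = (idm C x \<otimes> g) \<cdot> rotation x y zb' zb r' rb \<gamma>"
proof -
  define F where "F = Arrow z z' f"
  define G where "G = Arrow (z' \<odot> x) (y \<odot> z) \<gamma>"
  define Rr where "Rr = Arrow \<one> (zb \<odot> z) r"
  define Rbr where "Rbr = Arrow \<one> (z \<odot> zb) rb"
  define Rr' where "Rr' = Arrow \<one> (zb' \<odot> z') r'"
  define Rbr' where "Rbr' = Arrow \<one> (z' \<odot> zb') rb'"
  note z = zigzag_arrows[OF sol, folded Rr_def Rbr_def]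
  note z' = zigzag_arrows[OF sol', folded Rr'_def Rbr'_def]
  have sel [simp]: "src F = z" "tgt F = z'" "mor F = f"
    "src G = z' \<odot> x" "tgt G = y \<odot> z" "mor G = \<gamma>"
    "src Rr = \<one>" "tgt Rr = zb \<odot> z" "mor Rr = r"
    "src Rbr = \<one>" "tgt Rbr = z \<odot> zb" "mor Rbr = rb"
    "src Rr' = \<one>" "tgt Rr' = zb' \<odot> z'" "mor Rr' = r'"
    "src Rbr' = \<one>" "tgt Rbr' = z' \<odot> zb'" "mor Rbr' = rb'"
    "valid F" "valid G" "valid Rr" "valid Rbr" "valid Rr'" "valid Rbr'"
    using \<gamma> f z(1,2) z'(1,2)
    by (simp_all add: F_def G_def Rr_def Rbr_def Rr'_def Rbr'_def)
  \<comment> \<open>the conjugate of \<open>f\<close>; \<open>T1\<close> and \<open>T2\<close> slide \<open>f\<^sup>\<dagger>\<close> through cup and cap\<close>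
  define T where "T = (aadj Rr \<diamondop> aid zb') \<star> (aid zb \<diamondop> ((aadj F \<diamondop> aid zb') \<star> Rbr'))"
  have T [simp]: "valid T" "src T = zb" "tgt T = zb'"
    by (simp_all add: T_def)
  have T1: "(aid z \<diamondop> T) \<star> Rbr = (aadj F \<diamondop> aid zb') \<star> Rbr'"
  proof -
    have "mor ((aid z \<diamondop> T) \<star> Rbr) = mor ((aadj F \<diamondop> aid zb') \<star> Rbr')"
      using transpose_right_inverse[OF sol, of "mor ((aadj F \<diamondop> aid zb') \<star> Rbr')" zb']
        valid_def[of "(aadj F \<diamondop> aid zb') \<star> Rbr'"]
      by (simp add: T_def)
    then show ?thesis
      by (intro arrow.expand) simp
  qed
  have T2: "aadj Rr \<star> (aid zb \<diamondop> aadj F) = aadj Rr' \<star> (T \<diamondop> aid z')"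
  proof -
    define k where "k = (aid zb \<diamondop> F) \<star> Rr"
    have k [simp]: "valid k" "src k = \<one>" "tgt k = zb \<odot> z'"
      by (simp_all add: k_def)
    have "aadj k = aadj Rr \<star> (aid zb \<diamondop> aadj F)"
      by (simp add: k_def aadj_simps)
    have "(aadj Rr \<diamondop> aid zb') \<star> (aid zb \<diamondop> ((aadj F \<diamondop> aid zb') \<star> Rbr'))
      = ((aadj Rr \<diamondop> aid zb') \<star> ((aid zb \<diamondop> aadj F) \<diamondop> aid zb')) \<star> (aid zb \<diamondop> Rbr')"
      by (subst acomp_assoc) (simp_all add: interchange atens_assoc)
    also have "\<dots> = (aadj k \<diamondop> aid zb') \<star> (aid zb \<diamondop> Rbr')"
      by (subst (1) interchange) (simp_all add: k_def aadj_simps)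
    finally have T': "aadj T = (aid zb \<diamondop> aadj Rbr') \<star> (k \<diamondop> aid zb')"
      by (simp add: T_def aadj_simps)
    have "mor ((aadj T \<diamondop> aid z') \<star> Rr') = mor k"
      using transpose_left_inverse[OF conj_solution_swap[OF sol'], of "mor k" zb] k
      by (simp add: T' valid_def del: k)
    then have "(aadj T \<diamondop> aid z') \<star> Rr' = k"
      by (intro arrow.expand) simp
    then have "aadj ((aadj T \<diamondop> aid z') \<star> Rr') = aadj k"
      by simp
    then show ?thesis
      by (simp add: aadj_simps k_def)
  qed
  define M where "M = (aadj Rr' \<diamondop> aid x \<diamondop> aid zb) \<star> (aid zb' \<diamondop> aadj G \<diamondop> aid zb) \<star> (aid zb' \<diamondop> aid y \<diamondop> Rbr)"
  have M [simp]: "valid M" "src M = zb' \<odot> y" "tgt M = x \<odot> zb" "mor M = rotation x y zb' zb r' rb \<gamma>"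
    by (simp_all add: M_def rotation_def)
  have "(aadj Rr \<diamondop> aid x \<diamondop> aid zb) \<star> (aid zb \<diamondop> aadj (G \<star> (F \<diamondop> aid x)) \<diamondop> aid zb) \<star> (aid zb \<diamondop> aid y \<diamondop> Rbr)
      = (aadj Rr \<diamondop> aid (x \<odot> zb)) \<star> ((aid zb \<diamondop> aadj F) \<diamondop> aid (x \<odot> zb)) \<star> (aid zb \<diamondop> aadj G \<diamondop> aid zb) \<star> (aid (zb \<odot> y) \<diamondop> Rbr)"
  proof -
    have "aid zb \<diamondop> aadj (G \<star> (F \<diamondop> aid x)) \<diamondop> aid zb
        = ((aid zb \<diamondop> aadj F) \<diamondop> aid (x \<odot> zb)) \<star> (aid zb \<diamondop> aadj G \<diamondop> aid zb)"
    proof -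
      have "((aadj F \<diamondop> aid x) \<star> aadj G) \<diamondop> aid zb = (aadj F \<diamondop> aid x \<diamondop> aid zb) \<star> (aadj G \<diamondop> aid zb)"
        by (simp add: interchange flip: atens_assoc)
      then show ?thesis
        by (simp add: aadj_simps atens_assoc aid_atens[symmetric] interchange)
    qed
    then show ?thesis
      by (simp add: acomp_assoc aid_atens aid_split)
  qed
  also have "\<dots> = ((aadj Rr \<star> (aid zb \<diamondop> aadj F)) \<diamondop> aid (x \<odot> zb)) \<star> (aid zb \<diamondop> aadj G \<diamondop> aid zb) \<star> (aid (zb \<odot> y) \<diamondop> Rbr)"
    by (subst acomp_assoc[symmetric]) (simp_all add: interchange)
  also have "\<dots> = ((aadj Rr' \<diamondop> aid (x \<odot> zb)) \<star> ((T \<diamondop> aid z') \<diamondop> aid (x \<odot> zb))) \<star> (aid zb \<diamondop> aadj G \<diamondop> aid zb) \<star> (aid (zb \<odot> y) \<diamondop> Rbr)"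
    by (simp add: T2 interchange)
  also have "\<dots> = (aadj Rr' \<diamondop> aid (x \<odot> zb)) \<star> ((T \<diamondop> aid (z' \<odot> x \<odot> zb)) \<star> (aid zb \<diamondop> aadj G \<diamondop> aid zb)) \<star> (aid (zb \<odot> y) \<diamondop> Rbr)"
    by (simp add: acomp_assoc atens_assoc aid_atens)
  also have "(T \<diamondop> aid (z' \<odot> x \<odot> zb)) \<star> (aid zb \<diamondop> aadj G \<diamondop> aid zb)
      = (aid zb' \<diamondop> aadj G \<diamondop> aid zb) \<star> (T \<diamondop> aid (y \<odot> z \<odot> zb))"
    by (simp add: interchange)
  also have "(aadj Rr' \<diamondop> aid (x \<odot> zb)) \<star> \<dots> \<star> (aid (zb \<odot> y) \<diamondop> Rbr)
      = (aadj Rr' \<diamondop> aid (x \<odot> zb)) \<star> (aid zb' \<diamondop> aadj G \<diamondop> aid zb) \<star> ((T \<diamondop> aid y) \<diamondop> aid (z \<odot> zb)) \<star> (aid (zb \<odot> y) \<diamondop> Rbr)"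
    by (simp add: acomp_assoc atens_assoc aid_atens)
  also have "((T \<diamondop> aid y) \<diamondop> aid (z \<odot> zb)) \<star> (aid (zb \<odot> y) \<diamondop> Rbr) = (aid (zb' \<odot> y) \<diamondop> Rbr) \<star> ((T \<diamondop> aid y) \<diamondop> aid \<one>)"
    by (subst (1 2) interchange) simp_all
  also have "(aadj Rr' \<diamondop> aid (x \<odot> zb)) \<star> (aid zb' \<diamondop> aadj G \<diamondop> aid zb) \<star> \<dots> = M \<star> (T \<diamondop> aid y)"
    by (simp add: M_def acomp_assoc aid_split aid_atens)
  finally have 1: "rotation x y zb zb r rb (\<gamma> \<cdot> (f \<otimes> idm C x)) = rotation x y zb' zb r' rb \<gamma> \<cdot> (mor T \<otimes> idm C y)"
    by - (drule arg_cong[where f = mor], simp add: rotation_def)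
  have "(aadj Rr' \<diamondop> aid x \<diamondop> aid zb') \<star> (aid zb' \<diamondop> aadj ((aid y \<diamondop> F) \<star> G) \<diamondop> aid zb') \<star> (aid zb' \<diamondop> aid y \<diamondop> Rbr')
      = (aadj Rr' \<diamondop> aid (x \<odot> zb')) \<star> (aid zb' \<diamondop> aadj G \<diamondop> aid zb') \<star> (aid (zb' \<odot> y) \<diamondop> aadj F \<diamondop> aid zb') \<star> (aid (zb' \<odot> y) \<diamondop> Rbr')"
  proof -
    have "aid zb' \<diamondop> aadj ((aid y \<diamondop> F) \<star> G) \<diamondop> aid zb'
        = (aid zb' \<diamondop> aadj G \<diamondop> aid zb') \<star> (aid (zb' \<odot> y) \<diamondop> aadj F \<diamondop> aid zb')"
    proof -
      have "(aadj G \<star> (aid y \<diamondop> aadj F)) \<diamondop> aid zb' = (aadj G \<diamondop> aid zb') \<star> (aid y \<diamondop> aadj F \<diamondop> aid zb')"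
        by (simp add: interchange flip: atens_assoc)
      then show ?thesis
        by (simp add: aadj_simps aid_split interchange)
    qed
    then show ?thesis
      by (simp add: acomp_assoc aid_atens aid_split)
  qed
  also have "\<dots> = (aadj Rr' \<diamondop> aid (x \<odot> zb')) \<star> (aid zb' \<diamondop> aadj G \<diamondop> aid zb') \<star> (aid (zb' \<odot> y) \<diamondop> ((aadj F \<diamondop> aid zb') \<star> Rbr'))"
    by (simp add: interchange)
  also have "\<dots> = (aadj Rr' \<diamondop> aid (x \<odot> zb')) \<star> (aid zb' \<diamondop> aadj G \<diamondop> aid zb') \<star> (aid (zb' \<odot> y) \<diamondop> aid z \<diamondop> T) \<star> (aid (zb' \<odot> y) \<diamondop> Rbr)"
    by (simp add: T1[symmetric] interchange)
  also have "\<dots> = (aadj Rr' \<diamondop> aid (x \<odot> zb')) \<star> (((aid zb' \<diamondop> aadj G) \<diamondop> aid zb') \<star> (aid (zb' \<odot> y \<odot> z) \<diamondop> T)) \<star> (aid (zb' \<odot> y) \<diamondop> Rbr)"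
    by (simp add: acomp_assoc aid_split atens_assoc)
  also have "((aid zb' \<diamondop> aadj G) \<diamondop> aid zb') \<star> (aid (zb' \<odot> y \<odot> z) \<diamondop> T)
     = (aid (zb' \<odot> z' \<odot> x) \<diamondop> T) \<star> ((aid zb' \<diamondop> aadj G) \<diamondop> aid zb)"
    by (simp add: interchange)
  also have "(aadj Rr' \<diamondop> aid (x \<odot> zb')) \<star> \<dots> \<star> (aid (zb' \<odot> y) \<diamondop> Rbr)
     = ((aadj Rr' \<diamondop> aid (x \<odot> zb')) \<star> (aid (zb' \<odot> z') \<diamondop> aid x \<diamondop> T)) \<star> ((aid zb' \<diamondop> aadj G) \<diamondop> aid zb) \<star> (aid (zb' \<odot> y) \<diamondop> Rbr)"
    by (simp add: acomp_assoc aid_split atens_assoc)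
  also have "(aadj Rr' \<diamondop> aid (x \<odot> zb')) \<star> (aid (zb' \<odot> z') \<diamondop> aid x \<diamondop> T) = (aid \<one> \<diamondop> aid x \<diamondop> T) \<star> (aadj Rr' \<diamondop> aid (x \<odot> zb))"
    by (subst (1 2) interchange) simp_all
  also have "\<dots> \<star> ((aid zb' \<diamondop> aadj G) \<diamondop> aid zb) \<star> (aid (zb' \<odot> y) \<diamondop> Rbr) = (aid x \<diamondop> T) \<star> M"
    by (simp add: M_def acomp_assoc atens_assoc aid_split aid_atens)
  finally have 2: "rotation x y zb' zb' r' rb' ((idm C y \<otimes> f) \<cdot> \<gamma>) = (idm C x \<otimes> mor T) \<cdot> rotation x y zb' zb r' rb \<gamma>"
    by - (drule arg_cong[where f = mor], simp add: rotation_def)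
  show ?thesis
    using 1 2 T by (intro bexI[of _ "mor T"] conjI) (simp_all add: valid_def)
qed

text \<open>
  Together with \<open>mult_middle\<close>, this moves a subobject \<open>v\<close> of \<open>x\<close> into the middle of a product \<open>a a\<^sup>*\<close>, where it
  appears only through its range projection \<open>v v\<^sup>\<dagger>\<close>.
\<close>

lemma rotation_precomp:
  assumes r: "r \<in> Hom C \<one> (zb \<odot> z)" and rb: "rb \<in> Hom C \<one> (z \<odot> zb)"
    and \<gamma>: "\<gamma> \<in> Hom C (z \<odot> x) (y \<odot> z)" and v: "v \<in> Hom C x' x"
  shows "rotation x' y zb zb r rb (\<gamma> \<cdot> (idm C z \<otimes> v)) = (v\<^sup>\<dagger> \<otimes> idm C zb) \<cdot> rotation x y zb zb r rb \<gamma>"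
proof -
  define V where "V = Arrow x' x v"
  define G where "G = Arrow (z \<odot> x) (y \<odot> z) \<gamma>"
  define Rr where "Rr = Arrow \<one> (zb \<odot> z) r"
  define Rbr where "Rbr = Arrow \<one> (z \<odot> zb) rb"
  have sel [simp]: "src V = x'" "tgt V = x" "mor V = v"
    "src G = z \<odot> x" "tgt G = y \<odot> z" "mor G = \<gamma>"
    "src Rr = \<one>" "tgt Rr = zb \<odot> z" "mor Rr = r"
    "src Rbr = \<one>" "tgt Rbr = z \<odot> zb" "mor Rbr = rb"
    "valid V" "valid G" "valid Rr" "valid Rbr"
    using assms by (simp_all add: V_def G_def Rr_def Rbr_def)
  have "(aadj Rr \<diamondop> aid x' \<diamondop> aid zb) \<star> (aid zb \<diamondop> aadj (G \<star> (aid z \<diamondop> V)) \<diamondop> aid zb) \<star> (aid zb \<diamondop> aid y \<diamondop> Rbr)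
    = ((aadj Rr \<diamondop> aid (x' \<odot> zb)) \<star> (aid (zb \<odot> z) \<diamondop> aadj V \<diamondop> aid zb)) \<star> (aid zb \<diamondop> aadj G \<diamondop> aid zb) \<star> (aid zb \<diamondop> aid y \<diamondop> Rbr)"
  proof -
    have "aid zb \<diamondop> aadj (G \<star> (aid z \<diamondop> V)) \<diamondop> aid zb = (aid (zb \<odot> z) \<diamondop> aadj V \<diamondop> aid zb) \<star> (aid zb \<diamondop> aadj G \<diamondop> aid zb)"
      by (simp add: interchange aadj_simps aid_split atens_assoc[symmetric] del: aid_atens)
        (simp add: interchange atens_assoc)
    then show ?thesis by (simp add: acomp_assoc aid_atens)
  qed
  also have "(aadj Rr \<diamondop> aid (x' \<odot> zb)) \<star> (aid (zb \<odot> z) \<diamondop> aadj V \<diamondop> aid zb)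
    = (aid \<one> \<diamondop> aadj V \<diamondop> aid zb) \<star> (aadj Rr \<diamondop> aid (x \<odot> zb))"
    by (subst (1 2) interchange) simp_all
  also have "\<dots> \<star> (aid zb \<diamondop> aadj G \<diamondop> aid zb) \<star> (aid zb \<diamondop> aid y \<diamondop> Rbr)
    = (aadj V \<diamondop> aid zb) \<star> (aadj Rr \<diamondop> aid x \<diamondop> aid zb) \<star> (aid zb \<diamondop> aadj G \<diamondop> aid zb) \<star> (aid zb \<diamondop> aid y \<diamondop> Rbr)"
    by (simp add: acomp_assoc aid_atens)
  finally show ?thesis
    by - (drule arg_cong[where f = mor], simp add: rotation_def)
qed

lemma mult_middle:
  assumes \<gamma>: "\<gamma> \<in> Hom C (z \<odot> x) (y \<odot> z)" and \<delta>: "\<delta> \<in> Hom C (z' \<odot> y') (x \<odot> z')" and v: "v \<in> Hom C x' x"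
  shows "((\<gamma> \<cdot> (idm C z \<otimes> v)) \<otimes> idm C z') \<cdot> (idm C z \<otimes> ((v\<^sup>\<dagger> \<otimes> idm C z') \<cdot> \<delta>))
    = (\<gamma> \<otimes> idm C z') \<cdot> (idm C z \<otimes> (((v \<cdot> v\<^sup>\<dagger>) \<otimes> idm C z') \<cdot> \<delta>))"
proof -
  define V where "V = Arrow x' x v"
  define G where "G = Arrow (z \<odot> x) (y \<odot> z) \<gamma>"
  define D where "D = Arrow (z' \<odot> y') (x \<odot> z') \<delta>"
  have sel [simp]: "src V = x'" "tgt V = x" "mor V = v"
    "src G = z \<odot> x" "tgt G = y \<odot> z" "mor G = \<gamma>"
    "src D = z' \<odot> y'" "tgt D = x \<odot> z'" "mor D = \<delta>"
    "valid V" "valid G" "valid D"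
    using assms by (simp_all add: V_def G_def D_def)
  have "((G \<star> (aid z \<diamondop> V)) \<diamondop> aid z') \<star> (aid z \<diamondop> ((aadj V \<diamondop> aid z') \<star> D))
     = ((G \<diamondop> aid z') \<star> ((aid z \<diamondop> V) \<diamondop> aid z')) \<star> (aid z \<diamondop> aadj V \<diamondop> aid z') \<star> (aid z \<diamondop> D)"
    by (simp add: interchange)
  also have "\<dots> = (G \<diamondop> aid z') \<star> (((aid z \<diamondop> V \<diamondop> aid z') \<star> (aid z \<diamondop> aadj V \<diamondop> aid z')) \<star> (aid z \<diamondop> D))"
    by (simp add: acomp_assoc atens_assoc)
  also have "\<dots> = (G \<diamondop> aid z') \<star> (aid z \<diamondop> (((V \<star> aadj V) \<diamondop> aid z') \<star> D))"
    by (simp add: interchange)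
  finally show ?thesis
    by - (drule arg_cong[where f = mor], simp)
qed

lemma rotation_eval:
  assumes sol: "conj_solution C x xb r rb"
  shows "rotation (xb \<odot> x) \<one> xb xb r rb (rb\<^sup>\<dagger> \<otimes> idm C x) = idm C xb \<otimes> rb"
proof -
  define Rr where "Rr = Arrow \<one> (xb \<odot> x) r"
  define Rbr where "Rbr = Arrow \<one> (x \<odot> xb) rb"
  note z = zigzag_arrows[OF sol, folded Rr_def Rbr_def]
    zigzag_arrows[OF conj_solution_swap[OF sol], folded Rr_def Rbr_def]
  have sel [simp]: "src Rr = \<one>" "tgt Rr = xb \<odot> x" "mor Rr = r"
    "src Rbr = \<one>" "tgt Rbr = x \<odot> xb" "mor Rbr = rb" "valid Rr" "valid Rbr"
    using z(1,2) by (simp_all add: Rr_def Rbr_def)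
  have u: "idm C \<one> \<otimes> rb = rb"
    using sol mtens_unit_left by (auto simp: conj_solution_def)
  have "(aadj Rr \<diamondop> aid (xb \<odot> x) \<diamondop> aid xb) \<star> (aid xb \<diamondop> aadj (aadj Rbr \<diamondop> aid x) \<diamondop> aid xb) \<star> (aid xb \<diamondop> aid \<one> \<diamondop> Rbr)
    = ((aadj Rr \<diamondop> aid xb) \<diamondop> aid (x \<odot> xb)) \<star> ((aid xb \<diamondop> Rbr) \<diamondop> aid (x \<odot> xb)) \<star> (aid xb \<diamondop> Rbr)"
    by (simp add: aadj_simps atens_assoc aid_atens)
  also have "\<dots> = (((aadj Rr \<diamondop> aid xb) \<star> (aid xb \<diamondop> Rbr)) \<diamondop> aid (x \<odot> xb)) \<star> (aid xb \<diamondop> Rbr)"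
    by (subst acomp_assoc[symmetric]) (simp_all add: interchange)
  also have "\<dots> = aid xb \<diamondop> Rbr"
    by (simp add: z aid_atens)
  finally show ?thesis
    by - (drule arg_cong[where f = mor], simp add: rotation_def u)
qed

text \<open>
  A conjugate of the unit need not be the unit, but by the second equation \<open>rb1\<close> identifies them, so
  that the involution of a tube without strand is the adjoint up to naturality.
\<close>

lemma rotation_unit:
  assumes sol: "conj_solution C \<one> b r1 rb1" and \<rho>: "\<rho> \<in> Hom C X \<one>"
  shows "rotation X \<one> b b r1 rb1 \<rho> = (idm C X \<otimes> rb1) \<cdot> (\<rho>\<^sup>\<dagger> \<cdot> r1\<^sup>\<dagger>)" "r1\<^sup>\<dagger> \<cdot> rb1 = idm C \<one>"
proof -
  define Rr where "Rr = Arrow \<one> b r1"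
  define Rbr where "Rbr = Arrow \<one> b rb1"
  define P where "P = Arrow X \<one> \<rho>"
  note z = zigzag_arrows[OF sol, simplified, folded Rr_def Rbr_def]
  have sel [simp]: "src Rr = \<one>" "tgt Rr = b" "mor Rr = r1"
    "src Rbr = \<one>" "tgt Rbr = b" "mor Rbr = rb1" "valid Rr" "valid Rbr"
    "src P = X" "tgt P = \<one>" "mor P = \<rho>" "valid P"
    using z(1,2) \<rho> by (simp_all add: Rr_def Rbr_def P_def)
  have "aadj Rr \<star> Rbr = aid \<one>"
    using z(3) by simp
  then show "r1\<^sup>\<dagger> \<cdot> rb1 = idm C \<one>"
    by - (drule arg_cong[where f = mor], simp)
  have u: "idm C \<one> \<otimes> rb1 = rb1"
    using sol mtens_unit_left by (auto simp: conj_solution_def)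
  have "(aadj Rr \<diamondop> aid X \<diamondop> aid b) \<star> (aid b \<diamondop> aadj P \<diamondop> aid b) \<star> (aid b \<diamondop> aid \<one> \<diamondop> Rbr)
    = aadj Rr \<diamondop> ((aid X \<star> aadj P \<star> aid \<one>) \<diamondop> (aid b \<star> aid b \<star> Rbr))"
    by (simp add: interchange flip: atens_assoc) 
  also have "\<dots> = aadj Rr \<diamondop> ((aid X \<diamondop> Rbr) \<star> (aadj P \<diamondop> aid \<one>))"
    by (subst interchange) simp_all
  also have "\<dots> = (aid \<one> \<diamondop> ((aid X \<diamondop> Rbr) \<star> (aadj P \<diamondop> aid \<one>))) \<star> (aadj Rr \<diamondop> aid \<one>)"
    by (subst interchange) simp_all
  also have "\<dots> = (aid X \<diamondop> Rbr) \<star> (aadj P \<star> aadj Rr)"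
    by (simp add: acomp_assoc)
  finally show "rotation X \<one> b b r1 rb1 \<rho> = (idm C X \<otimes> rb1) \<cdot> (\<rho>\<^sup>\<dagger> \<cdot> r1\<^sup>\<dagger>)"
    by - (drule arg_cong[where f = mor], simp add: rotation_def u)
qed

end

section \<open>Simple objects, projections and orthonormal bases\<close>

context cstar_category
begin

lemma simple_scalar:
  assumes "simple_obj C w" "f \<in> Hom C w w"
  obtains c where "f = cscale C c (idm C w)"
  using assms by (auto simp: simple_obj_def)

text \<open>
  The modulus of the scalar \<open>k\<^sup>\<dagger> k\<close> is given by the C*-identity, its sign by positivity.
\<close>

lemma adj_comp_simple:
  assumes w: "simple_obj C w" and k: "k \<in> Hom C w y"
  shows "k\<^sup>\<dagger> \<cdot> k = cscale C (complex_of_real ((mnorm C k)\<^sup>2)) (idm C w)"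
proof -
  obtain h where h: "h \<in> Hom C w w" "k\<^sup>\<dagger> \<cdot> k = h\<^sup>\<dagger> \<cdot> h"
    using adj_comp_positive[OF k] by blast
  obtain c where c: "h = cscale C c (idm C w)"
    using simple_scalar[OF w h(1)] .
  have "k\<^sup>\<dagger> \<cdot> k = cscale C (cnj c * c) (idm C w)"
    unfolding h(2) c
    by (simp add: adj_cscale[OF idm_in] adj_idm comp_cscale_left[OF scale_in[OF idm_in] idm_in]
        comp_cscale_right[OF idm_in idm_in] comp_idm[OF idm_in])
  also have "cnj c * c = complex_of_real ((cmod c)\<^sup>2)"
    by (metis complex_norm_square mult.commute of_real_power)
  finally have eq: "k\<^sup>\<dagger> \<cdot> k = cscale C (complex_of_real ((cmod c)\<^sup>2)) (idm C w)" .
  moreover have "(mnorm C k)\<^sup>2 = (cmod c)\<^sup>2"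
    using cstar_identity[OF k] mnorm_cscale[OF idm_in, of "complex_of_real ((cmod c)\<^sup>2)" w] w
    by (simp add: eq mnorm_idm simple_obj_def norm_power)
  ultimately show ?thesis
    by simp
qed

lemma Schur_iso:
  assumes w: "simple_obj C w" and y: "simple_obj C y" and f: "f \<in> Hom C w y" "f \<noteq> 0"
  shows "iso_obj C w y"
proof -
  have nz: "mnorm C f \<noteq> 0"
    using f mnorm_eq_0_iff by blast
  define g where "g = cscale C (1 / complex_of_real ((mnorm C f)\<^sup>2)) (f\<^sup>\<dagger>)"
  have g: "g \<in> Hom C y w"
    using f by (simp add: g_def scale_in adj_in)
  have gf: "g \<cdot> f = idm C w"
    using nz unfolding g_def
    by (simp add: comp_cscale_left[OF f(1) adj_in[OF f(1)]] adj_comp_simple[OF w f(1)])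
  obtain c where c: "f \<cdot> g = cscale C c (idm C y)"
    using simple_scalar[OF y comp_in[OF g f(1)]] .
  have "(f \<cdot> g) \<cdot> f = f"
    using comp_assoc[OF f(1) g f(1)] gf comp_idm[OF f(1)] by simp
  then have "cscale C c f = f"
    by (simp add: c comp_cscale_left[OF f(1) idm_in] idm_comp[OF f(1)])
  then have "cscale C (c - 1) f = 0"
    by (simp add: vs.scale_left_diff_distrib)
  then have "c = 1"
    using f(2) by simp
  then show ?thesis
    using c g gf f(1) by (auto simp: iso_obj_def)
qed

definition projection :: "'o \<Rightarrow> 'm \<Rightarrow> bool" where
  "projection x p \<longleftrightarrow> p \<in> Hom C x x \<and> p\<^sup>\<dagger> = p \<and> p \<cdot> p = p"

definition orth_projections :: "'o \<Rightarrow> 'm set \<Rightarrow> bool" where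
  "orth_projections x P \<longleftrightarrow> finite P \<and> (\<forall>p\<in>P. projection x p \<and> p \<noteq> 0) \<and>
    (\<forall>p\<in>P. \<forall>q\<in>P. p \<noteq> q \<longrightarrow> p \<cdot> q = 0)"

lemma projection_sum:
  assumes "orth_projections x P"
  shows "projection x (\<Sum>P)"
proof -
  have P: "finite P" "\<And>p. p \<in> P \<Longrightarrow> p \<in> Hom C x x" "\<And>p. p \<in> P \<Longrightarrow> p\<^sup>\<dagger> = p"
    "\<And>p q. p \<in> P \<Longrightarrow> q \<in> P \<Longrightarrow> p \<cdot> q = (if p = q then p else 0)"
    using assms by (auto simp: orth_projections_def projection_def)
  have "(\<Sum>P) \<cdot> (\<Sum>P) = (\<Sum>p\<in>P. p \<cdot> \<Sum>P)"
    by (rule comp_sum_left) (use P in \<open>auto intro: sum_in\<close>)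
  also have "\<dots> = (\<Sum>p\<in>P. \<Sum>q\<in>P. p \<cdot> q)"
    by (intro sum.cong refl comp_sum_right) (use P in auto)
  also have "\<dots> = (\<Sum>p\<in>P. \<Sum>q\<in>P. if p = q then p else 0)"
    using P by (intro sum.cong) auto
  also have "\<dots> = \<Sum>P"
    using P(1) by simp
  finally show ?thesis
    using P by (simp add: projection_def sum_in adj_sum[of _ "\<lambda>p. p" x x])
qed

lemma projection_compl:
  assumes "projection x p"
  shows "projection x (idm C x - p)"
  using assms unfolding projection_def
  by (simp add: diff_in idm_in adj_diff[of _ x x] adj_idm comp_diff_left[of _ x x _ x] comp_diff_right[of _ x x _ _ x]
      comp_idm[of _ x x] idm_comp[of _ x x])

text \<open>
  Orthogonal isometries are counted through their range projections.
\<close>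

lemma isometries_orth_projections:
  assumes "finite I" "\<And>i. i \<in> I \<Longrightarrow> idm C (w i) \<noteq> 0"
    and u: "\<And>i. i \<in> I \<Longrightarrow> u i \<in> Hom C (w i) z" "\<And>i. i \<in> I \<Longrightarrow> (u i)\<^sup>\<dagger> \<cdot> u i = idm C (w i)"
    and o: "\<And>i j. i \<in> I \<Longrightarrow> j \<in> I \<Longrightarrow> i \<noteq> j \<Longrightarrow> (u i)\<^sup>\<dagger> \<cdot> u j = 0"
  shows "orth_projections z ((\<lambda>i. u i \<cdot> (u i)\<^sup>\<dagger>) ` I)" "card ((\<lambda>i. u i \<cdot> (u i)\<^sup>\<dagger>) ` I) = card I"
proof -
  have ua: "(u i)\<^sup>\<dagger> \<in> Hom C z (w i)" "u i \<cdot> (u i)\<^sup>\<dagger> \<in> Hom C z z" if "i \<in> I" for i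
    using u(1)[OF that] by (blast intro: adj_in comp_in)+
  have pu: "(u i \<cdot> (u i)\<^sup>\<dagger>) \<cdot> u j = (if i = j then u i else 0)" if "i \<in> I" "j \<in> I" for i j
    using comp_assoc[OF u(1)[OF that(2)] ua(1)[OF that(1)] u(1)[OF that(1)]]
      o[OF that] u(2)[OF that(1)] comp_idm[OF u(1)[OF that(1)]]
      comp_zero_right[OF u(1)[OF that(1)]] by auto
  have pp: "(u i \<cdot> (u i)\<^sup>\<dagger>) \<cdot> (u j \<cdot> (u j)\<^sup>\<dagger>) = (if i = j then u i \<cdot> (u i)\<^sup>\<dagger> else 0)"
    if "i \<in> I" "j \<in> I" for i j
    using comp_assoc[OF ua(1)[OF that(2)] u(1)[OF that(2)] ua(2)[OF that(1)]] pu[OF that]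
      comp_zero_left[OF ua(1)[OF that(2)]] by auto
  have nz: "u i \<noteq> 0" if "i \<in> I" for i
    using u(2)[OF that] assms(2)[OF that] comp_zero_right[OF ua(1)[OF that]] by auto
  have inj: "i = j" if "i \<in> I" "j \<in> I" "u i \<cdot> (u i)\<^sup>\<dagger> = u j \<cdot> (u j)\<^sup>\<dagger>" for i j
  proof (rule ccontr)
    assume "i \<noteq> j"
    then have "(u j \<cdot> (u j)\<^sup>\<dagger>) \<cdot> u i = 0"
      using pu[OF that(2,1)] by simp
    then show False
      using pu[OF that(1,1)] nz[OF that(1)] unfolding that(3) by simp
  qed
  have "u i \<cdot> (u i)\<^sup>\<dagger> \<noteq> 0" if "i \<in> I" for i
    using pu[OF that that] nz[OF that] comp_zero_left[OF u(1)[OF that]] by auto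
  moreover have "(u i \<cdot> (u i)\<^sup>\<dagger>)\<^sup>\<dagger> = u i \<cdot> (u i)\<^sup>\<dagger>" if "i \<in> I" for i
    using adj_comp[OF ua(1)[OF that] u(1)[OF that]] adj_adj[OF u(1)[OF that]] by simp
  ultimately show "orth_projections z ((\<lambda>i. u i \<cdot> (u i)\<^sup>\<dagger>) ` I)"
    using assms(1) ua pp inj by (auto simp: orth_projections_def projection_def)
  show "card ((\<lambda>i. u i \<cdot> (u i)\<^sup>\<dagger>) ` I) = card I"
    using inj by (intro card_image inj_onI)
qed

text \<open>
  A maximal orthogonal family thus consists of minimal projections.
\<close>

lemma orth_projections_split:
  assumes P: "orth_projections x P" and p: "p \<in> P" and q: "projection x q" "q \<noteq> 0" "q \<noteq> p"
    and qp: "q \<cdot> p = q" "p \<cdot> q = q"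
  shows "\<exists>P'. orth_projections x P' \<and> card P' = card P + 1"
proof -
  have pr: "projection x p" "finite P" and P': "\<And>s. s \<in> P \<Longrightarrow> projection x s \<and> s \<noteq> 0"
    "\<And>s t. s \<in> P \<Longrightarrow> t \<in> P \<Longrightarrow> s \<noteq> t \<Longrightarrow> s \<cdot> t = 0"
    using P p by (auto simp: orth_projections_def)
  have in_: "q \<in> Hom C x x" "p \<in> Hom C x x" and hs: "\<And>s. s \<in> P \<Longrightarrow> s \<in> Hom C x x"
    using q pr P' by (auto simp: projection_def)
  have pq: "projection x (p - q)"
    using pr q qp in_ by (simp add: projection_def diff_in adj_diff[of _ x x]
        comp_diff_left[of _ x x _ x] comp_diff_right[of _ x x _ _ x])
  have qq: "q \<cdot> (p - q) = 0" "(p - q) \<cdot> q = 0"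
    using q qp in_ by (simp_all add: projection_def comp_diff_left[of _ x x _ x] comp_diff_right[of _ x x _ _ x])
  have "q \<cdot> s = 0" "s \<cdot> q = 0" "(p - q) \<cdot> s = 0" "s \<cdot> (p - q) = 0" if s: "s \<in> P" "s \<noteq> p" for s
  proof -
    have ps: "p \<cdot> s = 0" "s \<cdot> p = 0"
      using P'(2)[OF p s(1)] P'(2)[OF s(1) p] s(2) by auto
    show 1: "q \<cdot> s = 0"
      using comp_assoc[OF hs[OF s(1)] in_(2,1)] ps qp comp_zero_right[OF in_(1)] by simp
    show 2: "s \<cdot> q = 0"
      using comp_assoc[OF in_(1,2) hs[OF s(1)]] ps qp comp_zero_left[OF in_(1)] by simp
    show "(p - q) \<cdot> s = 0" "s \<cdot> (p - q) = 0"
      using 1 2 ps in_ hs[OF s(1)]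
      by (simp_all add: comp_diff_left[of _ x x _ x] comp_diff_right[of _ x x _ _ x])
  qed note z = this
  have pq0: "p - q \<noteq> 0"
    using q(3) by simp
  have notin: "q \<notin> P - {p}" "p - q \<notin> P - {p}" "q \<noteq> p - q"
  proof -
    show "q \<notin> P - {p}"
      using z(1)[of q] q(1,2) by (auto simp: projection_def)
    show "p - q \<notin> P - {p}"
      using z(3)[of "p - q"] pq pq0 by (auto simp: projection_def)
    show "q \<noteq> p - q"
      using qq(1) q(1,2) by (auto simp: projection_def)
  qed
  have "orth_projections x (insert q (insert (p - q) (P - {p})))"
    unfolding orth_projections_def
    using pr(2) P' q pq pq0 qq z by auto
  moreover have "card (insert q (insert (p - q) (P - {p}))) = card P + 1"
    using notin pr(2) card_Suc_Diff1[OF pr(2) p] by simp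
  ultimately show ?thesis
    by blast
qed

end

context cstar_tensor_category
begin

text \<open>
  The vectors \<open>k p = (1 \<otimes> p) r\<close> satisfy \<open>\<parallel>k p\<parallel>\<^sup>2 = r\<^sup>\<dagger> (1 \<otimes> p) r\<close>, which is additive in \<open>p\<close> and at
  most \<open>\<parallel>r\<parallel>\<^sup>2\<close> in total.  Each of them is bounded below, since \<open>p\<close> has norm one and is recovered from
  \<open>k p\<close> by Frobenius reciprocity.  The morphisms \<open>1 \<otimes> p\<close> and
  \<open>1 \<otimes> k p\<close> are a projection and a multiple of an isometry, so the C*-identity controls their norms.
\<close>

lemma orth_projections_bounded:
  assumes sol: "conj_solution C z zb r rb" and unit: "simple_obj C \<one>"
  shows "\<exists>N. \<forall>P. orth_projections z P \<longrightarrow> card P \<le> N"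
proof -
  have r: "r \<in> Hom C \<one> (zb \<odot> z)" and rb: "rb \<in> Hom C \<one> (z \<odot> zb)"
    using sol by (auto simp: conj_solution_def)
  define b where "b = mnorm C (rb\<^sup>\<dagger> \<otimes> idm C z)"
  define k where "k p = (idm C zb \<otimes> p) \<cdot> r" for p
  have k: "k p \<in> Hom C \<one> (zb \<odot> z)" if "p \<in> Hom C z z" for p
    using that r by (auto simp: k_def intro: tensor_intros)
  have rbz: "rb\<^sup>\<dagger> \<otimes> idm C z \<in> Hom C (z \<odot> zb \<odot> z) z"
    using mtens_in[OF adj_in[OF rb] idm_in[of z]] by simp
  have "0 \<le> b"
    unfolding b_def by (rule mnorm_nonneg[OF rbz])
  have low: "1 \<le> b\<^sup>2 * (mnorm C (k p))\<^sup>2" if p: "projection z p" "p \<noteq> 0" for p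
  proof -
    have p': "p \<in> Hom C z z" "mnorm C p = 1"
      using p mnorm_projection[of p z] by (auto simp: projection_def)
    have zk: "idm C z \<otimes> k p \<in> Hom C z (z \<odot> zb \<odot> z)"
      using mtens_in[OF idm_in[of z] k[OF p'(1)]] by simp
    have "(idm C z \<otimes> k p)\<^sup>\<dagger> \<cdot> (idm C z \<otimes> k p) = idm C z \<otimes> ((k p)\<^sup>\<dagger> \<cdot> k p)"
      using mtens_comp[OF idm_in[of z] idm_in[of z] k[OF p'(1)] adj_in[OF k[OF p'(1)]]]
      by (simp add: adj_mtens[OF idm_in k[OF p'(1)]] adj_idm comp_idm[OF idm_in])
    also have "\<dots> = cscale C (complex_of_real ((mnorm C (k p))\<^sup>2)) (idm C z)"
      by (simp add: adj_comp_simple[OF unit k[OF p'(1)]] mtens_cscale_right[OF idm_in idm_in]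
          mtens_unit_right[OF idm_in])
    finally have "(mnorm C (idm C z \<otimes> k p))\<^sup>2 \<le> (mnorm C (k p))\<^sup>2"
      using cstar_identity[OF zk]
      by (auto simp: mnorm_cscale[OF idm_in] mnorm_idm norm_power split: if_splits)
    then have "mnorm C (idm C z \<otimes> k p) \<le> mnorm C (k p)"
      using mnorm_nonneg[OF k[OF p'(1)]] power2_le_imp_le by blast
    moreover have "1 \<le> b * mnorm C (idm C z \<otimes> k p)"
      using mnorm_comp[OF zk rbz] p' transpose_inverse[OF sol p'(1)] by (simp add: b_def k_def)
    ultimately have "1 \<le> b * mnorm C (k p)"
      using \<open>0 \<le> b\<close> by (meson mult_left_mono order_trans)
    then have "1\<^sup>2 \<le> (b * mnorm C (k p))\<^sup>2"
      by (intro power_mono) auto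
    then show ?thesis
      by (simp add: power_mult_distrib)
  qed
  have kk: "(k p)\<^sup>\<dagger> \<cdot> k p = r\<^sup>\<dagger> \<cdot> k p" if p: "projection z p" for p
  proof -
    have p': "p \<in> Hom C z z" "p\<^sup>\<dagger> = p" "p \<cdot> p = p"
      using p by (auto simp: projection_def)
    have zp: "idm C zb \<otimes> p \<in> Hom C (zb \<odot> z) (zb \<odot> z)"
      using mtens_in[OF idm_in p'(1)] .
    have "(k p)\<^sup>\<dagger> = r\<^sup>\<dagger> \<cdot> (idm C zb \<otimes> p)"
      unfolding k_def using adj_comp[OF r zp] adj_mtens[OF idm_in p'(1)] p'(2) by (simp add: adj_idm)
    then have "(k p)\<^sup>\<dagger> \<cdot> k p = r\<^sup>\<dagger> \<cdot> (idm C zb \<otimes> p) \<cdot> k p"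
      using comp_assoc[OF k[OF p'(1)] zp adj_in[OF r]] by simp
    also have "(idm C zb \<otimes> p) \<cdot> k p = ((idm C zb \<otimes> p) \<cdot> (idm C zb \<otimes> p)) \<cdot> r"
      unfolding k_def using comp_assoc[OF r zp zp] by simp
    also have "(idm C zb \<otimes> p) \<cdot> (idm C zb \<otimes> p) = idm C zb \<otimes> p"
      using mtens_comp[OF idm_in idm_in p'(1) p'(1)] p'(3) by (simp add: comp_idm[OF idm_in])
    finally show ?thesis
      by (simp add: k_def)
  qed
  have k_sum: "k (sum f I) = (\<Sum>i\<in>I. k (f i))" if "\<And>i. i \<in> I \<Longrightarrow> f i \<in> Hom C z z" for f :: "'b \<Rightarrow> 'b" and I
    using that
  proof (induction I rule: infinite_finite_induct)
    case (insert i I)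
    have "k (f i + sum f I) = k (f i) + k (sum f I)"
      unfolding k_def using insert
      by (subst mtens_add_right[OF idm_in])
        (auto intro!: comp_add_left[OF r] sum_in mtens_in idm_in)
    then show ?case
      using insert by simp
  next
    case empty
    show ?case
      by (simp add: k_def mtens_zero_right[OF idm_in] comp_zero_left[OF r])
  next
    case (infinite I)
    then show ?case
      by (simp add: k_def mtens_zero_right[OF idm_in] comp_zero_left[OF r])
  qed
  have up: "(\<Sum>p\<in>P. (mnorm C (k p))\<^sup>2) \<le> (mnorm C r)\<^sup>2" if P: "orth_projections z P" for P
  proof -
    have P': "\<And>p. p \<in> P \<Longrightarrow> projection z p" "\<And>p. p \<in> P \<Longrightarrow> p \<in> Hom C z z"
      using P by (auto simp: orth_projections_def projection_def)
    have q: "projection z (\<Sum>P)" "\<Sum>P \<in> Hom C z z"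
      using projection_sum[OF P] by (auto simp: projection_def)
    have "cscale C (complex_of_real (\<Sum>p\<in>P. (mnorm C (k p))\<^sup>2)) (idm C \<one>) = (\<Sum>p\<in>P. (k p)\<^sup>\<dagger> \<cdot> k p)"
      using P'(2) adj_comp_simple[OF unit k] by (simp add: vs.scale_sum_left)
    also have "\<dots> = r\<^sup>\<dagger> \<cdot> k (\<Sum>P)"
      using P' k by (simp add: kk k_sum comp_sum_right[OF adj_in[OF r], of _ _ \<one>])
    also have "\<dots> = cscale C (complex_of_real ((mnorm C (k (\<Sum>P)))\<^sup>2)) (idm C \<one>)"
      using kk[OF q(1)] adj_comp_simple[OF unit k[OF q(2)]] by simp
    finally have "(\<Sum>p\<in>P. (mnorm C (k p))\<^sup>2) = (mnorm C (k (\<Sum>P)))\<^sup>2"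
      using unit by (auto simp: simple_obj_def vs.scale_cancel_right simp flip: of_real_sum of_real_power)
    also have "\<dots> \<le> (mnorm C r)\<^sup>2"
    proof (rule power_mono)
      have "idm C zb \<otimes> \<Sum>P \<in> Hom C (zb \<odot> z) (zb \<odot> z)"
        "(idm C zb \<otimes> \<Sum>P)\<^sup>\<dagger> = idm C zb \<otimes> \<Sum>P"
        "(idm C zb \<otimes> \<Sum>P) \<cdot> (idm C zb \<otimes> \<Sum>P) = idm C zb \<otimes> \<Sum>P"
        using q mtens_comp[OF idm_in[of zb] idm_in q(2) q(2)]
        by (auto simp: projection_def adj_mtens[OF idm_in q(2)] adj_idm comp_idm[OF idm_in] intro: mtens_in idm_in)
      then have "mnorm C (idm C zb \<otimes> \<Sum>P) \<le> 1" and i: "idm C zb \<otimes> \<Sum>P \<in> Hom C (zb \<odot> z) (zb \<odot> z)"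
        using mnorm_projection by simp_all
      then show "mnorm C (k (\<Sum>P)) \<le> mnorm C r"
        using mnorm_comp[OF r i] mnorm_nonneg[OF r] mnorm_nonneg[OF i] unfolding k_def
        by (meson mult_left_le_one_le order_trans)
      show "0 \<le> mnorm C (k (\<Sum>P))"
        using mnorm_nonneg[OF k[OF q(2)]] .
    qed
    finally show ?thesis .
  qed
  have "card P \<le> nat \<lceil>b\<^sup>2 * (mnorm C r)\<^sup>2\<rceil>" if P: "orth_projections z P" for P
  proof -
    have "real (card P) = (\<Sum>p\<in>P. 1)"
      by simp
    also have "\<dots> \<le> (\<Sum>p\<in>P. b\<^sup>2 * (mnorm C (k p))\<^sup>2)"
      using P low by (intro sum_mono) (auto simp: orth_projections_def)
    also have "\<dots> = b\<^sup>2 * (\<Sum>p\<in>P. (mnorm C (k p))\<^sup>2)"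
      by (simp add: sum_distrib_left)
    also have "\<dots> \<le> b\<^sup>2 * (mnorm C r)\<^sup>2"
      using up[OF P] by (intro mult_left_mono) auto
    finally show ?thesis
      by linarith
  qed
  then show ?thesis
    by blast
qed

text \<open>
  An orthonormal set of largest cardinality spans: otherwise the normalised residual of some vector
  would enlarge it.
\<close>

lemma ex_orthonormal_basis:
  assumes sol: "conj_solution C z zb r rb" and unit: "simple_obj C \<one>" and w: "simple_obj C w"
  shows "\<exists>B. orthonormal_basis C w z B"
proof -
  define on where "on B \<longleftrightarrow> finite B \<and> B \<subseteq> Hom C w z \<and>
    (\<forall>s\<in>B. \<forall>t\<in>B. t\<^sup>\<dagger> \<cdot> s = (if s = t then idm C w else 0))" for B
  obtain N where N: "\<And>P. orth_projections z P \<Longrightarrow> card P \<le> N"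
    using orth_projections_bounded[OF sol unit] by blast
  have wnz: "idm C w \<noteq> 0"
    using w by (simp add: simple_obj_def)
  have bound: "card B \<le> N" if "on B" for B
    using that isometries_orth_projections[of B "\<lambda>_. w" "\<lambda>s. s" z] N wnz
    by (fastforce simp: on_def)
  have "on {}"
    by (simp add: on_def)
  then obtain B where B: "on B" "\<And>B'. on B' \<Longrightarrow> card B' \<le> card B"
    using ex_has_greatest_nat[of on "{}" card "Suc N"] bound by (auto simp: less_Suc_eq_le)
  have Bin: "finite B" "\<And>s. s \<in> B \<Longrightarrow> s \<in> Hom C w z"
    "\<And>s t. s \<in> B \<Longrightarrow> t \<in> B \<Longrightarrow> t\<^sup>\<dagger> \<cdot> s = (if s = t then idm C w else 0)"
    using B(1) by (auto simp: on_def)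
  have "f \<in> module.span (cscale C) B" if f: "f \<in> Hom C w z" for f
  proof -
    have "\<exists>c. e\<^sup>\<dagger> \<cdot> f = cscale C c (idm C w)" if "e \<in> B" for e
      using simple_scalar[OF w comp_in[OF f adj_in[OF Bin(2)[OF that]]]] by metis
    then obtain c where c: "\<And>e. e \<in> B \<Longrightarrow> e\<^sup>\<dagger> \<cdot> f = cscale C (c e) (idm C w)"
      by metis
    define h where "h = (\<Sum>e\<in>B. cscale C (c e) e)"
    have h: "h \<in> Hom C w z"
      unfolding h_def by (intro sum_in scale_in Bin)
    have hs: "h \<in> module.span (cscale C) B"
      unfolding h_def by (intro vs.span_sum vs.span_scale vs.span_base)
    have eh: "e\<^sup>\<dagger> \<cdot> (f - h) = 0" if e: "e \<in> B" for e
    proof -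
      have "e\<^sup>\<dagger> \<cdot> h = (\<Sum>e'\<in>B. e\<^sup>\<dagger> \<cdot> cscale C (c e') e')"
        unfolding h_def by (rule comp_sum_right[OF adj_in[OF Bin(2)[OF e]], where x = w]) (intro scale_in Bin)
      also have "\<dots> = (\<Sum>e'\<in>B. if e' = e then cscale C (c e) (idm C w) else 0)"
        using e Bin by (intro sum.cong) (auto simp: comp_cscale_right[OF _ adj_in[OF Bin(2)[OF e]], of _ w])
      also have "\<dots> = e\<^sup>\<dagger> \<cdot> f"
        using e Bin(1) c by simp
      finally show ?thesis
        using comp_diff_right[OF f h adj_in[OF Bin(2)[OF e]]] by simp
    qed
    have "f - h = 0"
    proof (rule ccontr)
      assume nz: "f - h \<noteq> 0"
      have fh: "f - h \<in> Hom C w z"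
        using f h by (rule diff_in)
      define g where "g = cscale C (complex_of_real (1 / mnorm C (f - h))) (f - h)"
      have mn: "mnorm C (f - h) \<noteq> 0"
        using nz mnorm_eq_0_iff[OF fh] by simp
      have g: "g \<in> Hom C w z"
        unfolding g_def using fh by (rule scale_in)
      have "mnorm C g = 1"
        using mn mnorm_nonneg[OF fh] by (simp add: g_def mnorm_cscale[OF fh] norm_divide)
      then have gg: "g\<^sup>\<dagger> \<cdot> g = idm C w"
        using adj_comp_simple[OF w g] by simp
      have eg: "e\<^sup>\<dagger> \<cdot> g = 0" if e: "e \<in> B" for e
        unfolding g_def using comp_cscale_right[OF fh adj_in[OF Bin(2)[OF e]]] eh[OF e] by simp
      have ge: "g\<^sup>\<dagger> \<cdot> e = 0" if e: "e \<in> B" for e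
        using adj_comp[OF g adj_in[OF Bin(2)[OF e]]] eg[OF e] adj_adj[OF Bin(2)[OF e]] adj_zero by simp
      have "g \<notin> B"
        using ge[of g] gg wnz by auto
      moreover have "on (insert g B)"
        using Bin g gg ge eg \<open>g \<notin> B\<close> by (auto simp: on_def)
      ultimately show False
        using B(2)[of "insert g B"] Bin(1) by simp
    qed
    then show ?thesis
      using hs by simp
  qed
  moreover have "module.span (cscale C) B \<subseteq> Hom C w z"
    by (rule vs.span_minimal) (use Bin subspace_Hom in auto)
  ultimately show ?thesis
    using Bin by (intro exI[of _ B]) (auto simp: orthonormal_basis_def)
qed

end

section \<open>Minimal projections\<close>

text \<open>
  Linear dependence of a family rather than of a set, so that repeated vectors are covered.
\<close>

lemma (in vector_space) nontrivial_relation: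
  assumes "finite E" "\<And>i. i \<le> n \<Longrightarrow> v i \<in> span E" "card E \<le> n"
  shows "\<exists>c. (\<exists>i\<le>n. c i \<noteq> 0) \<and> (\<Sum>i\<le>n. scale (c i) (v i)) = 0"
proof (cases "inj_on v {..n}")
  case True
  have "dependent (v ` {..n})"
  proof (rule ccontr)
    assume "independent (v ` {..n})"
    then have "card (v ` {..n}) \<le> card E"
      using independent_span_bound[OF assms(1)] assms(2) by blast
    then show False
      using assms(3) card_image[OF True] by simp
  qed
  then obtain u where u: "\<exists>x\<in>v ` {..n}. u x \<noteq> 0" "(\<Sum>x\<in>v ` {..n}. scale (u x) x) = 0"
    using dependent_finite[of "v ` {..n}"] by blast
  have "(\<Sum>i\<le>n. scale (u (v i)) (v i)) = 0"
    using u(2) by (simp add: sum.reindex[OF True])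
  then show ?thesis
    using u(1) by (intro exI[of _ "u \<circ> v"]) auto
next
  case False
  then obtain i j where ij: "i \<le> n" "j \<le> n" "i \<noteq> j" "v i = v j"
    by (auto simp: inj_on_def)
  define c :: "nat \<Rightarrow> 'a" where "c k = (if k = i then 1 else if k = j then - 1 else 0)" for k
  have "(\<Sum>k\<le>n. scale (c k) (v k)) = (\<Sum>k\<in>{i, j}. scale (c k) (v k))"
    using ij by (intro sum.mono_neutral_right) (auto simp: c_def)
  also have "\<dots> = 0"
    using ij by (simp add: c_def)
  finally show ?thesis
    using ij(1) by (intro exI[of _ c]) (auto simp: c_def)
qed

context cstar_category
begin

definition poly_mor :: "'o \<Rightarrow> 'm \<Rightarrow> complex poly \<Rightarrow> 'm" where
  "poly_mor x a p = fold_coeffs (\<lambda>c f. cscale C c (idm C x) + a \<cdot> f) p 0"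

lemma poly_mor_0 [simp]: "poly_mor x a 0 = 0"
  by (simp add: poly_mor_def)

lemma poly_mor_pCons:
  assumes "a \<in> Hom C x x"
  shows "poly_mor x a (pCons c p) = cscale C c (idm C x) + a \<cdot> poly_mor x a p"
  by (cases "p = 0 \<and> c = 0") (auto simp: poly_mor_def comp_zero_right[OF assms])

lemma poly_mor_in: "a \<in> Hom C x x \<Longrightarrow> poly_mor x a p \<in> Hom C x x"
  by (induction p) (auto simp: poly_mor_pCons intro: hom_intros)

lemma poly_mor_add:
  assumes a: "a \<in> Hom C x x"
  shows "poly_mor x a (p + q) = poly_mor x a p + poly_mor x a q"
  by (induction p q rule: poly_induct2)
    (simp_all add: poly_mor_pCons[OF a] comp_add_right[OF poly_mor_in[OF a] poly_mor_in[OF a] a]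
      vs.scale_left_distrib)

lemma poly_mor_smult:
  assumes a: "a \<in> Hom C x x"
  shows "poly_mor x a (smult c p) = cscale C c (poly_mor x a p)"
  by (induction p)
    (simp_all add: poly_mor_pCons[OF a] comp_cscale_right[OF poly_mor_in[OF a] a]
      vs.scale_right_distrib)

lemma poly_mor_sum:
  assumes a: "a \<in> Hom C x x"
  shows "poly_mor x a (sum p I) = (\<Sum>i\<in>I. poly_mor x a (p i))"
  by (induction I rule: infinite_finite_induct) (simp_all add: poly_mor_add[OF a])

lemma poly_mor_commute:
  assumes a: "a \<in> Hom C x x"
  shows "a \<cdot> poly_mor x a p = poly_mor x a p \<cdot> a"
proof (induction p)
  case 0
  then show ?case
    by (simp add: comp_zero_left[OF a] comp_zero_right[OF a])
next
  case (pCons c p)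
  have p: "poly_mor x a p \<in> Hom C x x"
    using poly_mor_in[OF a] .
  have "a \<cdot> (cscale C c (idm C x) + a \<cdot> poly_mor x a p) = cscale C c a + a \<cdot> (a \<cdot> poly_mor x a p)"
    using a p by (simp add: comp_add_right[of _ x x _ _ x] scale_in idm_in comp_in[of _ x x]
        comp_cscale_right[of _ x x _ x] comp_idm[of _ x x])
  also have "a \<cdot> (a \<cdot> poly_mor x a p) = (a \<cdot> poly_mor x a p) \<cdot> a"
    using pCons comp_assoc[OF a p a] by simp
  also have "cscale C c a + (a \<cdot> poly_mor x a p) \<cdot> a = (cscale C c (idm C x) + a \<cdot> poly_mor x a p) \<cdot> a"
    using a p by (simp add: comp_add_left[of _ x x _ x] scale_in idm_in comp_in[of _ x x]
        comp_cscale_left[of _ x x _ x] idm_comp[of _ x x])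
  finally show ?case
    by (simp add: poly_mor_pCons[OF a])
qed

lemma poly_mor_eigen:
  assumes a: "a \<in> Hom C x x" and b: "b \<in> Hom C y x" and ab: "a \<cdot> b = cscale C l b"
  shows "poly_mor x a p \<cdot> b = cscale C (poly p l) b"
proof (induction p)
  case 0
  then show ?case
    by (simp add: comp_zero_left[OF b])
next
  case (pCons c p)
  have p: "poly_mor x a p \<in> Hom C x x"
    using poly_mor_in[OF a] .
  have "(cscale C c (idm C x) + a \<cdot> poly_mor x a p) \<cdot> b = cscale C c b + a \<cdot> (poly_mor x a p \<cdot> b)"
    by (simp add: comp_add_left[OF b scale_in[OF idm_in] comp_in[OF p a]]
        comp_cscale_left[OF b idm_in] idm_comp[OF b] comp_assoc[OF b p a])
  also have "a \<cdot> (poly_mor x a p \<cdot> b) = cscale C (l * poly p l) b"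
    by (simp add: pCons comp_cscale_right[OF b a] ab mult.commute)
  finally show ?case
    by (simp add: poly_mor_pCons[OF a] vs.scale_left_distrib)
qed

text \<open>
  If \<open>m\<close> is a polynomial of least degree with \<open>m(a) = 0\<close> and \<open>m = (X - l) q\<close>, then \<open>b = q(a)\<close> satisfies
  \<open>a b = l b\<close>.  Self-adjointness of \<open>a\<close> makes \<open>b\<close> a nonzero multiple of a projection, and the
  identity is the only nonzero projection.
\<close>

lemma selfadjoint_scalar:
  assumes a: "a \<in> Hom C x x" "a\<^sup>\<dagger> = a" and nz: "idm C x \<noteq> 0"
    and ann: "\<exists>p. p \<noteq> 0 \<and> poly_mor x a p = 0"
    and min: "\<And>p. projection x p \<Longrightarrow> p \<noteq> 0 \<Longrightarrow> p = idm C x"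
  shows "\<exists>c. a = cscale C c (idm C x)"
proof -
  obtain m where m: "m \<noteq> 0" "poly_mor x a m = 0"
    and m_min: "\<And>p. p \<noteq> 0 \<Longrightarrow> poly_mor x a p = 0 \<Longrightarrow> degree m \<le> degree p"
    using ann ex_has_least_nat[of "\<lambda>p. p \<noteq> 0 \<and> poly_mor x a p = 0" _ degree] by blast
  have "degree m \<noteq> 0"
  proof
    assume "degree m = 0"
    then obtain c where "m = [:c:]"
      by (metis degree_0_id)
    then show False
      using m nz by (simp add: poly_mor_pCons[OF a(1)] comp_zero_right[OF a(1)])
  qed
  then obtain l where "poly m l = 0"
    using fundamental_theorem_of_algebra[of m] by (auto simp: constant_degree)
  then obtain q where q: "m = [:- l, 1:] * q"
    by (auto simp: poly_eq_0_iff_dvd elim: dvdE)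
  have qnz: "q \<noteq> 0"
    using m(1) q by auto
  have "degree q < degree m"
    using qnz degree_mult_eq[of "[:- l, 1:]" q] q by simp
  define b where "b = poly_mor x a q"
  have bnz: "b \<noteq> 0"
    using m_min[OF qnz] \<open>degree q < degree m\<close> unfolding b_def by linarith
  have b: "b \<in> Hom C x x" "b\<^sup>\<dagger> \<in> Hom C x x"
    unfolding b_def using poly_mor_in[OF a(1)] by (auto intro: adj_in)
  have "poly_mor x a m = a \<cdot> b - cscale C l b"
  proof -
    have "m = pCons 0 q + smult (- l) q"
      using q by simp
    then show ?thesis
      unfolding b_def
      by (simp only: poly_mor_add[OF a(1)] poly_mor_smult[OF a(1)] poly_mor_pCons[OF a(1)]) simp
  qed
  then have ab: "a \<cdot> b = cscale C l b"
    using m(2) by simp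
  have ba: "b \<cdot> a = cscale C l b"
    using ab poly_mor_commute[OF a(1), of q] by (simp add: b_def)
  have ab': "a \<cdot> b\<^sup>\<dagger> = cscale C (cnj l) (b\<^sup>\<dagger>)" and ba': "b\<^sup>\<dagger> \<cdot> a = cscale C (cnj l) (b\<^sup>\<dagger>)"
    using adj_comp[OF a(1) b(1)] adj_comp[OF b(1) a(1)] ab ba a(2) adj_cscale[OF b(1)] by simp_all
  \<comment> \<open>compute \<open>b\<^sup>\<dagger> a b\<close> in two ways: the eigenvalue is real\<close>
  have "cscale C (cnj l) (b\<^sup>\<dagger> \<cdot> b) = cscale C l (b\<^sup>\<dagger> \<cdot> b)"
    using comp_assoc[OF b(1) a(1) b(2)] ab ba' comp_cscale_left[OF b(1) b(2)]
      comp_cscale_right[OF b(1) b(2)] by simp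
  then have l: "cnj l = l"
    using bnz adj_comp_eq_0_iff[OF b(1)] by (simp add: vs.scale_cancel_right)
  define k where "k = poly q l"
  have bb': "b \<cdot> b\<^sup>\<dagger> = cscale C k (b\<^sup>\<dagger>)"
    using poly_mor_eigen[OF a(1) b(2), of l q] ab' l by (simp add: b_def k_def)
  have bb: "b \<cdot> b = cscale C k b"
    using poly_mor_eigen[OF a(1) b(1) ab, of q] by (simp add: b_def k_def)
  have "b \<cdot> b\<^sup>\<dagger> \<noteq> 0"
    using adj_comp_eq_0_iff[OF b(2)] adj_adj[OF b(1)] bnz adj_zero by auto
  then have knz: "k \<noteq> 0"
    using bb' by auto
  have "b \<cdot> b\<^sup>\<dagger> = cscale C (cnj k) b"
    using adj_comp[OF b(2) b(1)] bb' adj_cscale[OF b(2)] adj_adj[OF b(1)] by simp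
  then have "cscale C k (b\<^sup>\<dagger>) = cscale C (cnj k) b"
    using bb' by simp
  \<comment> \<open>\<open>b\<close> is idempotent and self-adjoint after division by \<open>k\<close>\<close>
  then have b': "cscale C (inverse (cnj k)) (b\<^sup>\<dagger>) = cscale C (inverse k) b"
    using knz by (metis (no_types, opaque_lifting) complex_cnj_zero_iff mult.commute
        right_inverse vs.scale_one vs.scale_scale)
  define p where "p = cscale C (inverse k) b"
  have "projection x p"
    using knz b bb b' unfolding projection_def p_def
    by (simp add: scale_in adj_cscale[OF b(1)] comp_cscale_left[OF scale_in[OF b(1)] b(1)]
        comp_cscale_right[OF b(1) b(1)])
  moreover have "p \<noteq> 0"
    using bnz knz by (simp add: p_def)
  ultimately have "p = idm C x"
    by (rule min)
  moreover have "b = cscale C k p"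
    using knz by (simp add: p_def)
  ultimately have bk: "b = cscale C k (idm C x)"
    by simp
  have "cscale C k a = cscale C (l * k) (idm C x)"
    using ab unfolding bk by (simp add: comp_cscale_right[OF idm_in a(1)] comp_idm[OF a(1)])
  then have "a = cscale C l (idm C x)"
    using knz by (metis mult.commute vs.scale_left_imp_eq vs.scale_scale)
  then show ?thesis
    by blast
qed

lemma simple_if_no_projections:
  assumes nz: "idm C x \<noteq> 0"
    and ann: "\<And>a. a \<in> Hom C x x \<Longrightarrow> \<exists>p. p \<noteq> 0 \<and> poly_mor x a p = 0"
    and min: "\<And>p. projection x p \<Longrightarrow> p \<noteq> 0 \<Longrightarrow> p = idm C x"
  shows "simple_obj C x"
proof -
  have "\<exists>c. f = cscale C c (idm C x)" if f: "f \<in> Hom C x x" for f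
  proof -
    have f': "f\<^sup>\<dagger> \<in> Hom C x x" "(f\<^sup>\<dagger>)\<^sup>\<dagger> = f"
      using f by (auto intro: adj_in adj_adj)
    define g where "g = f + f\<^sup>\<dagger>"
    define h where "h = cscale C \<i> (f - f\<^sup>\<dagger>)"
    have g: "g \<in> Hom C x x" "g\<^sup>\<dagger> = g"
      using f f' by (auto simp: g_def adj_add[OF f f'(1)] add.commute intro: add_in)
    have "h\<^sup>\<dagger> = cscale C (cnj \<i>) (f\<^sup>\<dagger> - f)"
      unfolding h_def adj_cscale[OF diff_in[OF f f'(1)]] adj_diff[OF f f'(1)] f'(2) ..
    then have h: "h \<in> Hom C x x" "h\<^sup>\<dagger> = h"
      using f f' by (auto simp: h_def vs.scale_right_diff_distrib intro: scale_in diff_in)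
    obtain c where c: "g = cscale C c (idm C x)"
      using selfadjoint_scalar[OF g nz ann[OF g(1)] min] by blast
    obtain d where d: "h = cscale C d (idm C x)"
      using selfadjoint_scalar[OF h nz ann[OF h(1)] min] by blast
    have "f = cscale C (1/2) (f + f)"
      by (simp add: vs.scale_right_distrib flip: vs.scale_left_distrib)
    also have "f + f = g - cscale C \<i> h"
      by (simp add: g_def h_def)
    also have "cscale C (1/2) (g - cscale C \<i> h) = cscale C (1/2 * (c - \<i> * d)) (idm C x)"
      by (simp add: c d vs.scale_right_diff_distrib vs.scale_left_diff_distrib diff_divide_distrib)
    finally show ?thesis
      by blast
  qed
  then show ?thesis
    using nz by (auto simp: simple_obj_def intro: scale_in idm_in)
qed

end

section \<open>Semisimplicity\<close>

locale rigid_cstar_category = cstar_tensor_category +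
  fixes Irr :: "'a set" and cj :: "'a \<Rightarrow> 'a" and R Rb :: "'a \<Rightarrow> 'b"
  assumes simple_unit: "simple_obj C \<one>"
    and Irr: "irr_representatives C Irr"
    and solutions: "standard_solutions C cj R Rb"
begin

lemma conj_sol: "conj_solution C x (cj x) (R x) (Rb x)"
  using solutions by (simp add: standard_solutions_def)

lemma R_in: "R x \<in> Hom C \<one> (cj x \<odot> x)" and Rb_in: "Rb x \<in> Hom C \<one> (x \<odot> cj x)"
  using conj_sol[of x] by (auto simp: conj_solution_def)

text \<open>
  Frobenius reciprocity embeds the endomorphisms of \<open>x\<close> into \<open>Hom \<one> (cj x \<odot> x)\<close>, which has a finite
  orthonormal basis; hence the powers of \<open>a\<close> are linearly dependent.
\<close>

lemma ex_annihilating_poly: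
  assumes a: "a \<in> Hom C x x"
  shows "\<exists>p. p \<noteq> 0 \<and> poly_mor x a p = 0"
proof -
  obtain E where E: "orthonormal_basis C \<one> (cj x \<odot> x) E"
    using ex_orthonormal_basis[OF conj_sol simple_unit simple_unit] by blast
  then have fin: "finite E" and span: "vs.span E = Hom C \<one> (cj x \<odot> x)"
    by (auto simp: orthonormal_basis_def)
  define T where "T f = (idm C (cj x) \<otimes> f) \<cdot> R x" for f
  have T_in: "T f \<in> vs.span E" if "f \<in> Hom C x x" for f
    unfolding span T_def using that R_in by (auto intro: tensor_intros)
  have T_add: "T (f + g) = T f + T g" if "f \<in> Hom C x x" "g \<in> Hom C x x" for f g
    using that R_in[of x] unfolding T_def
    by (simp add: mtens_add_right[of _ "cj x" "cj x" _ x x] idm_in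
        comp_add_left[of _ \<one> "cj x \<odot> x" _ "cj x \<odot> x"] mtens_in)
  have T_scale: "T (cscale C c f) = cscale C c (T f)" if "f \<in> Hom C x x" for f c
    using that R_in[of x] unfolding T_def
    by (simp add: mtens_cscale_right[of _ "cj x" "cj x" _ x x] idm_in
        comp_cscale_left[of _ \<one> "cj x \<odot> x" _ "cj x \<odot> x"] mtens_in)
  have T_0: "f = 0" if "f \<in> Hom C x x" "T f = 0" for f
    using transpose_inverse[OF conj_sol that(1)] that(2)
    by (simp add: T_def[symmetric] mtens_zero_right[OF idm_in]
        comp_zero_right[OF mtens_in[OF adj_in[OF Rb_in] idm_in]])
  define v where "v i = T (poly_mor x a (monom 1 i))" for i
  obtain c where c: "\<exists>i\<le>card E. c i \<noteq> 0" "(\<Sum>i\<le>card E. cscale C (c i) (v i)) = 0"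
    using vs.nontrivial_relation[OF fin, of "card E" v] T_in poly_mor_in[OF a] by (auto simp: v_def)
  define p where "p = (\<Sum>i\<le>card E. monom (c i) i)"
  have "coeff p i = c i" if "i \<le> card E" for i
    using that by (simp add: p_def coeff_sum)
  then have "p \<noteq> 0"
    using c(1) by auto
  moreover have "T (poly_mor x a p) = 0"
  proof -
    have pm: "poly_mor x a (monom (c i) i) = cscale C (c i) (poly_mor x a (monom 1 i))" for i
      using poly_mor_smult[OF a, of "c i" "monom 1 i"] by (simp add: smult_monom)
    have "T (sum f I) = (\<Sum>i\<in>I. T (f i))" if "\<And>i. f i \<in> Hom C x x" for f and I :: "nat set"
      using that
    proof (induction I rule: infinite_finite_induct)
      case (insert i I)
      then show ?case
        by (simp add: T_add sum_in)
    qed (simp_all add: T_def mtens_zero_right[OF idm_in] comp_zero_left[OF R_in])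
    then show ?thesis
      using c(2) poly_mor_in[OF a]
      by (simp add: p_def poly_mor_sum[OF a] pm v_def T_scale scale_in)
  qed
  ultimately show ?thesis
    using T_0[OF poly_mor_in[OF a]] by blast
qed

text \<open>
  The image of any member of a largest orthogonal family of projections is simple: a proper projection
  \<open>q\<close> of the image would split that member further.
\<close>

lemma ex_simple_subobject:
  assumes nz: "idm C y \<noteq> 0"
  shows "\<exists>w\<in>Irr. \<exists>u\<in>Hom C w y. u \<noteq> 0"
proof -
  obtain N where N: "\<And>P. orth_projections y P \<Longrightarrow> card P \<le> N"
    using orth_projections_bounded[OF conj_sol simple_unit] by blast
  have id: "orth_projections y {idm C y}"
    using nz by (simp add: orth_projections_def projection_def idm_in adj_idm comp_idm[OF idm_in])
  obtain P where P: "orth_projections y P" "\<And>P'. orth_projections y P' \<Longrightarrow> card P' \<le> card P"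
    using ex_has_greatest_nat[of "orth_projections y" "{idm C y}" card "Suc N"] N id
    by (auto simp: less_Suc_eq_le)
  have "P \<noteq> {}"
    using P(2)[OF id] by auto
  then obtain p where p: "p \<in> P"
    by blast
  then have pp: "projection y p" "p \<noteq> 0" "p \<in> Hom C y y"
    using P by (auto simp: orth_projections_def projection_def)
  obtain x v where v: "v \<in> Hom C x y" "v\<^sup>\<dagger> \<cdot> v = idm C x" "v \<cdot> v\<^sup>\<dagger> = p"
    using subobjects[OF pp(3)] pp(1) by (auto simp: projection_def)
  have v': "v\<^sup>\<dagger> \<in> Hom C y x"
    using v(1) by (rule adj_in)
  have vnz: "v \<noteq> 0"
    using v(3) pp(2) comp_zero_left[OF v'] by auto
  have idx: "idm C x \<noteq> 0"
    using v(2) vnz adj_comp_eq_0_iff[OF v(1)] by auto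
  have "simple_obj C x"
  proof (rule simple_if_no_projections[OF idx ex_annihilating_poly])
    fix q assume q: "projection x q" "q \<noteq> 0"
    then have q': "q \<in> Hom C x x" "q\<^sup>\<dagger> = q" "q \<cdot> q = q"
      by (auto simp: projection_def)
    show "q = idm C x"
    proof (rule ccontr)
      assume ne: "q \<noteq> idm C x"
      \<comment> \<open>transport \<open>q\<close> to a projection of \<open>y\<close> strictly below \<open>p\<close>\<close>
      define s where "s = v \<cdot> q \<cdot> v\<^sup>\<dagger>"
      have qv: "q \<cdot> v\<^sup>\<dagger> \<in> Hom C y x"
        using q'(1) v' by (blast intro: comp_in)
      have s: "s \<in> Hom C y y"
        unfolding s_def using qv v(1) by (blast intro: comp_in)
      have sv: "v\<^sup>\<dagger> \<cdot> s = q \<cdot> v\<^sup>\<dagger>"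
        unfolding s_def using comp_assoc[OF qv v(1) v'] v(2) idm_comp[OF qv] by simp
      have pv: "p \<cdot> v = v" "v\<^sup>\<dagger> \<cdot> p = v\<^sup>\<dagger>"
        using comp_assoc[OF v(1) v' v(1)] comp_assoc[OF v' v(1) v'] v(2,3) comp_idm[OF v(1)] idm_comp[OF v']
        by simp_all
      have ps: "p \<cdot> s = s"
        unfolding s_def using comp_assoc[OF qv v(1) pp(3)] pv by simp
      have sp: "s \<cdot> p = s"
        unfolding s_def
        using comp_assoc[OF pp(3) qv v(1)] comp_assoc[OF pp(3) v' q'(1)] pv by simp
      have sstar: "s\<^sup>\<dagger> = s"
        unfolding s_def
        using adj_comp[OF qv v(1)] adj_comp[OF v' q'(1)] q'(2) adj_adj[OF v(1)] comp_assoc[OF v' q'(1) v(1)]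
        by simp
      have ss: "s \<cdot> s = s"
      proof -
        have "s \<cdot> s = v \<cdot> (q \<cdot> v\<^sup>\<dagger>) \<cdot> s"
          using comp_assoc[OF s qv v(1)] by (simp add: s_def)
        also have "(q \<cdot> v\<^sup>\<dagger>) \<cdot> s = q \<cdot> q \<cdot> v\<^sup>\<dagger>"
          using comp_assoc[OF s v' q'(1)] sv by simp
        also have "\<dots> = q \<cdot> v\<^sup>\<dagger>"
          using comp_assoc[OF v' q'(1) q'(1)] q'(3) by simp
        finally show ?thesis
          by (simp add: s_def)
      qed
      have qs: "q = v\<^sup>\<dagger> \<cdot> s \<cdot> v"
      proof -
        have "v\<^sup>\<dagger> \<cdot> s \<cdot> v = (v\<^sup>\<dagger> \<cdot> s) \<cdot> v"
          using comp_assoc[OF v(1) s v'] by simp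
        also have "\<dots> = q"
          using comp_assoc[OF v(1) v' q'(1)] v(2) comp_idm[OF q'(1)] by (simp add: sv)
        finally show ?thesis ..
      qed
      have "s \<noteq> 0"
        using qs q(2) comp_zero_left[OF v(1)] comp_zero_right[OF v'] by auto
      moreover have "s \<noteq> p"
        using qs ne pv v(2) by auto
      ultimately obtain P' where "orth_projections y P'" "card P' = card P + 1"
        using orth_projections_split[OF P(1) p] s sstar ss ps sp by (auto simp: projection_def)
      then show False
        using P(2)[of P'] by simp
    qed
  qed
  then obtain w where w: "w \<in> Irr" "iso_obj C x w"
    using Irr by (auto simp: irr_representatives_def)
  then obtain f g where fg: "f \<in> Hom C x w" "g \<in> Hom C w x" "g \<cdot> f = idm C x"
    by (auto simp: iso_obj_def)
  have vg: "v \<cdot> g \<in> Hom C w y"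
    using v(1) fg(2) by (blast intro: comp_in)
  moreover have "v \<cdot> g \<noteq> 0"
  proof
    assume "v \<cdot> g = 0"
    then have "(v \<cdot> g) \<cdot> f = 0"
      by (simp add: comp_zero_left[OF fg(1)])
    then show False
      using comp_assoc[OF fg(1,2) v(1)] fg(3) comp_idm[OF v(1)] vnz by simp
  qed
  ultimately show ?thesis
    using w(1) by blast
qed

lemma Irr_simple: "w \<in> Irr \<Longrightarrow> simple_obj C w"
  using Irr by (auto simp: irr_representatives_def)

lemma unit_Irr: "\<one> \<in> Irr"
  using Irr by (simp add: irr_representatives_def)

lemma Schur_zero:
  assumes "w \<in> Irr" "w' \<in> Irr" "w \<noteq> w'" "f \<in> Hom C w w'"
  shows "f = 0"
proof (rule ccontr)
  assume "f \<noteq> 0"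
  then have "iso_obj C w w'"
    using assms Schur_iso Irr_simple by blast
  moreover have "iso_obj C w w"
    unfolding iso_obj_def using idm_in comp_idm by blast
  ultimately show False
    using Irr assms Irr_simple[OF assms(1)] unfolding irr_representatives_def by metis
qed

text \<open>
  The same choice of basis as in the components of \<open>tube_Psi\<close>.
\<close>

definition onb :: "'a \<Rightarrow> 'a \<Rightarrow> 'b set" where
  "onb w z = (SOME B. orthonormal_basis C w z B)"

lemma onb:
  assumes "w \<in> Irr"
  shows "finite (onb w z)" "\<And>s. s \<in> onb w z \<Longrightarrow> s \<in> Hom C w z"
    "\<And>s t. s \<in> onb w z \<Longrightarrow> t \<in> onb w z \<Longrightarrow> t\<^sup>\<dagger> \<cdot> s = (if s = t then idm C w else 0)"
    "vs.span (onb w z) = Hom C w z"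
proof -
  have "orthonormal_basis C w z (onb w z)"
    unfolding onb_def
    using ex_orthonormal_basis[OF conj_sol simple_unit Irr_simple[OF assms]] by (rule someI_ex)
  then show "finite (onb w z)" "\<And>s. s \<in> onb w z \<Longrightarrow> s \<in> Hom C w z"
    "\<And>s t. s \<in> onb w z \<Longrightarrow> t \<in> onb w z \<Longrightarrow> t\<^sup>\<dagger> \<cdot> s = (if s = t then idm C w else 0)"
    "vs.span (onb w z) = Hom C w z"
    by (auto simp: orthonormal_basis_def)
qed

lemma onb_expand:
  assumes w: "w \<in> Irr" and f: "f \<in> Hom C w z"
  shows "(\<Sum>\<beta>\<in>onb w z. \<beta> \<cdot> \<beta>\<^sup>\<dagger> \<cdot> f) = f"
proof -
  note o = onb[OF w, where z = z]
  obtain c where c: "f = (\<Sum>\<beta>\<in>onb w z. cscale C (c \<beta>) \<beta>)"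
    using f unfolding o(4)[symmetric] vs.span_finite[OF o(1)] by auto
  have "\<beta> \<cdot> \<beta>\<^sup>\<dagger> \<cdot> f = cscale C (c \<beta>) \<beta>" if b: "\<beta> \<in> onb w z" for \<beta>
  proof -
    have b': "\<beta>\<^sup>\<dagger> \<in> Hom C z w"
      using o(2)[OF b] by (rule adj_in)
    have "\<beta>\<^sup>\<dagger> \<cdot> f = (\<Sum>\<beta>'\<in>onb w z. \<beta>\<^sup>\<dagger> \<cdot> cscale C (c \<beta>') \<beta>')"
      unfolding c by (rule comp_sum_right[OF b', where x = w]) (intro scale_in o)
    also have "\<dots> = (\<Sum>\<beta>'\<in>onb w z. if \<beta>' = \<beta> then cscale C (c \<beta>) (idm C w) else 0)"
      using b o by (intro sum.cong) (auto simp: comp_cscale_right[OF _ b', of _ w])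
    also have "\<dots> = cscale C (c \<beta>) (idm C w)"
      using b o(1) by simp
    finally show ?thesis
      by (simp add: comp_cscale_right[OF idm_in o(2)[OF b]] comp_idm[OF o(2)[OF b]])
  qed
  then show ?thesis
    using c by simp
qed

text \<open>
  Isometries from inequivalent simple objects have orthogonal ranges by Schur's lemma.
\<close>

lemma finite_constituents: "finite {w\<in>Irr. \<exists>f\<in>Hom C w z. f \<noteq> 0}"
proof (rule ccontr)
  assume inf: "infinite {w\<in>Irr. \<exists>f\<in>Hom C w z. f \<noteq> 0}"
  obtain N where N: "\<And>P. orth_projections z P \<Longrightarrow> card P \<le> N"
    using orth_projections_bounded[OF conj_sol simple_unit] by blast
  obtain I where I: "finite I" "card I = Suc N" "I \<subseteq> {w\<in>Irr. \<exists>f\<in>Hom C w z. f \<noteq> 0}"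
    using infinite_arbitrarily_large[OF inf] by blast
  have "\<exists>u\<in>Hom C w z. u\<^sup>\<dagger> \<cdot> u = idm C w" if w: "w \<in> I" for w
  proof -
    obtain f where f: "f \<in> Hom C w z" "f \<noteq> 0"
      using I w by blast
    then have "f \<in> Hom C w z" "(\<Sum>\<beta>\<in>onb w z. \<beta> \<cdot> \<beta>\<^sup>\<dagger> \<cdot> f) \<noteq> 0"
      using onb_expand I w by auto
    then obtain \<beta> where "\<beta> \<in> onb w z"
      by (metis sum.empty all_not_in_conv)
    then show ?thesis
      using onb(2,3)[of w] I w by force
  qed
  then obtain u where u: "\<And>w. w \<in> I \<Longrightarrow> u w \<in> Hom C w z \<and> (u w)\<^sup>\<dagger> \<cdot> u w = idm C w"
    by metis
  have "(u i)\<^sup>\<dagger> \<cdot> u j = 0" if "i \<in> I" "j \<in> I" "i \<noteq> j" for i j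
    using that u I(3) Schur_zero[of j i] by (blast intro: comp_in adj_in)
  then have "card I \<le> N"
    using isometries_orth_projections[of I "\<lambda>w. w" u z] N u I Irr_simple
    by (fastforce simp: simple_obj_def)
  then show False
    using I by simp
qed

text \<open>
  The right-hand side \<open>e\<close> is a projection fixing every morphism from a simple object.  A simple
  subobject of its complement would be both fixed and annihilated by \<open>e\<close>.
\<close>

lemma resolution_of_identity:
  "idm C z = (\<Sum>w\<in>{w\<in>Irr. \<exists>f\<in>Hom C w z. f \<noteq> 0}. \<Sum>\<beta>\<in>onb w z. \<beta> \<cdot> \<beta>\<^sup>\<dagger>)"
proof -
  define W where "W = {w\<in>Irr. \<exists>f\<in>Hom C w z. f \<noteq> 0}"
  define e where "e = (\<Sum>w\<in>W. \<Sum>\<beta>\<in>onb w z. \<beta> \<cdot> \<beta>\<^sup>\<dagger>)"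
  have W: "finite W" "W \<subseteq> Irr"
    using finite_constituents by (auto simp: W_def)
  have bb: "\<beta> \<cdot> \<beta>\<^sup>\<dagger> \<in> Hom C z z" "\<beta>\<^sup>\<dagger> \<in> Hom C z w" if "\<beta> \<in> onb w z" "w \<in> Irr" for \<beta> w
    using onb(2)[OF that(2,1)] by (blast intro: comp_in adj_in)+
  have e: "e \<in> Hom C z z"
    unfolding e_def using W bb by (blast intro: sum_in)
  have eu: "e \<cdot> u = u" if w: "w \<in> Irr" and u: "u \<in> Hom C w z" for w u
  proof (cases "w \<in> W")
    case True
    have "e \<cdot> u = (\<Sum>w'\<in>W. \<Sum>\<beta>\<in>onb w' z. \<beta> \<cdot> \<beta>\<^sup>\<dagger> \<cdot> u)"
    proof -
      have "e \<cdot> u = (\<Sum>w'\<in>W. (\<Sum>\<beta>\<in>onb w' z. \<beta> \<cdot> \<beta>\<^sup>\<dagger>) \<cdot> u)"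
        unfolding e_def using W bb by (intro comp_sum_left[OF u, where z = z] sum_in) blast
      also have "\<dots> = (\<Sum>w'\<in>W. \<Sum>\<beta>\<in>onb w' z. (\<beta> \<cdot> \<beta>\<^sup>\<dagger>) \<cdot> u)"
        using W bb by (intro sum.cong refl comp_sum_left[OF u, where z = z]) blast
      also have "\<dots> = (\<Sum>w'\<in>W. \<Sum>\<beta>\<in>onb w' z. \<beta> \<cdot> \<beta>\<^sup>\<dagger> \<cdot> u)"
        using W bb onb(2) by (intro sum.cong refl comp_assoc[OF u]) blast+
      finally show ?thesis .
    qed
    also have "\<dots> = (\<Sum>w'\<in>W. if w' = w then u else 0)"
    proof (rule sum.cong)
      fix w' assume w': "w' \<in> W"
      show "(\<Sum>\<beta>\<in>onb w' z. \<beta> \<cdot> \<beta>\<^sup>\<dagger> \<cdot> u) = (if w' = w then u else 0)"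
      proof (cases "w' = w")
        case True
        then show ?thesis
          using onb_expand[OF w u] by simp
      next
        case False
        have "\<beta> \<cdot> \<beta>\<^sup>\<dagger> \<cdot> u = 0" if b: "\<beta> \<in> onb w' z" for \<beta>
        proof -
          have "\<beta>\<^sup>\<dagger> \<cdot> u = 0"
            using Schur_zero[OF w, of w'] False w' W b bb(2)[OF b] u by (blast intro: comp_in)
          then show ?thesis
            using comp_zero_right onb(2)[OF _ b] w' W by auto
        qed
        then show ?thesis
          using False by simp
      qed
    qed simp
    also have "\<dots> = u"
      using True W(1) by simp
    finally show ?thesis .
  next
    case False
    then have "u = 0"
      using w u by (auto simp: W_def)
    then show ?thesis
      by (simp add: comp_zero_right[OF e])
  qed
  have estar: "e\<^sup>\<dagger> = e"
  proof -
    have "e\<^sup>\<dagger> = (\<Sum>w\<in>W. (\<Sum>\<beta>\<in>onb w z. \<beta> \<cdot> \<beta>\<^sup>\<dagger>)\<^sup>\<dagger>)"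
      unfolding e_def using W bb by (intro adj_sum[where x = z and y = z] sum_in) blast
    also have "\<dots> = (\<Sum>w\<in>W. \<Sum>\<beta>\<in>onb w z. (\<beta> \<cdot> \<beta>\<^sup>\<dagger>)\<^sup>\<dagger>)"
      using W bb by (intro sum.cong refl adj_sum[where x = z and y = z]) blast
    also have "\<dots> = e"
      unfolding e_def
    proof (intro sum.cong refl)
      fix w \<beta> assume "w \<in> W" "\<beta> \<in> onb w z"
      then have "w \<in> Irr" "\<beta> \<in> Hom C w z"
        using W onb(2) by auto
      then show "(\<beta> \<cdot> \<beta>\<^sup>\<dagger>)\<^sup>\<dagger> = \<beta> \<cdot> \<beta>\<^sup>\<dagger>"
        using adj_comp[OF adj_in] adj_adj by metis
    qed
    finally show ?thesis .
  qed
  have ee: "e \<cdot> e = e"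
  proof -
    have "e \<cdot> e = (\<Sum>w\<in>W. e \<cdot> (\<Sum>\<beta>\<in>onb w z. \<beta> \<cdot> \<beta>\<^sup>\<dagger>))"
      unfolding e_def using W bb
      by (intro comp_sum_right[where x = z and z = z and y = z] sum_in e[unfolded e_def]) blast+
    also have "\<dots> = (\<Sum>w\<in>W. \<Sum>\<beta>\<in>onb w z. e \<cdot> \<beta> \<cdot> \<beta>\<^sup>\<dagger>)"
      using W bb by (intro sum.cong refl comp_sum_right[OF e, where x = z]) blast
    also have "\<dots> = e"
      unfolding e_def[symmetric]
    proof -
      have "e \<cdot> \<beta> \<cdot> \<beta>\<^sup>\<dagger> = \<beta> \<cdot> \<beta>\<^sup>\<dagger>" if "w \<in> W" "\<beta> \<in> onb w z" for w \<beta>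
      proof -
        have "w \<in> Irr" "\<beta> \<in> Hom C w z"
          using that W onb(2) by auto
        then show ?thesis
          using comp_assoc[OF adj_in _ e] eu by metis
      qed
      then have "(\<Sum>w\<in>W. \<Sum>\<beta>\<in>onb w z. e \<cdot> \<beta> \<cdot> \<beta>\<^sup>\<dagger>) = (\<Sum>w\<in>W. \<Sum>\<beta>\<in>onb w z. \<beta> \<cdot> \<beta>\<^sup>\<dagger>)"
        by (intro sum.cong refl)
      then show "(\<Sum>w\<in>W. \<Sum>\<beta>\<in>onb w z. e \<cdot> \<beta> \<cdot> \<beta>\<^sup>\<dagger>) = e"
        by (simp add: e_def)
    qed
    finally show ?thesis .
  qed
  define q where "q = idm C z - e"
  have q: "projection z q"
    unfolding q_def using e estar ee by (intro projection_compl) (simp add: projection_def)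
  have "q = 0"
  proof (rule ccontr)
    assume qnz: "q \<noteq> 0"
    have qin: "q \<in> Hom C z z" "q\<^sup>\<dagger> = q" "q \<cdot> q = q"
      using q by (auto simp: projection_def)
    obtain y v where v: "v \<in> Hom C y z" "v\<^sup>\<dagger> \<cdot> v = idm C y" "v \<cdot> v\<^sup>\<dagger> = q"
      using subobjects[OF qin] by blast
    have v': "v\<^sup>\<dagger> \<in> Hom C z y"
      using v(1) by (rule adj_in)
    have "v \<noteq> 0"
      using v(3) qnz comp_zero_left[OF v'] by auto
    then have "idm C y \<noteq> 0"
      using v(2) adj_comp_eq_0_iff[OF v(1)] by auto
    then obtain w u where w: "w \<in> Irr" and u: "u \<in> Hom C w y" "u \<noteq> 0"
      using ex_simple_subobject by blast
    have vu: "v \<cdot> u \<in> Hom C w z"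
      using v(1) u(1) by (blast intro: comp_in)
    have "q \<cdot> v = v"
      using comp_assoc[OF v(1) v' v(1)] v(2,3) comp_idm[OF v(1)] by simp
    then have "q \<cdot> (v \<cdot> u) = v \<cdot> u"
      using comp_assoc[OF u(1) v(1) qin(1)] by simp
    moreover have "q \<cdot> (v \<cdot> u) = 0"
      unfolding q_def using comp_diff_left[OF vu idm_in e] idm_comp[OF vu] eu[OF w vu] by simp
    ultimately have "v \<cdot> u = 0"
      by simp
    then have "v\<^sup>\<dagger> \<cdot> (v \<cdot> u) = 0"
      using comp_zero_right[OF v'] by simp
    then show False
      using comp_assoc[OF u(1) v(1) v'] v(2) idm_comp[OF u(1)] u(2) by simp
  qed
  then show ?thesis
    by (simp add: q_def e_def W_def)
qed

section \<open>The tube algebra\<close>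

abbreviation Psi :: "'a \<Rightarrow> 'a \<Rightarrow> 'a \<Rightarrow> 'b \<Rightarrow> 'a \<Rightarrow> 'b" where
  "Psi \<equiv> tube_Psi C Irr"

lemma Psi_onb:
  "Psi x y z \<gamma> w = (if w \<in> Irr
    then \<Sum>\<alpha>\<in>onb w z. (idm C y \<otimes> \<alpha>\<^sup>\<dagger>) \<cdot> \<gamma> \<cdot> (\<alpha> \<otimes> idm C x) else 0)"
  by (simp add: tube_Psi_def onb_def)

lemma Psi_term_in:
  assumes "\<gamma> \<in> Hom C (z \<odot> x) (y \<odot> z)" "w \<in> Irr" "\<alpha> \<in> onb w z"
  shows "\<gamma> \<cdot> (\<alpha> \<otimes> idm C x) \<in> Hom C (w \<odot> x) (y \<odot> z)"
    "idm C y \<otimes> \<alpha>\<^sup>\<dagger> \<in> Hom C (y \<odot> z) (y \<odot> w)"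
    "(idm C y \<otimes> \<alpha>\<^sup>\<dagger>) \<cdot> \<gamma> \<cdot> (\<alpha> \<otimes> idm C x) \<in> Hom C (w \<odot> x) (y \<odot> w)"
proof -
  note a = onb(2)[OF assms(2,3)]
  show 1: "\<gamma> \<cdot> (\<alpha> \<otimes> idm C x) \<in> Hom C (w \<odot> x) (y \<odot> z)"
    using comp_in[OF mtens_in[OF a idm_in] assms(1)] .
  show 2: "idm C y \<otimes> \<alpha>\<^sup>\<dagger> \<in> Hom C (y \<odot> z) (y \<odot> w)"
    using mtens_in[OF idm_in adj_in[OF a]] .
  show "(idm C y \<otimes> \<alpha>\<^sup>\<dagger>) \<cdot> \<gamma> \<cdot> (\<alpha> \<otimes> idm C x) \<in> Hom C (w \<odot> x) (y \<odot> w)"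
    using comp_in[OF 1 2] .
qed

lemma Psi_add:
  assumes "\<gamma> \<in> Hom C (z \<odot> x) (y \<odot> z)" "\<gamma>' \<in> Hom C (z \<odot> x) (y \<odot> z)"
  shows "Psi x y z (\<gamma> + \<gamma>') w = Psi x y z \<gamma> w + Psi x y z \<gamma>' w"
proof (cases "w \<in> Irr")
  case True
  have "(idm C y \<otimes> \<alpha>\<^sup>\<dagger>) \<cdot> (\<gamma> + \<gamma>') \<cdot> (\<alpha> \<otimes> idm C x)
      = (idm C y \<otimes> \<alpha>\<^sup>\<dagger>) \<cdot> \<gamma> \<cdot> (\<alpha> \<otimes> idm C x) + (idm C y \<otimes> \<alpha>\<^sup>\<dagger>) \<cdot> \<gamma>' \<cdot> (\<alpha> \<otimes> idm C x)"
    if a: "\<alpha> \<in> onb w z" for \<alpha>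
    using Psi_term_in[OF assms(1) True a] Psi_term_in[OF assms(2) True a]
      comp_add_left[OF mtens_in[OF onb(2)[OF True a] idm_in] assms] comp_add_right by simp
  then show ?thesis
    using True by (simp add: Psi_onb sum.distrib)
qed (simp add: Psi_onb)

lemma Psi_scale:
  assumes "\<gamma> \<in> Hom C (z \<odot> x) (y \<odot> z)"
  shows "Psi x y z (cscale C c \<gamma>) w = cscale C c (Psi x y z \<gamma> w)"
proof (cases "w \<in> Irr")
  case True
  have "(idm C y \<otimes> \<alpha>\<^sup>\<dagger>) \<cdot> (cscale C c \<gamma>) \<cdot> (\<alpha> \<otimes> idm C x)
      = cscale C c ((idm C y \<otimes> \<alpha>\<^sup>\<dagger>) \<cdot> \<gamma> \<cdot> (\<alpha> \<otimes> idm C x))"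
    if a: "\<alpha> \<in> onb w z" for \<alpha>
    using Psi_term_in[OF assms(1) True a]
      comp_cscale_left[OF mtens_in[OF onb(2)[OF True a] idm_in] assms] comp_cscale_right by simp
  then show ?thesis
    using True by (simp add: Psi_onb vs.scale_sum_right)
qed (simp add: Psi_onb)

text \<open>
  Trace-like property of a tube: expanding \<open>f \<beta>\<close> in the basis of \<open>Hom w z'\<close> and \<open>\<beta>'\<^sup>\<dagger> f\<close> in the adjoint
  basis of \<open>Hom w z\<close> gives the same matrix coefficients of \<open>f\<close>, hence the same double sum.
\<close>

lemma Psi_naturality:
  assumes \<gamma>: "\<gamma> \<in> Hom C (z' \<odot> x) (y \<odot> z)" and f: "f \<in> Hom C z z'"
  shows "Psi x y z (\<gamma> \<cdot> (f \<otimes> idm C x)) = Psi x y z' ((idm C y \<otimes> f) \<cdot> \<gamma>)"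
proof (rule ext)
  fix w
  show "Psi x y z (\<gamma> \<cdot> (f \<otimes> idm C x)) w = Psi x y z' ((idm C y \<otimes> f) \<cdot> \<gamma>) w"
  proof (cases "w \<in> Irr")
    case w: True
    note B = onb(2)[OF w, of _ z] onb(1)[OF w, of z]
    note B' = onb(2)[OF w, of _ z'] onb(1)[OF w, of z']
    have f': "f\<^sup>\<dagger> \<in> Hom C z' z" "(f\<^sup>\<dagger>)\<^sup>\<dagger> = f"
      using f by (auto intro: adj_in adj_adj)
    have "\<exists>c. b'\<^sup>\<dagger> \<cdot> f \<cdot> b = cscale C c (idm C w)" if "b \<in> onb w z" "b' \<in> onb w z'" for b b'
      using simple_scalar[OF Irr_simple[OF w]
          comp_in[OF comp_in[OF B(1)[OF that(1)] f] adj_in[OF B'(1)[OF that(2)]]]] by metis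
    then obtain c where c: "\<And>b b'. b \<in> onb w z \<Longrightarrow> b' \<in> onb w z' \<Longrightarrow>
        b'\<^sup>\<dagger> \<cdot> f \<cdot> b = cscale C (c b b') (idm C w)"
      by metis
    define T where "T b b' = (idm C y \<otimes> b\<^sup>\<dagger>) \<cdot> \<gamma> \<cdot> (b' \<otimes> idm C x)" for b b'
    have 1: "(idm C y \<otimes> b\<^sup>\<dagger>) \<cdot> (\<gamma> \<cdot> (f \<otimes> idm C x)) \<cdot> (b \<otimes> idm C x)
        = (\<Sum>b'\<in>onb w z'. cscale C (c b b') (T b b'))" if b: "b \<in> onb w z" for b
    proof -
      note bin = B(1)[OF b]
      have fb: "f \<cdot> b = (\<Sum>b'\<in>onb w z'. cscale C (c b b') b')"
      proof -
        have "f \<cdot> b = (\<Sum>b'\<in>onb w z'. b' \<cdot> b'\<^sup>\<dagger> \<cdot> f \<cdot> b)"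
          using onb_expand[OF w comp_in[OF bin f]] by simp
        also have "\<dots> = (\<Sum>b'\<in>onb w z'. cscale C (c b b') b')"
          using c[OF b] B'(1)
          by (intro sum.cong refl)
            (simp add: comp_scaled_idm[OF B'(1)])
        finally show ?thesis .
      qed
      have bx: "b' \<otimes> idm C x \<in> Hom C (w \<odot> x) (z' \<odot> x)" if "b' \<in> onb w z'" for b'
        using mtens_in[OF B'(1)[OF that] idm_in] .
      have L: "idm C y \<otimes> b\<^sup>\<dagger> \<in> Hom C (y \<odot> z) (y \<odot> w)"
        using mtens_in[OF idm_in adj_in[OF bin]] .
      have "(\<gamma> \<cdot> (f \<otimes> idm C x)) \<cdot> (b \<otimes> idm C x) = \<gamma> \<cdot> ((f \<cdot> b) \<otimes> idm C x)"
        using comp_assoc[OF mtens_in[OF bin idm_in] mtens_in[OF f idm_in] \<gamma>]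
          comp_mtens_idm[OF bin f] by simp
      also have "(f \<cdot> b) \<otimes> idm C x = (\<Sum>b'\<in>onb w z'. cscale C (c b b') (b' \<otimes> idm C x))"
        unfolding fb using B'(1)
        by (subst mtens_sum_left[OF idm_in, where x = w and y = z'])
          (auto intro!: sum.cong intro: scale_in mtens_cscale_left[OF _ idm_in])
      also have "\<gamma> \<cdot> \<dots> = (\<Sum>b'\<in>onb w z'. cscale C (c b b') (\<gamma> \<cdot> (b' \<otimes> idm C x)))"
        using bx
        by (subst comp_sum_right[OF \<gamma>, where x = "w \<odot> x"])
          (auto intro!: sum.cong intro: scale_in comp_cscale_right[OF _ \<gamma>])
      finally show ?thesis
        using comp_in[OF bx \<gamma>] unfolding T_def
        by (simp, subst comp_sum_right[OF L, where x = "w \<odot> x"])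
          (auto intro!: sum.cong intro: scale_in comp_cscale_right[OF _ L])
    qed
    have 2: "(idm C y \<otimes> b'\<^sup>\<dagger>) \<cdot> ((idm C y \<otimes> f) \<cdot> \<gamma>) \<cdot> (b' \<otimes> idm C x)
        = (\<Sum>b\<in>onb w z. cscale C (c b b') (T b b'))" if b': "b' \<in> onb w z'" for b'
    proof -
      note bin = B'(1)[OF b']
      have bin': "b'\<^sup>\<dagger> \<in> Hom C z' w"
        using adj_in[OF bin] .
      have bf: "b'\<^sup>\<dagger> \<cdot> f = (\<Sum>b\<in>onb w z. cscale C (c b b') (b\<^sup>\<dagger>))"
      proof -
        have cc: "b\<^sup>\<dagger> \<cdot> f\<^sup>\<dagger> \<cdot> b' = cscale C (cnj (c b b')) (idm C w)" if b: "b \<in> onb w z" for b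
        proof -
          have "(b'\<^sup>\<dagger> \<cdot> f \<cdot> b)\<^sup>\<dagger> = (b\<^sup>\<dagger> \<cdot> f\<^sup>\<dagger>) \<cdot> b'"
            using adj_comp[OF comp_in[OF B(1)[OF b] f] bin'] adj_comp[OF B(1)[OF b] f] adj_adj[OF bin]
            by simp
          then show ?thesis
            using c[OF b b'] comp_assoc[OF bin f'(1) adj_in[OF B(1)[OF b]]]
            by (simp add: adj_cscale[OF idm_in] adj_idm)
        qed
        have "f\<^sup>\<dagger> \<cdot> b' = (\<Sum>b\<in>onb w z. b \<cdot> b\<^sup>\<dagger> \<cdot> f\<^sup>\<dagger> \<cdot> b')"
          using onb_expand[OF w comp_in[OF bin f'(1)]] by simp
        also have "\<dots> = (\<Sum>b\<in>onb w z. cscale C (cnj (c b b')) b)"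
          using cc B(1)
          by (intro sum.cong refl)
            (simp add: comp_scaled_idm[OF B(1)])
        finally have "(f\<^sup>\<dagger> \<cdot> b')\<^sup>\<dagger> = (\<Sum>b\<in>onb w z. (cscale C (cnj (c b b')) b)\<^sup>\<dagger>)"
          using adj_sum[of "onb w z" "\<lambda>b. cscale C (cnj (c b b')) b" w z] B(1) by (simp add: scale_in)
        then show ?thesis
          using adj_comp[OF bin f'(1)] f'(2) B(1) by (simp add: adj_cscale[of _ w z])
      qed
      have R: "\<gamma> \<cdot> (b' \<otimes> idm C x) \<in> Hom C (w \<odot> x) (y \<odot> z)"
        using comp_in[OF mtens_in[OF bin idm_in] \<gamma>] .
      have yb: "idm C y \<otimes> b\<^sup>\<dagger> \<in> Hom C (y \<odot> z) (y \<odot> w)" if "b \<in> onb w z" for b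
        using mtens_in[OF idm_in adj_in[OF B(1)[OF that]]] .
      have "(idm C y \<otimes> b'\<^sup>\<dagger>) \<cdot> ((idm C y \<otimes> f) \<cdot> \<gamma>) \<cdot> (b' \<otimes> idm C x)
         = (idm C y \<otimes> (b'\<^sup>\<dagger> \<cdot> f)) \<cdot> \<gamma> \<cdot> (b' \<otimes> idm C x)"
        using comp_assoc[OF mtens_in[OF bin idm_in] \<gamma> mtens_in[OF idm_in f]]
          comp_assoc[OF R mtens_in[OF idm_in f] mtens_in[OF idm_in bin']]
          idm_mtens_comp[OF f bin'] by simp
      also have "idm C y \<otimes> (b'\<^sup>\<dagger> \<cdot> f) = (\<Sum>b\<in>onb w z. cscale C (c b b') (idm C y \<otimes> b\<^sup>\<dagger>))"
        unfolding bf using B(1)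
        by (subst mtens_sum_right[OF idm_in, where x' = z and y' = w])
          (auto intro!: sum.cong intro: scale_in adj_in mtens_cscale_right[OF idm_in])
      also have "\<dots> \<cdot> \<gamma> \<cdot> (b' \<otimes> idm C x) = (\<Sum>b\<in>onb w z. cscale C (c b b') (T b b'))"
        unfolding T_def using yb
        by (subst comp_sum_left[OF R, where z = "y \<odot> w"])
          (auto intro!: sum.cong intro: scale_in comp_cscale_left[OF R])
      finally show ?thesis .
    qed
    have "Psi x y z (\<gamma> \<cdot> (f \<otimes> idm C x)) w = (\<Sum>b\<in>onb w z. \<Sum>b'\<in>onb w z'. cscale C (c b b') (T b b'))"
      using w by (simp add: Psi_onb 1)
    also have "\<dots> = (\<Sum>b'\<in>onb w z'. \<Sum>b\<in>onb w z. cscale C (c b b') (T b b'))"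
      by (rule sum.swap)
    also have "\<dots> = Psi x y z' ((idm C y \<otimes> f) \<cdot> \<gamma>) w"
      using w by (simp add: Psi_onb 2)
    finally show ?thesis .
  qed (simp add: Psi_onb)
qed

lemma onb_empty:
  assumes "w \<in> Irr" "\<not> (\<exists>f\<in>Hom C w z. f \<noteq> 0)"
  shows "onb w z = {}"
proof (rule ccontr)
  assume "onb w z \<noteq> {}"
  then obtain b where b: "b \<in> onb w z"
    by blast
  then have "b = 0"
    using onb(2)[OF assms(1)] assms(2) by blast
  then show False
    using onb(2,3)[OF assms(1)] b comp_zero_right[OF adj_in[OF onb(2)[OF assms(1) b]]]
      Irr_simple[OF assms(1)] by (auto simp: simple_obj_def)
qed

lemma Psi_in_tube_block:
  assumes "\<gamma> \<in> Hom C (z \<odot> x) (y \<odot> z)"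
  shows "Psi x y z \<gamma> \<in> tube_block C Irr x y"
proof -
  have "{w. Psi x y z \<gamma> w \<noteq> 0} \<subseteq> {w\<in>Irr. \<exists>f\<in>Hom C w z. f \<noteq> 0}"
    using onb_empty[of _ z] by (auto simp: Psi_onb split: if_splits) (metis sum.empty)
  then have "finite {w. Psi x y z \<gamma> w \<noteq> 0}"
    using finite_constituents by (rule finite_subset)
  then show ?thesis
    using Psi_term_in[OF assms] by (auto simp: tube_block_def Psi_onb intro: sum_in)
qed

text \<open>
  Insert \<open>1\<^sub>z = \<Sum> \<beta> \<beta>\<^sup>\<dagger>\<close> and move each \<open>\<beta>\<^sup>\<dagger>\<close> around the tube: this expresses \<open>F z \<gamma>\<close> through the components
  of \<open>\<Psi>\<^sup>z(\<gamma>)\<close> alone.  Categorically, the block is a coend.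
\<close>

lemma Psi_universal:
  fixes F :: "'a \<Rightarrow> 'b \<Rightarrow> 'b"
  assumes add: "\<And>z \<gamma> \<gamma>'. \<gamma> \<in> Hom C (z \<odot> x) (y \<odot> z) \<Longrightarrow> \<gamma>' \<in> Hom C (z \<odot> x) (y \<odot> z) \<Longrightarrow>
      F z (\<gamma> + \<gamma>') = F z \<gamma> + F z \<gamma>'"
    and nat: "\<And>z z' \<gamma> f. \<gamma> \<in> Hom C (z' \<odot> x) (y \<odot> z) \<Longrightarrow> f \<in> Hom C z z' \<Longrightarrow>
      F z (\<gamma> \<cdot> (f \<otimes> idm C x)) = F z' ((idm C y \<otimes> f) \<cdot> \<gamma>)"
    and \<gamma>: "\<gamma> \<in> Hom C (z \<odot> x) (y \<odot> z)" and \<gamma>': "\<gamma>' \<in> Hom C (z' \<odot> x) (y \<odot> z')"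
    and eq: "Psi x y z \<gamma> = Psi x y z' \<gamma>'"
  shows "F z \<gamma> = F z' \<gamma>'"
proof -
  have F0: "F z 0 = 0" for z
    using add[OF zero_in zero_in, of z] by simp
  have F_sum: "F z (sum f I) = (\<Sum>i\<in>I. F z (f i))"
    if "\<And>i. i \<in> I \<Longrightarrow> f i \<in> Hom C (z \<odot> x) (y \<odot> z)" for z and f :: "'c \<Rightarrow> 'b" and I
    using that by (induction I rule: infinite_finite_induct) (simp_all add: F0 add sum_in)
  have key: "F z \<gamma> = (\<Sum>w\<in>{w. Psi x y z \<gamma> w \<noteq> 0}. F w (Psi x y z \<gamma> w))"
    if \<gamma>: "\<gamma> \<in> Hom C (z \<odot> x) (y \<odot> z)" for z \<gamma>
  proof -
    define W where "W = {w\<in>Irr. \<exists>f\<in>Hom C w z. f \<noteq> 0}"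
    have W: "finite W" "W \<subseteq> Irr"
      using finite_constituents by (auto simp: W_def)
    have bb: "\<beta> \<cdot> \<beta>\<^sup>\<dagger> \<in> Hom C z z" "\<beta>\<^sup>\<dagger> \<in> Hom C z w" "\<beta> \<in> Hom C w z"
      if "\<beta> \<in> onb w z" "w \<in> W" for \<beta> w
      using onb(2)[of w \<beta> z] W that by (blast intro: comp_in adj_in)+
    have t: "\<gamma> \<cdot> ((\<beta> \<cdot> \<beta>\<^sup>\<dagger>) \<otimes> idm C x) \<in> Hom C (z \<odot> x) (y \<odot> z)"
      if "\<beta> \<in> onb w z" "w \<in> W" for \<beta> w
      using comp_in[OF mtens_in[OF bb(1)[OF that] idm_in] \<gamma>] .
    have Ft: "F z (\<gamma> \<cdot> ((\<beta> \<cdot> \<beta>\<^sup>\<dagger>) \<otimes> idm C x)) = F w ((idm C y \<otimes> \<beta>\<^sup>\<dagger>) \<cdot> \<gamma> \<cdot> (\<beta> \<otimes> idm C x))"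
      if "\<beta> \<in> onb w z" "w \<in> W" for \<beta> w
    proof -
      note b = bb[OF that]
      have "\<gamma> \<cdot> ((\<beta> \<cdot> \<beta>\<^sup>\<dagger>) \<otimes> idm C x) = (\<gamma> \<cdot> (\<beta> \<otimes> idm C x)) \<cdot> (\<beta>\<^sup>\<dagger> \<otimes> idm C x)"
        using comp_mtens_idm[OF b(2,3)]
          comp_assoc[OF mtens_in[OF b(2) idm_in] mtens_in[OF b(3) idm_in] \<gamma>] by simp
      then show ?thesis
        using nat[OF comp_in[OF mtens_in[OF b(3) idm_in] \<gamma>] b(2)] by simp
    qed
    have "\<gamma> = \<gamma> \<cdot> (idm C z \<otimes> idm C x)"
      using comp_idm[OF \<gamma>] by (simp add: mtens_idm)
    also have "\<dots> = \<gamma> \<cdot> ((\<Sum>w\<in>W. \<Sum>\<beta>\<in>onb w z. \<beta> \<cdot> \<beta>\<^sup>\<dagger>) \<otimes> idm C x)"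
      unfolding W_def resolution_of_identity[of z, symmetric] ..
    also have "\<dots> = \<gamma> \<cdot> (\<Sum>w\<in>W. \<Sum>\<beta>\<in>onb w z. (\<beta> \<cdot> \<beta>\<^sup>\<dagger>) \<otimes> idm C x)"
      using bb(1)
      by (subst mtens_sum_left[OF idm_in, where x = z and y = z])
        (auto intro!: sum_in arg_cong[where f = "\<lambda>t. \<gamma> \<cdot> t"] sum.cong mtens_sum_left[OF idm_in, where x = z and y = z])
    also have "\<dots> = (\<Sum>w\<in>W. \<Sum>\<beta>\<in>onb w z. \<gamma> \<cdot> ((\<beta> \<cdot> \<beta>\<^sup>\<dagger>) \<otimes> idm C x))"
      using bb(1)
      by (subst comp_sum_right[OF \<gamma>, where x = "z \<odot> x"])
        (auto intro!: sum_in sum.cong comp_sum_right[OF \<gamma>, where x = "z \<odot> x"] mtens_in idm_in)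
    finally have "F z \<gamma> = F z (\<Sum>w\<in>W. \<Sum>\<beta>\<in>onb w z. \<gamma> \<cdot> ((\<beta> \<cdot> \<beta>\<^sup>\<dagger>) \<otimes> idm C x))"
      by simp
    also have "\<dots> = (\<Sum>w\<in>W. \<Sum>\<beta>\<in>onb w z. F z (\<gamma> \<cdot> ((\<beta> \<cdot> \<beta>\<^sup>\<dagger>) \<otimes> idm C x)))"
    proof -
      have "F z (\<Sum>w\<in>W. \<Sum>\<beta>\<in>onb w z. \<gamma> \<cdot> ((\<beta> \<cdot> \<beta>\<^sup>\<dagger>) \<otimes> idm C x))
          = (\<Sum>w\<in>W. F z (\<Sum>\<beta>\<in>onb w z. \<gamma> \<cdot> ((\<beta> \<cdot> \<beta>\<^sup>\<dagger>) \<otimes> idm C x)))"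
        using t by (intro F_sum sum_in)
      also have "\<dots> = (\<Sum>w\<in>W. \<Sum>\<beta>\<in>onb w z. F z (\<gamma> \<cdot> ((\<beta> \<cdot> \<beta>\<^sup>\<dagger>) \<otimes> idm C x)))"
        using t by (intro sum.cong refl F_sum)
      finally show ?thesis .
    qed
    also have "\<dots> = (\<Sum>w\<in>W. \<Sum>\<beta>\<in>onb w z. F w ((idm C y \<otimes> \<beta>\<^sup>\<dagger>) \<cdot> \<gamma> \<cdot> (\<beta> \<otimes> idm C x)))"
      using Ft by (intro sum.cong refl) auto
    also have "\<dots> = (\<Sum>w\<in>W. F w (Psi x y z \<gamma> w))"
    proof (intro sum.cong refl)
      fix w assume w: "w \<in> W"
      then have "w \<in> Irr"
        using W by blast
      then show "(\<Sum>\<beta>\<in>onb w z. F w ((idm C y \<otimes> \<beta>\<^sup>\<dagger>) \<cdot> \<gamma> \<cdot> (\<beta> \<otimes> idm C x))) = F w (Psi x y z \<gamma> w)"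
        unfolding Psi_onb using Psi_term_in(3)[OF \<gamma>] by (simp add: F_sum)
    qed
    also have "\<dots> = (\<Sum>w\<in>{w. Psi x y z \<gamma> w \<noteq> 0}. F w (Psi x y z \<gamma> w))"
    proof (rule sum.mono_neutral_right[OF W(1)])
      show "{w. Psi x y z \<gamma> w \<noteq> 0} \<subseteq> W"
        using onb_empty[of _ z] by (auto simp: W_def Psi_onb split: if_splits) (metis sum.empty)
    qed (simp add: F0)
    finally show ?thesis .
  qed
  show ?thesis
    using key[OF \<gamma>] key[OF \<gamma>'] eq by simp
qed

lemma tube_mult_Psi:
  assumes \<gamma>\<^sub>1: "\<gamma>\<^sub>1 \<in> Hom C (z\<^sub>1 \<odot> u) (y \<odot> z\<^sub>1)" and \<gamma>\<^sub>2: "\<gamma>\<^sub>2 \<in> Hom C (z\<^sub>2 \<odot> x) (u \<odot> z\<^sub>2)"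
  shows "tube_mult C Irr x u y (Psi u y z\<^sub>1 \<gamma>\<^sub>1) (Psi x u z\<^sub>2 \<gamma>\<^sub>2) =
    Psi x y (z\<^sub>1 \<odot> z\<^sub>2) ((\<gamma>\<^sub>1 \<otimes> idm C z\<^sub>2) \<cdot> (idm C z\<^sub>1 \<otimes> \<gamma>\<^sub>2))"
proof -
  define P where "P z\<^sub>1 \<gamma>\<^sub>1 z\<^sub>2 \<gamma>\<^sub>2 = Psi x y (z\<^sub>1 \<odot> z\<^sub>2) ((\<gamma>\<^sub>1 \<otimes> idm C z\<^sub>2) \<cdot> (idm C z\<^sub>1 \<otimes> \<gamma>\<^sub>2))"
    for z\<^sub>1 \<gamma>\<^sub>1 z\<^sub>2 \<gamma>\<^sub>2
  have L: "\<gamma>\<^sub>1 \<otimes> idm C z\<^sub>2 \<in> Hom C (z\<^sub>1 \<odot> u \<odot> z\<^sub>2) (y \<odot> z\<^sub>1 \<odot> z\<^sub>2)"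
    if "\<gamma>\<^sub>1 \<in> Hom C (z\<^sub>1 \<odot> u) (y \<odot> z\<^sub>1)" for z\<^sub>1 z\<^sub>2 \<gamma>\<^sub>1
    using mtens_in[OF that idm_in[of z\<^sub>2]] by simp
  have R: "idm C z\<^sub>1 \<otimes> \<gamma>\<^sub>2 \<in> Hom C ((z\<^sub>1 \<odot> z\<^sub>2) \<odot> x) (z\<^sub>1 \<odot> u \<odot> z\<^sub>2)"
    if "\<gamma>\<^sub>2 \<in> Hom C (z\<^sub>2 \<odot> x) (u \<odot> z\<^sub>2)" for z\<^sub>1 z\<^sub>2 \<gamma>\<^sub>2
    using mtens_in[OF idm_in[of z\<^sub>1] that] by simp
  have LR: "(\<gamma>\<^sub>1 \<otimes> idm C z\<^sub>2) \<cdot> (idm C z\<^sub>1 \<otimes> \<gamma>\<^sub>2) \<in> Hom C ((z\<^sub>1 \<odot> z\<^sub>2) \<odot> x) (y \<odot> z\<^sub>1 \<odot> z\<^sub>2)"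
    if "\<gamma>\<^sub>1 \<in> Hom C (z\<^sub>1 \<odot> u) (y \<odot> z\<^sub>1)" "\<gamma>\<^sub>2 \<in> Hom C (z\<^sub>2 \<odot> x) (u \<odot> z\<^sub>2)" for z\<^sub>1 z\<^sub>2 \<gamma>\<^sub>1 \<gamma>\<^sub>2
    using comp_in[OF R[OF that(2)] L[OF that(1)]] .
  have left: "P z\<^sub>1 \<gamma>\<^sub>1 z\<^sub>2 \<gamma>\<^sub>2 = P z\<^sub>1' \<gamma>\<^sub>1' z\<^sub>2 \<gamma>\<^sub>2"
    if g: "\<gamma>\<^sub>1 \<in> Hom C (z\<^sub>1 \<odot> u) (y \<odot> z\<^sub>1)" "\<gamma>\<^sub>1' \<in> Hom C (z\<^sub>1' \<odot> u) (y \<odot> z\<^sub>1')"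
      "\<gamma>\<^sub>2 \<in> Hom C (z\<^sub>2 \<odot> x) (u \<odot> z\<^sub>2)"
      "Psi u y z\<^sub>1 \<gamma>\<^sub>1 = Psi u y z\<^sub>1' \<gamma>\<^sub>1'" for z\<^sub>1 z\<^sub>1' z\<^sub>2 \<gamma>\<^sub>1 \<gamma>\<^sub>1' \<gamma>\<^sub>2
  proof (rule ext)
    fix v
    show "P z\<^sub>1 \<gamma>\<^sub>1 z\<^sub>2 \<gamma>\<^sub>2 v = P z\<^sub>1' \<gamma>\<^sub>1' z\<^sub>2 \<gamma>\<^sub>2 v"
    proof (rule Psi_universal[OF _ _ g(1,2,4)])
      fix z \<gamma> \<gamma>'
      assume h: "\<gamma> \<in> Hom C (z \<odot> u) (y \<odot> z)" "\<gamma>' \<in> Hom C (z \<odot> u) (y \<odot> z)"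
      show "P z (\<gamma> + \<gamma>') z\<^sub>2 \<gamma>\<^sub>2 v = P z \<gamma> z\<^sub>2 \<gamma>\<^sub>2 v + P z \<gamma>' z\<^sub>2 \<gamma>\<^sub>2 v"
        unfolding P_def mtens_add_left[OF h idm_in] comp_add_left[OF R[OF g(3)] L[OF h(1)] L[OF h(2)]]
        by (rule Psi_add) (use LR h g(3) in auto)
    next
      fix z z' \<gamma> f
      assume h: "\<gamma> \<in> Hom C (z' \<odot> u) (y \<odot> z)" "f \<in> Hom C z z'"
      show "P z (\<gamma> \<cdot> (f \<otimes> idm C u)) z\<^sub>2 \<gamma>\<^sub>2 v = P z' ((idm C y \<otimes> f) \<cdot> \<gamma>) z\<^sub>2 \<gamma>\<^sub>2 v"
        unfolding P_def mult_dinatural_left(2,3)[OF h(1) g(3) h(2)]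
        using Psi_naturality[OF mult_dinatural_left(1)[OF h(1) g(3) h(2)] mtens_in[OF h(2) idm_in]] by simp
    qed
  qed
  have right: "P z\<^sub>1 \<gamma>\<^sub>1 z\<^sub>2 \<gamma>\<^sub>2 = P z\<^sub>1 \<gamma>\<^sub>1 z\<^sub>2' \<gamma>\<^sub>2'"
    if g: "\<gamma>\<^sub>2 \<in> Hom C (z\<^sub>2 \<odot> x) (u \<odot> z\<^sub>2)" "\<gamma>\<^sub>2' \<in> Hom C (z\<^sub>2' \<odot> x) (u \<odot> z\<^sub>2')"
      "\<gamma>\<^sub>1 \<in> Hom C (z\<^sub>1 \<odot> u) (y \<odot> z\<^sub>1)"
      "Psi x u z\<^sub>2 \<gamma>\<^sub>2 = Psi x u z\<^sub>2' \<gamma>\<^sub>2'" for z\<^sub>1 z\<^sub>2 z\<^sub>2' \<gamma>\<^sub>1 \<gamma>\<^sub>2 \<gamma>\<^sub>2'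
  proof (rule ext)
    fix v
    show "P z\<^sub>1 \<gamma>\<^sub>1 z\<^sub>2 \<gamma>\<^sub>2 v = P z\<^sub>1 \<gamma>\<^sub>1 z\<^sub>2' \<gamma>\<^sub>2' v"
    proof (rule Psi_universal[OF _ _ g(1,2,4)])
      fix z \<gamma> \<gamma>'
      assume h: "\<gamma> \<in> Hom C (z \<odot> x) (u \<odot> z)" "\<gamma>' \<in> Hom C (z \<odot> x) (u \<odot> z)"
      show "P z\<^sub>1 \<gamma>\<^sub>1 z (\<gamma> + \<gamma>') v = P z\<^sub>1 \<gamma>\<^sub>1 z \<gamma> v + P z\<^sub>1 \<gamma>\<^sub>1 z \<gamma>' v"
        unfolding P_def mtens_add_right[OF idm_in h] comp_add_right[OF R[OF h(1)] R[OF h(2)] L[OF g(3)]]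
        by (rule Psi_add) (use LR h g(3) in auto)
    next
      fix z z' \<gamma> f
      assume h: "\<gamma> \<in> Hom C (z' \<odot> x) (u \<odot> z)" "f \<in> Hom C z z'"
      show "P z\<^sub>1 \<gamma>\<^sub>1 z (\<gamma> \<cdot> (f \<otimes> idm C x)) v = P z\<^sub>1 \<gamma>\<^sub>1 z' ((idm C u \<otimes> f) \<cdot> \<gamma>) v"
        unfolding P_def mult_dinatural_right(2,3)[OF g(3) h]
        using Psi_naturality[OF mult_dinatural_right(1)[OF g(3) h] mtens_in[OF idm_in h(2)]] by simp
    qed
  qed
  show ?thesis
    unfolding tube_mult_def
  proof (rule the_equality, goal_cases)
    case 1
    show ?case
      using \<gamma>\<^sub>1 \<gamma>\<^sub>2 by blast
  next
    case (2 c)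
    then obtain z\<^sub>1' z\<^sub>2' \<gamma>\<^sub>1' \<gamma>\<^sub>2' where g: "\<gamma>\<^sub>1' \<in> Hom C (z\<^sub>1' \<odot> u) (y \<odot> z\<^sub>1')"
      "\<gamma>\<^sub>2' \<in> Hom C (z\<^sub>2' \<odot> x) (u \<odot> z\<^sub>2')"
      "Psi u y z\<^sub>1 \<gamma>\<^sub>1 = Psi u y z\<^sub>1' \<gamma>\<^sub>1'" "Psi x u z\<^sub>2 \<gamma>\<^sub>2 = Psi x u z\<^sub>2' \<gamma>\<^sub>2'"
      and c: "c = P z\<^sub>1' \<gamma>\<^sub>1' z\<^sub>2' \<gamma>\<^sub>2'"
      by (auto simp: P_def)
    show ?case
      using left[OF \<gamma>\<^sub>1 g(1) \<gamma>\<^sub>2 g(3)] right[OF \<gamma>\<^sub>2 g(2) g(1) g(4)] by (simp add: c P_def)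
  qed
qed

lemma tube_star_Psi:
  assumes \<gamma>: "\<gamma> \<in> Hom C (z \<odot> x) (y \<odot> z)"
  shows "tube_star C Irr cj R Rb x y (Psi x y z \<gamma>) =
    Psi y x (cj z) (rotation x y (cj z) (cj z) (R z) (Rb z) \<gamma>)"
proof -
  define Q where "Q z \<gamma> = Psi y x (cj z) (rotation x y (cj z) (cj z) (R z) (Rb z) \<gamma>)" for z \<gamma>
  have wd: "Q z \<gamma> = Q z' \<gamma>'" if g: "\<gamma> \<in> Hom C (z \<odot> x) (y \<odot> z)" "\<gamma>' \<in> Hom C (z' \<odot> x) (y \<odot> z')"
    "Psi x y z \<gamma> = Psi x y z' \<gamma>'" for z z' \<gamma> \<gamma>'
  proof (rule ext)
    fix v
    show "Q z \<gamma> v = Q z' \<gamma>' v"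
    proof (rule Psi_universal[OF _ _ g])
      fix z \<gamma> \<gamma>'
      assume h: "\<gamma> \<in> Hom C (z \<odot> x) (y \<odot> z)" "\<gamma>' \<in> Hom C (z \<odot> x) (y \<odot> z)"
      show "Q z (\<gamma> + \<gamma>') v = Q z \<gamma> v + Q z \<gamma>' v"
        unfolding Q_def rotation_add[OF R_in Rb_in h]
        by (intro Psi_add rotation_in[OF R_in Rb_in] h)
    next
      fix z z' \<gamma> f
      assume h: "\<gamma> \<in> Hom C (z' \<odot> x) (y \<odot> z)" "f \<in> Hom C z z'"
      obtain g where "g \<in> Hom C (cj z) (cj z')"
        "rotation x y (cj z) (cj z) (R z) (Rb z) (\<gamma> \<cdot> (f \<otimes> idm C x)) = rotation x y (cj z') (cj z) (R z') (Rb z) \<gamma> \<cdot> (g \<otimes> idm C y)"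
        "rotation x y (cj z') (cj z') (R z') (Rb z') ((idm C y \<otimes> f) \<cdot> \<gamma>) = (idm C x \<otimes> g) \<cdot> rotation x y (cj z') (cj z) (R z') (Rb z) \<gamma>"
        using star_dinatural[OF conj_sol conj_sol h] by blast
      then show "Q z (\<gamma> \<cdot> (f \<otimes> idm C x)) v = Q z' ((idm C y \<otimes> f) \<cdot> \<gamma>) v"
        using Psi_naturality[OF rotation_in[OF R_in Rb_in h(1)]] by (simp add: Q_def)
    qed
  qed
  show ?thesis
    unfolding tube_star_def
  proof (rule the_equality, goal_cases)
    case 1
    show ?case
      using \<gamma> by (auto simp: rotation_def)
  next
    case (2 c)
    then obtain z' \<gamma>' where g: "\<gamma>' \<in> Hom C (z' \<odot> x) (y \<odot> z')" "Psi x y z \<gamma> = Psi x y z' \<gamma>'"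
      and c: "c = Q z' \<gamma>'"
      by (auto simp: Q_def rotation_def)
    show ?case
      using wd[OF \<gamma> g] by (simp add: c Q_def)
  qed
qed

section \<open>Dimension and conjugation of simple objects\<close>

lemma cat_dim:
  "(R x)\<^sup>\<dagger> \<cdot> R x = cscale C (complex_of_real (cat_dim C R x)) (idm C \<one>)"
  "(Rb x)\<^sup>\<dagger> \<cdot> Rb x = cscale C (complex_of_real (cat_dim C R x)) (idm C \<one>)"
  "cat_dim C R x = (mnorm C (R x))\<^sup>2"
proof -
  have *: "(R x)\<^sup>\<dagger> \<cdot> R x = cscale C (complex_of_real ((mnorm C (R x))\<^sup>2)) (idm C \<one>)"
    by (rule adj_comp_simple[OF simple_unit R_in])
  show 1: "cat_dim C R x = (mnorm C (R x))\<^sup>2"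
    unfolding cat_dim_def
  proof (rule the_equality)
    show "(R x)\<^sup>\<dagger> \<cdot> R x = cscale C (complex_of_real ((mnorm C (R x))\<^sup>2)) (idm C \<one>)"
      by (rule *)
  next
    fix d
    assume "(R x)\<^sup>\<dagger> \<cdot> R x = cscale C (complex_of_real d) (idm C \<one>)"
    then show "d = (mnorm C (R x))\<^sup>2"
      using * simple_unit by (auto simp: simple_obj_def vs.scale_cancel_right simp flip: of_real_power)
  qed
  show 2: "(R x)\<^sup>\<dagger> \<cdot> R x = cscale C (complex_of_real (cat_dim C R x)) (idm C \<one>)"
    using * 1 by simp
  have "(R x)\<^sup>\<dagger> \<cdot> (idm C (cj x) \<otimes> idm C x) \<cdot> R x = (Rb x)\<^sup>\<dagger> \<cdot> (idm C x \<otimes> idm C (cj x)) \<cdot> Rb x"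
    using solutions idm_in unfolding standard_solutions_def by blast
  then show "(Rb x)\<^sup>\<dagger> \<cdot> Rb x = cscale C (complex_of_real (cat_dim C R x)) (idm C \<one>)"
    using 2 by (simp add: mtens_idm idm_comp[OF R_in] idm_comp[OF Rb_in])
qed

lemma cat_dim_pos:
  assumes "idm C x \<noteq> 0"
  shows "0 < cat_dim C R x"
proof -
  have "R x \<noteq> 0"
  proof
    assume "R x = 0"
    then have "(Rb x)\<^sup>\<dagger> \<otimes> idm C x \<cdot> idm C x \<otimes> 0 = idm C x"
      using transpose_inverse[OF conj_sol idm_in, of x]
        comp_zero_right[OF mtens_in[OF idm_in[of "cj x"] idm_in[of x]]] by simp
    then show False
      using assms comp_zero_right[OF mtens_in[OF adj_in[OF Rb_in[of x]] idm_in[of x]]]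
      by (simp add: mtens_zero_right[OF idm_in])
  qed
  then show ?thesis
    using mnorm_eq_0_iff[OF R_in] by (simp add: cat_dim(3))
qed

lemma transpose_eq_0:
  assumes f: "f \<in> Hom C (cj x) t" and 0: "(idm C x \<otimes> f) \<cdot> Rb x = 0"
  shows "f = 0"
  using transpose_inverse[OF conj_solution_swap[OF conj_sol] f] 0
    comp_zero_right[OF mtens_in[OF adj_in[OF R_in[of x]] idm_in[of t]]]
  by (simp add: mtens_zero_right[OF idm_in])

text \<open>
  Every morphism between conjugates is the conjugate of a morphism between the objects in the opposite
  direction.
\<close>

lemma ex_transpose:
  assumes h: "h \<in> Hom C (cj x) (cj y)"
  shows "\<exists>m\<in>Hom C y x. (m \<otimes> idm C (cj y)) \<cdot> Rb y = (idm C x \<otimes> h) \<cdot> Rb x"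
proof -
  define k where "k = (idm C x \<otimes> h) \<cdot> Rb x"
  have k: "k \<in> Hom C \<one> (x \<odot> cj y)"
    unfolding k_def using h Rb_in by (blast intro: tensor_intros)
  have "k \<otimes> idm C y \<in> Hom C y (x \<odot> cj y \<odot> y)" "idm C x \<otimes> (R y)\<^sup>\<dagger> \<in> Hom C (x \<odot> cj y \<odot> y) x"
    using mtens_in[OF k idm_in[of y]] mtens_in[OF idm_in[of x] adj_in[OF R_in[of y]]] by simp_all
  then have "(idm C x \<otimes> (R y)\<^sup>\<dagger>) \<cdot> (k \<otimes> idm C y) \<in> Hom C y x"
    by (rule comp_in)
  then show ?thesis
    using transpose_left_inverse[OF conj_sol k] unfolding k_def by blast
qed

text \<open>
  Transposition identifies the endomorphisms of the conjugate with those of \<open>x\<close> and maps scalars to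
  scalars.
\<close>

lemma simple_cj:
  assumes x: "simple_obj C x"
  shows "simple_obj C (cj x)"
proof -
  have "\<exists>c. f = cscale C c (idm C (cj x))" if f: "f \<in> Hom C (cj x) (cj x)" for f
  proof -
    obtain m where m: "m \<in> Hom C x x" "(m \<otimes> idm C (cj x)) \<cdot> Rb x = (idm C x \<otimes> f) \<cdot> Rb x"
      using ex_transpose[OF f] by blast
    obtain c where c: "m = cscale C c (idm C x)"
      using simple_scalar[OF x m(1)] .
    have d: "cscale C c (idm C (cj x)) \<in> Hom C (cj x) (cj x)"
      by (intro scale_in idm_in)
    have "(idm C x \<otimes> (f - cscale C c (idm C (cj x)))) \<cdot> Rb x
        = (idm C x \<otimes> f) \<cdot> Rb x - (idm C x \<otimes> cscale C c (idm C (cj x))) \<cdot> Rb x"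
    proof -
      have "idm C x \<otimes> f = idm C x \<otimes> (f - cscale C c (idm C (cj x))) + idm C x \<otimes> cscale C c (idm C (cj x))"
        using mtens_add_right[OF idm_in[of x] diff_in[OF f d] d] by simp
      then show ?thesis
        using comp_add_left[OF Rb_in mtens_in[OF idm_in diff_in[OF f d]] mtens_in[OF idm_in d]] by simp
    qed
    also have "(idm C x \<otimes> cscale C c (idm C (cj x))) = m \<otimes> idm C (cj x)"
      by (simp add: c mtens_cscale_right[OF idm_in idm_in] mtens_cscale_left[OF idm_in idm_in])
    finally have "f - cscale C c (idm C (cj x)) = 0"
      using m(2) by (intro transpose_eq_0[OF diff_in[OF f d]]) simp
    then show ?thesis
      by auto
  qed
  moreover have "idm C (cj x) \<noteq> 0"
  proof
    assume 0: "idm C (cj x) = 0"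
    have "R x = (idm C (cj x) \<otimes> idm C x) \<cdot> R x"
      using idm_comp[OF R_in] by (simp add: mtens_idm)
    then have "R x = 0"
      by (simp add: 0 mtens_zero_left[OF idm_in] comp_zero_left[OF R_in])
    then show False
      using cat_dim_pos[of x] x by (simp add: cat_dim(3) mnorm_0 simple_obj_def)
  qed
  ultimately show ?thesis
    by (auto simp: simple_obj_def intro: scale_in idm_in)
qed

lemma irr_rep:
  assumes "simple_obj C x"
  shows "irr_rep C Irr x \<in> Irr" "iso_obj C x (irr_rep C Irr x)"
proof -
  have "\<exists>!w. w \<in> Irr \<and> iso_obj C x w"
    using Irr assms by (auto simp: irr_representatives_def)
  from theI'[OF this] show "irr_rep C Irr x \<in> Irr" "iso_obj C x (irr_rep C Irr x)"
    by (simp_all add: irr_rep_def)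
qed

text \<open>
  A nonzero morphism between the conjugates transposes to a nonzero morphism between \<open>y\<close> and \<open>x\<close>, so
  Schur's lemma applies.
\<close>

lemma cj_inj:
  assumes x: "x \<in> Irr" and y: "y \<in> Irr" and eq: "irr_rep C Irr (cj x) = irr_rep C Irr (cj y)"
  shows "x = y"
proof (rule ccontr)
  assume ne: "x \<noteq> y"
  define w where "w = irr_rep C Irr (cj x)"
  have w: "w \<in> Irr" "iso_obj C (cj x) w" "iso_obj C (cj y) w"
    using irr_rep[OF simple_cj[OF Irr_simple[OF x]]] irr_rep[OF simple_cj[OF Irr_simple[OF y]]] eq
    by (auto simp: w_def)
  obtain f f' where f: "f \<in> Hom C (cj x) w" "f' \<in> Hom C w (cj x)" "f \<cdot> f' = idm C w"
    using w(2) by (auto simp: iso_obj_def)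
  obtain g g' where g: "g \<in> Hom C (cj y) w" "g' \<in> Hom C w (cj y)" "g \<cdot> g' = idm C w"
    using w(3) by (auto simp: iso_obj_def)
  have h: "g' \<cdot> f \<in> Hom C (cj x) (cj y)"
    using f g by (blast intro: comp_in)
  have hnz: "g' \<cdot> f \<noteq> 0"
  proof
    assume "g' \<cdot> f = 0"
    then have "f = 0"
      using comp_assoc[OF f(1) g(2,1)] g(3) idm_comp[OF f(1)] comp_zero_right[OF g(1)] by simp
    then show False
      using f(3) comp_zero_left[OF f(2)] Irr_simple[OF w(1)] by (simp add: simple_obj_def)
  qed
  obtain m where m: "m \<in> Hom C y x" "(m \<otimes> idm C (cj y)) \<cdot> Rb y = (idm C x \<otimes> (g' \<cdot> f)) \<cdot> Rb x"
    using ex_transpose[OF h] by blast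
  have "m = 0"
    using Schur_zero[OF y x _ m(1)] ne by blast
  then have "(idm C x \<otimes> (g' \<cdot> f)) \<cdot> Rb x = 0"
    using m(2) by (simp add: mtens_zero_left[OF idm_in] comp_zero_left[OF Rb_in])
  then show False
    using transpose_eq_0[OF h] hnz by simp
qed

section \<open>The Laplacian as a sum of squares\<close>

lemma Psi_iso:
  assumes "iso_obj C x y"
  shows "Psi \<one> \<one> x (idm C x) = Psi \<one> \<one> y (idm C y)"
proof -
  obtain f g where fg: "f \<in> Hom C x y" "g \<in> Hom C y x" "g \<cdot> f = idm C x" "f \<cdot> g = idm C y"
    using assms by (auto simp: iso_obj_def)
  show ?thesis
    using Psi_naturality[of g y \<one> \<one> x f] fg
    by (simp add: mtens_unit_left[OF fg(1)] mtens_unit_right[OF fg(1)])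
qed

text \<open>
  A tube supported on a subobject of \<open>z\<close> is a tube over that subobject.
\<close>

lemma Psi_absorb:
  assumes u: "u \<in> Hom C z0 z" "u\<^sup>\<dagger> \<cdot> u = idm C z0" and \<gamma>: "\<gamma> \<in> Hom C (z0 \<odot> x) (y \<odot> z0)"
  shows "Psi x y z (((idm C y \<otimes> u) \<cdot> \<gamma>) \<cdot> (u\<^sup>\<dagger> \<otimes> idm C x)) = Psi x y z0 \<gamma>"
proof -
  have yu: "idm C y \<otimes> u \<in> Hom C (y \<odot> z0) (y \<odot> z)" "idm C y \<otimes> u\<^sup>\<dagger> \<in> Hom C (y \<odot> z) (y \<odot> z0)"
    using mtens_in[OF idm_in u(1)] mtens_in[OF idm_in adj_in[OF u(1)]] .
  have "(idm C y \<otimes> u\<^sup>\<dagger>) \<cdot> (idm C y \<otimes> u) \<cdot> \<gamma> = \<gamma>"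
    using comp_assoc[OF \<gamma> yu] idm_mtens_comp[OF u(1) adj_in[OF u(1)], of y] u(2) idm_comp[OF \<gamma>]
    by (simp add: mtens_idm)
  then show ?thesis
    using Psi_naturality[OF comp_in[OF \<gamma> yu(1)] adj_in[OF u(1)]] by simp
qed

text \<open>
  By \<open>rotation_precomp\<close> and \<open>mult_middle\<close>, the summand of \<open>\<beta>\<close> is \<open>a a\<^sup>*\<close> with the projection \<open>\<beta> \<beta>\<^sup>\<dagger>\<close> inserted
  in the middle, and these projections sum to the identity of \<open>X\<close>.
\<close>

lemma tube_square_decomposition:
  assumes \<Gamma>: "\<Gamma> \<in> Hom C (z \<odot> X) (y \<odot> z)"
  defines "W \<equiv> {w\<in>Irr. \<exists>f\<in>Hom C w X. f \<noteq> 0}"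
  shows "(\<Sum>w\<in>W. \<Sum>\<beta>\<in>onb w X. tube_mult C Irr y w y (Psi w y z (\<Gamma> \<cdot> (idm C z \<otimes> \<beta>)))
        (tube_star C Irr cj R Rb w y (Psi w y z (\<Gamma> \<cdot> (idm C z \<otimes> \<beta>)))) v)
    = tube_mult C Irr y X y (Psi X y z \<Gamma>) (tube_star C Irr cj R Rb X y (Psi X y z \<Gamma>)) v"
proof -
  define D where "D = rotation X y (cj z) (cj z) (R z) (Rb z) \<Gamma>"
  have D: "D \<in> Hom C (cj z \<odot> y) (X \<odot> cj z)"
    unfolding D_def by (rule rotation_in[OF R_in Rb_in \<Gamma>])
  define L where "L p = Psi y y (z \<odot> cj z) ((\<Gamma> \<otimes> idm C (cj z)) \<cdot> (idm C z \<otimes> ((p \<otimes> idm C (cj z)) \<cdot> D))) v" for p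
  have G: "\<Gamma> \<otimes> idm C (cj z) \<in> Hom C (z \<odot> X \<odot> cj z) (y \<odot> z \<odot> cj z)"
    using mtens_in[OF \<Gamma> idm_in[of "cj z"]] by simp
  have p1: "p \<otimes> idm C (cj z) \<in> Hom C (X \<odot> cj z) (X \<odot> cj z)" if "p \<in> Hom C X X" for p
    using mtens_in[OF that idm_in] .
  have p2: "idm C z \<otimes> ((p \<otimes> idm C (cj z)) \<cdot> D) \<in> Hom C ((z \<odot> cj z) \<odot> y) (z \<odot> X \<odot> cj z)"
    if "p \<in> Hom C X X" for p
    using mtens_in[OF idm_in[of z] comp_in[OF D p1[OF that]]] by simp
  have L_add: "L (p + q) = L p + L q" if pq: "p \<in> Hom C X X" "q \<in> Hom C X X" for p q
    unfolding L_def mtens_add_left[OF pq idm_in] comp_add_left[OF D p1[OF pq(1)] p1[OF pq(2)]]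
      mtens_add_right[OF idm_in comp_in[OF D p1[OF pq(1)]] comp_in[OF D p1[OF pq(2)]]]
      comp_add_right[OF p2[OF pq(1)] p2[OF pq(2)] G]
    by (intro Psi_add) (use comp_in[OF p2[OF pq(1)] G] comp_in[OF p2[OF pq(2)] G] in simp_all)
  have L0: "L 0 = 0"
    using L_add[OF zero_in zero_in] by simp
  have L_sum: "L (sum f I) = (\<Sum>i\<in>I. L (f i))" if "\<And>i. i \<in> I \<Longrightarrow> f i \<in> Hom C X X"
    for f :: "'c \<Rightarrow> 'b" and I
    using that by (induction I rule: infinite_finite_induct) (simp_all add: L0 L_add sum_in)
  have bb: "\<beta> \<cdot> \<beta>\<^sup>\<dagger> \<in> Hom C X X" if "w \<in> W" "\<beta> \<in> onb w X" for w \<beta>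
    using that onb(2)[of w \<beta> X] by (auto simp: W_def intro: comp_in adj_in)
  have summand: "tube_mult C Irr y w y (Psi w y z (\<Gamma> \<cdot> (idm C z \<otimes> \<beta>)))
        (tube_star C Irr cj R Rb w y (Psi w y z (\<Gamma> \<cdot> (idm C z \<otimes> \<beta>)))) v = L (\<beta> \<cdot> \<beta>\<^sup>\<dagger>)"
    if "w \<in> W" "\<beta> \<in> onb w X" for w \<beta>
  proof -
    have b: "\<beta> \<in> Hom C w X"
      using that onb(2) by (auto simp: W_def)
    have g: "\<Gamma> \<cdot> (idm C z \<otimes> \<beta>) \<in> Hom C (z \<odot> w) (y \<odot> z)"
      using comp_in[OF mtens_in[OF idm_in b] \<Gamma>] .
    have r: "(\<beta>\<^sup>\<dagger> \<otimes> idm C (cj z)) \<cdot> D \<in> Hom C (cj z \<odot> y) (w \<odot> cj z)"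
      using comp_in[OF D mtens_in[OF adj_in[OF b] idm_in]] .
    show ?thesis
      unfolding tube_star_Psi[OF g] rotation_precomp[OF R_in Rb_in \<Gamma> b] D_def[symmetric]
        tube_mult_Psi[OF g r] L_def mult_middle[OF \<Gamma> D b] ..
  qed
  have "(\<Sum>w\<in>W. \<Sum>\<beta>\<in>onb w X. L (\<beta> \<cdot> \<beta>\<^sup>\<dagger>)) = (\<Sum>w\<in>W. L (\<Sum>\<beta>\<in>onb w X. \<beta> \<cdot> \<beta>\<^sup>\<dagger>))"
    using bb by (intro sum.cong refl L_sum[symmetric])
  also have "\<dots> = L (idm C X)"
    unfolding resolution_of_identity[of X, folded W_def] using bb by (intro L_sum[symmetric] sum_in)
  also have "\<dots> = tube_mult C Irr y X y (Psi X y z \<Gamma>) (tube_star C Irr cj R Rb X y (Psi X y z \<Gamma>)) v"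
    unfolding tube_star_Psi[OF \<Gamma>] D_def[symmetric] tube_mult_Psi[OF \<Gamma> D] L_def
    by (simp add: mtens_idm idm_comp[OF D])
  finally show ?thesis
    using summand by simp
qed

text \<open>
  The element is \<open>s\<close> times the difference of the cap \<open>R\<^sup>\<dagger>\<close> over \<open>\<one>\<close> and the cap \<open>Rb\<^sup>\<dagger> \<otimes> 1\<close> over \<open>x\<close>, the
  analogue of \<open>1 - h\<close> for a group element \<open>h\<close>.  The real factor \<open>s\<close> is carried along to absorb the weights of the
  Laplacian into the squares.
\<close>

lemma laplacian_square:
  fixes s :: real and x :: 'a
  defines "X \<equiv> cj x \<odot> x"
  shows "\<exists>z. \<exists>\<Gamma>\<in>Hom C (z \<odot> X) (\<one> \<odot> z). \<forall>v.
    tube_mult C Irr \<one> X \<one> (Psi X \<one> z \<Gamma>) (tube_star C Irr cj R Rb X \<one> (Psi X \<one> z \<Gamma>)) v =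
    cscale C (complex_of_real (s\<^sup>2)) (cscale C (complex_of_real (2 * cat_dim C R x)) (Psi \<one> \<one> \<one> (idm C \<one>) v)
      - Psi \<one> \<one> x (idm C x) v - Psi \<one> \<one> (cj x) (idm C (cj x)) v)"
proof -
  obtain z e g where e: "e \<in> Hom C \<one> z" "e\<^sup>\<dagger> \<cdot> e = idm C \<one>" and g: "g \<in> Hom C x z" "g\<^sup>\<dagger> \<cdot> g = idm C x"
    using direct_sums[of \<one> x] by blast
  have \<rho>: "(R x)\<^sup>\<dagger> \<in> Hom C (\<one> \<odot> X) (\<one> \<odot> \<one>)"
    using adj_in[OF R_in[of x]] by (simp add: X_def)
  have \<rho>': "R x \<in> Hom C (\<one> \<odot> \<one>) (X \<odot> \<one>)"
    using R_in[of x] by (simp add: X_def)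
  define \<sigma> where "\<sigma> = (Rb x)\<^sup>\<dagger> \<otimes> idm C x"
  have \<sigma>: "\<sigma> \<in> Hom C (x \<odot> X) (\<one> \<odot> x)"
    using mtens_in[OF adj_in[OF Rb_in[of x]] idm_in[of x]] by (simp add: X_def \<sigma>_def)
  have \<sigma>': "idm C (cj x) \<otimes> Rb x \<in> Hom C (cj x \<odot> \<one>) (X \<odot> cj x)"
    using mtens_in[OF idm_in[of "cj x"] Rb_in[of x]] by (simp add: X_def)
  \<comment> \<open>the two parts of the difference, supported on the summands \<open>\<one>\<close> and \<open>x\<close> of \<open>z\<close>\<close>
  define G1 where "G1 = ((idm C \<one> \<otimes> e) \<cdot> (R x)\<^sup>\<dagger>) \<cdot> (e\<^sup>\<dagger> \<otimes> idm C X)"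
  define G2 where "G2 = ((idm C \<one> \<otimes> g) \<cdot> \<sigma>) \<cdot> (g\<^sup>\<dagger> \<otimes> idm C X)"
  have G1: "G1 \<in> Hom C (z \<odot> X) (\<one> \<odot> z)"
    unfolding G1_def
    by (rule comp_in[OF mtens_in[OF adj_in[OF e(1)] idm_in] comp_in[OF \<rho> mtens_in[OF idm_in e(1)]]])
  have G2: "G2 \<in> Hom C (z \<odot> X) (\<one> \<odot> z)"
    unfolding G2_def
    by (rule comp_in[OF mtens_in[OF adj_in[OF g(1)] idm_in] comp_in[OF \<sigma> mtens_in[OF idm_in g(1)]]])
  have A1: "Psi X \<one> z G1 = Psi X \<one> \<one> ((R x)\<^sup>\<dagger>)"
    unfolding G1_def by (rule Psi_absorb[OF e \<rho>])
  have A2: "Psi X \<one> z G2 = Psi X \<one> x \<sigma>"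
    unfolding G2_def by (rule Psi_absorb[OF g \<sigma>])
  define D1 where "D1 = rotation X \<one> (cj z) (cj z) (R z) (Rb z) G1"
  define D2 where "D2 = rotation X \<one> (cj z) (cj z) (R z) (Rb z) G2"
  have D1: "D1 \<in> Hom C (cj z \<odot> \<one>) (X \<odot> cj z)" and D2: "D2 \<in> Hom C (cj z \<odot> \<one>) (X \<odot> cj z)"
    unfolding D1_def D2_def by (intro rotation_in[OF R_in Rb_in] G1 G2)+
  have B1: "Psi \<one> X (cj z) D1 = Psi \<one> X \<one> (R x)"
  proof -
    have "Psi \<one> X (cj z) D1 = tube_star C Irr cj R Rb X \<one> (Psi X \<one> \<one> ((R x)\<^sup>\<dagger>))"
      unfolding D1_def A1[symmetric] tube_star_Psi[OF G1] ..
    also have "\<dots> = Psi \<one> X (cj \<one>) ((idm C X \<otimes> Rb \<one>) \<cdot> (((R x)\<^sup>\<dagger>)\<^sup>\<dagger> \<cdot> (R \<one>)\<^sup>\<dagger>))"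
      using rotation_unit(1)[OF conj_sol, of "(R x)\<^sup>\<dagger>" X] \<rho> by (simp add: tube_star_Psi[OF \<rho>])
    also have "((R x)\<^sup>\<dagger>)\<^sup>\<dagger> = R x"
      by (rule adj_adj[OF R_in])
    also have "Psi \<one> X (cj \<one>) ((idm C X \<otimes> Rb \<one>) \<cdot> (R x \<cdot> (R \<one>)\<^sup>\<dagger>))
        = Psi \<one> X \<one> ((R x \<cdot> (R \<one>)\<^sup>\<dagger>) \<cdot> (Rb \<one> \<otimes> idm C \<one>))"
      using Psi_naturality[of "R x \<cdot> (R \<one>)\<^sup>\<dagger>" "cj \<one>" \<one> X \<one> "Rb \<one>"] \<rho>' R_in[of \<one>] Rb_in[of \<one>]
      by (simp add: comp_in[OF adj_in])
    also have "(R x \<cdot> (R \<one>)\<^sup>\<dagger>) \<cdot> (Rb \<one> \<otimes> idm C \<one>) = R x"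
      using comp_assoc[of "Rb \<one>" \<one> "cj \<one>" "(R \<one>)\<^sup>\<dagger>" \<one> "R x"] R_in[of \<one>] Rb_in[of \<one>]
        rotation_unit(2)[OF conj_sol zero_in] comp_idm[OF R_in] R_in[of x]
      by (simp add: mtens_unit_right[OF Rb_in] adj_in)
    finally show ?thesis .
  qed
  have B2: "Psi \<one> X (cj z) D2 = Psi \<one> X (cj x) (idm C (cj x) \<otimes> Rb x)"
  proof -
    have "Psi \<one> X (cj z) D2 = tube_star C Irr cj R Rb X \<one> (Psi X \<one> x \<sigma>)"
      unfolding D2_def A2[symmetric] tube_star_Psi[OF G2] ..
    also have "\<dots> = Psi \<one> X (cj x) (idm C (cj x) \<otimes> Rb x)"
      unfolding tube_star_Psi[OF \<sigma>] unfolding \<sigma>_def X_def rotation_eval[OF conj_sol] ..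
    finally show ?thesis .
  qed
  define N where "N \<gamma> \<delta> = (\<gamma> \<otimes> idm C (cj z)) \<cdot> (idm C z \<otimes> \<delta>)" for \<gamma> \<delta>
  have Nl: "\<gamma> \<otimes> idm C (cj z) \<in> Hom C (z \<odot> X \<odot> cj z) (z \<odot> cj z)" if "\<gamma> \<in> Hom C (z \<odot> X) (\<one> \<odot> z)" for \<gamma>
    using mtens_in[OF that idm_in[of "cj z"]] by simp
  have Nr: "idm C z \<otimes> \<delta> \<in> Hom C (z \<odot> cj z) (z \<odot> X \<odot> cj z)" if "\<delta> \<in> Hom C (cj z \<odot> \<one>) (X \<odot> cj z)" for \<delta>
    using mtens_in[OF idm_in[of z] that] by simp
  have N_in: "N \<gamma> \<delta> \<in> Hom C ((z \<odot> cj z) \<odot> \<one>) (\<one> \<odot> (z \<odot> cj z))"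
    if "\<gamma> \<in> Hom C (z \<odot> X) (\<one> \<odot> z)" "\<delta> \<in> Hom C (cj z \<odot> \<one>) (X \<odot> cj z)" for \<gamma> \<delta>
    unfolding N_def using comp_in[OF Nr[OF that(2)] Nl[OF that(1)]] by simp
  \<comment> \<open>the product as a bilinear form in representatives over \<open>z\<close> and its conjugate;
      by well-definedness its values may be computed over \<open>\<one>\<close> and \<open>x\<close> instead\<close>
  define P where "P \<gamma> \<delta> v = Psi \<one> \<one> (z \<odot> cj z) (N \<gamma> \<delta>) v" for \<gamma> \<delta> v
  have P_mult: "P \<gamma> \<delta> v = tube_mult C Irr \<one> X \<one> (Psi X \<one> z \<gamma>) (Psi \<one> X (cj z) \<delta>) v"
    if "\<gamma> \<in> Hom C (z \<odot> X) (\<one> \<odot> z)" "\<delta> \<in> Hom C (cj z \<odot> \<one>) (X \<odot> cj z)" for \<gamma> \<delta> v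
    by (simp add: P_def N_def tube_mult_Psi[OF that])
  have P_add_left: "P (\<gamma> + \<gamma>') \<delta> v = P \<gamma> \<delta> v + P \<gamma>' \<delta> v"
    if h: "\<gamma> \<in> Hom C (z \<odot> X) (\<one> \<odot> z)" "\<gamma>' \<in> Hom C (z \<odot> X) (\<one> \<odot> z)" "\<delta> \<in> Hom C (cj z \<odot> \<one>) (X \<odot> cj z)" for \<gamma> \<gamma>' \<delta> v
    using Psi_add[OF N_in[OF h(1,3)] N_in[OF h(2,3)], of v]
    by (simp add: P_def N_def mtens_add_left[OF h(1,2) idm_in] comp_add_left[OF Nr[OF h(3)] Nl[OF h(1)] Nl[OF h(2)]])
  have P_add_right: "P \<gamma> (\<delta> + \<delta>') v = P \<gamma> \<delta> v + P \<gamma> \<delta>' v"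
    if h: "\<gamma> \<in> Hom C (z \<odot> X) (\<one> \<odot> z)" "\<delta> \<in> Hom C (cj z \<odot> \<one>) (X \<odot> cj z)" "\<delta>' \<in> Hom C (cj z \<odot> \<one>) (X \<odot> cj z)" for \<gamma> \<delta> \<delta>' v
    using Psi_add[OF N_in[OF h(1,2)] N_in[OF h(1,3)], of v]
    by (simp add: P_def N_def mtens_add_right[OF idm_in h(2,3)] comp_add_right[OF Nr[OF h(2)] Nr[OF h(3)] Nl[OF h(1)]])
  have P_scale: "P (cscale C c \<gamma>) (cscale C c' \<delta>) v = cscale C (c * c') (P \<gamma> \<delta> v)"
    if h: "\<gamma> \<in> Hom C (z \<odot> X) (\<one> \<odot> z)" "\<delta> \<in> Hom C (cj z \<odot> \<one>) (X \<odot> cj z)" for \<gamma> \<delta> c c' v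
    using Psi_scale[OF N_in[OF h], of "c * c'" v]
    by (simp add: P_def N_def mtens_cscale_left[OF h(1) idm_in] mtens_cscale_right[OF idm_in h(2)]
        comp_cscale_left[OF scale_in[OF Nr[OF h(2)]] Nl[OF h(1)]] comp_cscale_right[OF Nr[OF h(2)] Nl[OF h(1)]])
  have P_diff: "P (G1 - G2) (D1 - D2) v = P G1 D1 v - P G1 D2 v - (P G2 D1 v - P G2 D2 v)" for v
    using P_add_left[OF diff_in[OF G1 G2] G2 diff_in[OF D1 D2], of v]
      P_add_right[OF G1 diff_in[OF D1 D2] D2, of v] P_add_right[OF G2 diff_in[OF D1 D2] D2, of v]
    by (simp add: algebra_simps)
  have P11: "P G1 D1 v = cscale C (complex_of_real (cat_dim C R x)) (Psi \<one> \<one> \<one> (idm C \<one>) v)" for v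
    using tube_mult_Psi[OF \<rho> \<rho>'] Psi_scale[of "idm C \<one>" \<one> \<one> \<one>] idm_in[of \<one>]
    by (simp add: P_mult[OF G1 D1] A1 B1 mtens_unit_right[OF adj_in[OF R_in]] mtens_unit_left[OF R_in] cat_dim)
  have P12: "P G1 D2 v = Psi \<one> \<one> (cj x) (idm C (cj x)) v" for v
    using tube_mult_Psi[OF \<rho> \<sigma>'] mtens_unit_left[OF \<sigma>']
    by (simp add: P_mult[OF G1 D2] A1 B2 conj_solution_products(1)[OF conj_sol])
  have P21: "P G2 D1 v = Psi \<one> \<one> x (idm C x) v" for v
    using tube_mult_Psi[OF \<sigma> \<rho>'] mtens_unit_right[OF \<sigma>]
    by (simp add: P_mult[OF G2 D1] A2 B1 \<sigma>_def conj_solution_products(2)[OF conj_sol])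
  have P22: "P G2 D2 v = cscale C (complex_of_real (cat_dim C R x)) (Psi \<one> \<one> \<one> (idm C \<one>) v)" for v
  proof -
    have "P G2 D2 v = Psi \<one> \<one> (x \<odot> cj x) (Rb x \<cdot> (Rb x)\<^sup>\<dagger>) v"
      using tube_mult_Psi[OF \<sigma> \<sigma>']
      by (simp add: P_mult[OF G2 D2] A2 B2 \<sigma>_def conj_solution_products(3)[OF conj_sol])
    also have "\<dots> = Psi \<one> \<one> \<one> ((Rb x)\<^sup>\<dagger> \<cdot> Rb x) v"
      using Psi_naturality[of "Rb x" \<one> \<one> \<one> "x \<odot> cj x" "(Rb x)\<^sup>\<dagger>"] Rb_in[of x] adj_in[OF Rb_in[of x]]
        mtens_unit_left[OF adj_in[OF Rb_in[of x]]] mtens_unit_right[OF adj_in[OF Rb_in[of x]]]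
      by simp
    finally show ?thesis
      using Psi_scale[of "idm C \<one>" \<one> \<one> \<one>] idm_in[of \<one>] by (simp add: cat_dim)
  qed
  define \<Gamma> where "\<Gamma> = cscale C (complex_of_real s) (G1 - G2)"
  have \<Gamma>: "\<Gamma> \<in> Hom C (z \<odot> X) (\<one> \<odot> z)"
    unfolding \<Gamma>_def by (intro scale_in diff_in G1 G2)
  have star: "rotation X \<one> (cj z) (cj z) (R z) (Rb z) \<Gamma> = cscale C (complex_of_real s) (D1 - D2)"
    unfolding \<Gamma>_def rotation_scale[OF R_in Rb_in diff_in[OF G1 G2]] rotation_diff[OF R_in Rb_in G1 G2] D1_def D2_def
    by simp
  have m1: "tube_mult C Irr \<one> X \<one> (Psi X \<one> z \<Gamma>) (tube_star C Irr cj R Rb X \<one> (Psi X \<one> z \<Gamma>)) v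
      = P \<Gamma> (cscale C (complex_of_real s) (D1 - D2)) v" for v
    unfolding tube_star_Psi[OF \<Gamma>] star
    by (rule P_mult[symmetric, OF \<Gamma> scale_in[OF diff_in[OF D1 D2]]])
  have m2: "P \<Gamma> (cscale C (complex_of_real s) (D1 - D2)) v
      = cscale C (complex_of_real (s\<^sup>2)) (P (G1 - G2) (D1 - D2) v)" for v
    unfolding \<Gamma>_def P_scale[OF diff_in[OF G1 G2] diff_in[OF D1 D2]] by (simp add: power2_eq_square)
  have m3: "P (G1 - G2) (D1 - D2) v = cscale C (complex_of_real (2 * cat_dim C R x)) (Psi \<one> \<one> \<one> (idm C \<one>) v)
      - Psi \<one> \<one> x (idm C x) v - Psi \<one> \<one> (cj x) (idm C (cj x)) v" for v
  proof -
    have "cscale C (complex_of_real (2 * cat_dim C R x)) t = cscale C (complex_of_real (cat_dim C R x)) t + cscale C (complex_of_real (cat_dim C R x)) t" for t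
      by (simp flip: vs.scale_left_distrib)
    then show ?thesis
      unfolding P_diff P11 P12 P21 P22 by (simp add: algebra_simps)
  qed
  show ?thesis
    using \<Gamma> by (intro exI[of _ z] bexI[of _ \<Gamma>] allI) (simp_all only: m1 m2 m3)
qed

lemma tube_cone_finite_sum:
  assumes c: "c \<in> fusion_space Irr" and I: "finite I"
    and a: "\<And>i. i \<in> I \<Longrightarrow> x i \<in> Irr \<and> a i \<in> tube_block C Irr (x i) \<one>"
    and eq: "\<And>v. fusion_to_tube C Irr c v =
      (\<Sum>i\<in>I. tube_mult C Irr \<one> (x i) \<one> (a i) (tube_star C Irr cj R Rb (x i) \<one> (a i)) v)"
  shows "c \<in> tube_cone C Irr cj R Rb"
proof -
  obtain h where h: "bij_betw h {0..<card I} I"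
    using ex_bij_betw_nat_finite[OF I] by blast
  have "(\<Sum>i<card I. tube_mult C Irr \<one> (x (h i)) \<one> (a (h i)) (tube_star C Irr cj R Rb (x (h i)) \<one> (a (h i))) v)
      = fusion_to_tube C Irr c v" for v
    unfolding eq
    using sum.reindex_bij_betw[OF h, of "\<lambda>i. tube_mult C Irr \<one> (x i) \<one> (a i) (tube_star C Irr cj R Rb (x i) \<one> (a i)) v"]
    by (simp add: lessThan_atLeast0)
  moreover have "h i \<in> I" if "i < card I" for i
    using h that by (auto simp: bij_betw_def)
  ultimately show ?thesis
    unfolding tube_cone_def
    using c a by (auto intro!: exI[of _ "card I"] exI[of _ "x \<circ> h"] exI[of _ "a \<circ> h"])
qed

text \<open>
  Conjugation is a weight-preserving permutation of \<open>S\<close>, so that the terms \<open>x\<close> and \<open>cj x\<close> of the squares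
  contribute equally; the weighted dimensions add up to \<open>\<kappa>\<close>, which is positive.
\<close>

lemma laplacian_in_tube_cone:
  assumes S: "finite S" "S \<subseteq> Irr" "S \<noteq> {}"
    and sym: "symmetric_set C Irr cj S" and \<nu>: "symmetric_weight C Irr cj S \<nu>"
  shows "laplacian C R S \<nu> \<in> tube_cone C Irr cj R Rb"
proof -
  define \<kappa> where "\<kappa> = weight_total C R S \<nu>"
  have \<nu>_pos: "\<nu> x > 0" if "x \<in> S" for x
    using that \<nu> unfolding symmetric_weight_def by blast
  have d_pos: "cat_dim C R x > 0" if "x \<in> S" for x
    using that S Irr_simple by (intro cat_dim_pos) (auto simp: simple_obj_def)
  have \<kappa>: "\<kappa> > 0"
    unfolding \<kappa>_def weight_total_def using S \<nu>_pos d_pos by (intro sum_pos) auto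
  define E where "E x v = Psi \<one> \<one> x (idm C x) v" for x v
  define t where "t x = irr_rep C Irr (cj x)" for x
  have tS: "t x \<in> S" if "x \<in> S" for x
    using sym that S by (auto simp: symmetric_set_def t_def)
  have \<nu>t: "\<nu> (t x) = \<nu> x" if "x \<in> S" for x
    using that \<nu> unfolding symmetric_weight_def t_def by metis
  have t_bij: "bij_betw t S S"
  proof -
    have "inj_on t S"
      using cj_inj S by (auto simp: inj_on_def t_def)
    then show ?thesis
      using tS S(1) by (simp add: bij_betw_def endo_inj_surj image_subsetI)
  qed
  have Et: "Psi \<one> \<one> (cj x) (idm C (cj x)) v = E (t x) v" if "x \<in> S" for x v
    using Psi_iso[OF irr_rep(2)[OF simple_cj[OF Irr_simple]]] that S by (auto simp: E_def t_def)
  \<comment> \<open>\<open>2 \<kappa>\<close> because each element of \<open>S\<close> occurs twice, as itself and as a conjugate\<close>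
  define s where "s x = sqrt (\<nu> x / (2 * \<kappa>))" for x
  have s2: "(s x)\<^sup>2 = \<nu> x / (2 * \<kappa>)" if "x \<in> S" for x
    using \<nu>_pos[OF that] \<kappa> by (simp add: s_def)
  define sq where "sq x z \<Gamma> \<longleftrightarrow> \<Gamma> \<in> Hom C (z \<odot> (cj x \<odot> x)) (\<one> \<odot> z) \<and> (\<forall>v.
      tube_mult C Irr \<one> (cj x \<odot> x) \<one> (Psi (cj x \<odot> x) \<one> z \<Gamma>)
        (tube_star C Irr cj R Rb (cj x \<odot> x) \<one> (Psi (cj x \<odot> x) \<one> z \<Gamma>)) v =
      cscale C (complex_of_real ((s x)\<^sup>2)) (cscale C (complex_of_real (2 * cat_dim C R x)) (E \<one> v)
        - E x v - Psi \<one> \<one> (cj x) (idm C (cj x)) v))" for x z \<Gamma>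
  have "\<exists>z \<Gamma>. sq x z \<Gamma>" for x
    using laplacian_square[of x "s x"] unfolding sq_def E_def by blast
  then obtain z \<Gamma> where "\<And>x. sq x (z x) (\<Gamma> x)"
    by metis
  then have \<Gamma>: "\<And>x. \<Gamma> x \<in> Hom C (z x \<odot> (cj x \<odot> x)) (\<one> \<odot> z x)"
    and sq: "\<And>x v. tube_mult C Irr \<one> (cj x \<odot> x) \<one> (Psi (cj x \<odot> x) \<one> (z x) (\<Gamma> x))
        (tube_star C Irr cj R Rb (cj x \<odot> x) \<one> (Psi (cj x \<odot> x) \<one> (z x) (\<Gamma> x))) v =
      cscale C (complex_of_real ((s x)\<^sup>2)) (cscale C (complex_of_real (2 * cat_dim C R x)) (E \<one> v)
        - E x v - Psi \<one> \<one> (cj x) (idm C (cj x)) v)"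
    by (simp_all only: sq_def)
  define W where "W x = {w\<in>Irr. \<exists>f\<in>Hom C w (cj x \<odot> x). f \<noteq> 0}" for x
  define a where "a = (\<lambda>(x, w, \<beta>). Psi w \<one> (z x) (\<Gamma> x \<cdot> (idm C (z x) \<otimes> \<beta>)))"
  define I where "I = (SIGMA x:S. SIGMA w:W x. onb w (cj x \<odot> x))"
  have W: "finite (W x)" "W x \<subseteq> Irr" for x
    using finite_constituents by (auto simp: W_def)
  have fin_onb: "finite (onb w (cj x \<odot> x))" if "w \<in> W x" for w x
    using that W onb(1) by blast
  have fin: "finite (SIGMA w:W x. onb w (cj x \<odot> x))" for x
    by (intro finite_SigmaI W fin_onb)
  have 1: "(\<Sum>i\<in>I. tube_mult C Irr \<one> (fst (snd i)) \<one> (a i) (tube_star C Irr cj R Rb (fst (snd i)) \<one> (a i)) v)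
      = E \<one> v - cscale C (complex_of_real (1 / \<kappa>)) (\<Sum>x\<in>S. cscale C (complex_of_real (\<nu> x)) (E x v))" for v
  proof -
    have "(\<Sum>i\<in>I. tube_mult C Irr \<one> (fst (snd i)) \<one> (a i) (tube_star C Irr cj R Rb (fst (snd i)) \<one> (a i)) v)
      = (\<Sum>x\<in>S. \<Sum>w\<in>W x. \<Sum>\<beta>\<in>onb w (cj x \<odot> x). tube_mult C Irr \<one> w \<one> (a (x, w, \<beta>)) (tube_star C Irr cj R Rb w \<one> (a (x, w, \<beta>))) v)"
    proof -
      define T where "T x w \<beta> = tube_mult C Irr \<one> w \<one> (a (x, w, \<beta>)) (tube_star C Irr cj R Rb w \<one> (a (x, w, \<beta>))) v" for x w \<beta>
      have "(\<Sum>x\<in>S. \<Sum>w\<in>W x. \<Sum>\<beta>\<in>onb w (cj x \<odot> x). T x w \<beta>)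
          = (\<Sum>x\<in>S. \<Sum>(w, \<beta>)\<in>(SIGMA w:W x. onb w (cj x \<odot> x)). T x w \<beta>)"
        using W fin_onb by (intro sum.cong refl sum.Sigma) blast+
      also have "\<dots> = (\<Sum>(x, w, \<beta>)\<in>I. T x w \<beta>)"
        unfolding I_def using S(1) fin by (subst sum.Sigma) (auto simp: split_def)
      finally show ?thesis
        by (simp add: T_def split_def)
    qed
    also have "\<dots> = (\<Sum>x\<in>S. cscale C (complex_of_real (\<nu> x / (2 * \<kappa>)))
        (cscale C (complex_of_real (2 * cat_dim C R x)) (E \<one> v) - E x v - E (t x) v))"
    proof (intro sum.cong refl)
      fix x assume x: "x \<in> S"
      show "(\<Sum>w\<in>W x. \<Sum>\<beta>\<in>onb w (cj x \<odot> x). tube_mult C Irr \<one> w \<one> (a (x, w, \<beta>)) (tube_star C Irr cj R Rb w \<one> (a (x, w, \<beta>))) v)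
        = cscale C (complex_of_real (\<nu> x / (2 * \<kappa>)))
          (cscale C (complex_of_real (2 * cat_dim C R x)) (E \<one> v) - E x v - E (t x) v)"
        unfolding a_def W_def prod.case tube_square_decomposition[OF \<Gamma>] sq s2[OF x] Et[OF x] ..
    qed
    also have "\<dots> = (\<Sum>x\<in>S. cscale C (complex_of_real (\<nu> x * cat_dim C R x / \<kappa>)) (E \<one> v))
        - (\<Sum>x\<in>S. cscale C (complex_of_real (\<nu> x / (2 * \<kappa>))) (E x v))
        - (\<Sum>x\<in>S. cscale C (complex_of_real (\<nu> x / (2 * \<kappa>))) (E (t x) v))"
      using \<kappa> by (simp add: vs.scale_right_diff_distrib sum_subtractf)
    also have "(\<Sum>x\<in>S. cscale C (complex_of_real (\<nu> x / (2 * \<kappa>))) (E (t x) v))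
        = (\<Sum>x\<in>S. cscale C (complex_of_real (\<nu> (t x) / (2 * \<kappa>))) (E (t x) v))"
      using \<nu>t by (intro sum.cong) auto
    also have "\<dots> = (\<Sum>x\<in>S. cscale C (complex_of_real (\<nu> x / (2 * \<kappa>))) (E x v))"
      by (rule sum.reindex_bij_betw[OF t_bij])
    also have "(\<Sum>x\<in>S. cscale C (complex_of_real (\<nu> x * cat_dim C R x / \<kappa>)) (E \<one> v)) = E \<one> v"
    proof -
      have one: "(\<Sum>x\<in>S. \<nu> x * cat_dim C R x / \<kappa>) = 1"
        using \<kappa> by (simp add: \<kappa>_def weight_total_def flip: sum_divide_distrib)
      show ?thesis
        unfolding vs.scale_sum_left[symmetric] of_real_sum[symmetric] one by simp
    qed
    finally have "(\<Sum>i\<in>I. tube_mult C Irr \<one> (fst (snd i)) \<one> (a i) (tube_star C Irr cj R Rb (fst (snd i)) \<one> (a i)) v)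
      = E \<one> v - ((\<Sum>x\<in>S. cscale C (complex_of_real (\<nu> x / (2 * \<kappa>))) (E x v)) + (\<Sum>x\<in>S. cscale C (complex_of_real (\<nu> x / (2 * \<kappa>))) (E x v)))"
      by simp
    also have "(\<Sum>x\<in>S. cscale C (complex_of_real (\<nu> x / (2 * \<kappa>))) (E x v)) + (\<Sum>x\<in>S. cscale C (complex_of_real (\<nu> x / (2 * \<kappa>))) (E x v))
      = cscale C (complex_of_real (1 / \<kappa>)) (\<Sum>x\<in>S. cscale C (complex_of_real (\<nu> x)) (E x v))"
    proof -
      have half: "complex_of_real (\<nu> x / (2 * \<kappa>)) + complex_of_real (\<nu> x / (2 * \<kappa>)) = complex_of_real (1 / \<kappa>) * complex_of_real (\<nu> x)" for x
        using \<kappa> by (simp add: field_simps flip: of_real_add of_real_mult)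
      show ?thesis
        unfolding sum.distrib[symmetric] vs.scale_left_distrib[symmetric] half vs.scale_sum_right by simp
    qed
    finally show ?thesis .
  qed
  define c where "c = laplacian C R S \<nu>"
  have c_eq: "c w = (if w = \<one> then 1 else 0) - complex_of_real (1 / \<kappa>) * (if w \<in> S then complex_of_real (\<nu> w) else 0)" for w
    using S(1) by (simp add: c_def laplacian_def fusion_basis_def \<kappa>_def if_distrib[of "\<lambda>u. _ * u"] cong: if_cong)
  have supp: "{w. c w \<noteq> 0} \<subseteq> insert \<one> S"
    by (auto simp: c_eq)
  have c_in: "c \<in> fusion_space Irr"
    using supp S finite_subset[OF supp] unit_Irr by (auto simp: fusion_space_def)
  have "fusion_to_tube C Irr c v = E \<one> v - cscale C (complex_of_real (1 / \<kappa>)) (\<Sum>x\<in>S. cscale C (complex_of_real (\<nu> x)) (E x v))" for v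
  proof -
    have "fusion_to_tube C Irr c v = (\<Sum>w\<in>insert \<one> S. cscale C (c w) (E w v))"
      unfolding fusion_to_tube_def E_def using S(1) supp by (intro sum.mono_neutral_left) auto
    also have "\<dots> = (\<Sum>w\<in>insert \<one> S. cscale C (if w = \<one> then 1 else 0) (E w v))
        - (\<Sum>w\<in>insert \<one> S. cscale C (complex_of_real (1 / \<kappa>) * (if w \<in> S then complex_of_real (\<nu> w) else 0)) (E w v))"
      unfolding c_eq by (simp add: vs.scale_left_diff_distrib sum_subtractf del: sum.insert_if)
    also have "(\<Sum>w\<in>insert \<one> S. cscale C (if w = \<one> then 1 else 0) (E w v)) = (\<Sum>w\<in>insert \<one> S. if w = \<one> then E w v else 0)"
      by (intro sum.cong) auto
    also have "\<dots> = E \<one> v"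
      using S(1) by (subst sum.delta) auto
    also have "(\<Sum>w\<in>insert \<one> S. cscale C (complex_of_real (1 / \<kappa>) * (if w \<in> S then complex_of_real (\<nu> w) else 0)) (E w v))
        = (\<Sum>w\<in>S. cscale C (complex_of_real (1 / \<kappa>) * complex_of_real (\<nu> w)) (E w v))"
      using S(1) by (intro sum.mono_neutral_cong_right) auto
    also have "\<dots> = cscale C (complex_of_real (1 / \<kappa>)) (\<Sum>x\<in>S. cscale C (complex_of_real (\<nu> x)) (E x v))"
      by (simp add: vs.scale_sum_right)
    finally show ?thesis .
  qed
  moreover have "fst (snd i) \<in> Irr \<and> a i \<in> tube_block C Irr (fst (snd i)) \<one>" if i: "i \<in> I" for i
  proof -
    obtain x w \<beta> where iw: "i = (x, w, \<beta>)" "x \<in> S" "w \<in> W x" "\<beta> \<in> onb w (cj x \<odot> x)"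
      using i by (auto simp: I_def)
    have w: "w \<in> Irr"
      using iw(3) W by blast
    then have b: "\<beta> \<in> Hom C w (cj x \<odot> x)"
      using onb(2) iw(4) by blast
    show ?thesis
      using Psi_in_tube_block[OF comp_in[OF mtens_in[OF idm_in b] \<Gamma>]] w by (simp add: iw(1) a_def)
  qed
  moreover have "finite I"
    unfolding I_def by (intro finite_SigmaI S(1) W fin_onb)
  ultimately show ?thesis
    unfolding c_def[symmetric] using c_in 1
    by (intro tube_cone_finite_sum[where I = I and x = "\<lambda>i. fst (snd i)" and a = a]) auto
qed

end

theorem proposition1p2:
  fixes C :: "('o, 'm::ab_group_add) tensor_cat"
    and Irr S :: "'o set"
    and cj :: "'o \<Rightarrow> 'o"
    and R Rb :: "'o \<Rightarrow> 'm"
    and \<nu> :: "'o \<Rightarrow> real"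
  assumes "cstar_tensor_category C"
    and "rigid C"
    and "simple_obj C (tunit C)"
    and "countable (simple_classes C)"
    and "irr_representatives C Irr"
    and "standard_solutions C cj R Rb"
    and "finite S" and "S \<subseteq> Irr"
    and "symmetric_set C Irr cj S"
    and "generating_set C Irr S"
    and "symmetric_weight C Irr cj S \<nu>"
  shows "laplacian C R S \<nu> \<in> tube_cone C Irr cj R Rb"
proof -
  interpret rigid_cstar_category C Irr cj R Rb
    using assms by (simp add: rigid_cstar_category_def rigid_cstar_category_axioms_def)
  have "S \<noteq> {}"
    using assms(10) unit_Irr by (fastforce simp: generating_set_def)
  then show ?thesis
    using laplacian_in_tube_cone assms by blast
qed

end
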